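(* Let $(H_N)_{N\in\mathbb N}$ be a sequence of converging Hilbert spaces with asymptotic space $H_\infty$, given by linear maps $\Psi_N:\mathcal C\to H_N$, $N\in\overline{\mathbb N}=\mathbb N\cup\{\infty\}$. For each $N\in\overline{\mathbb N}$ let $(G^N_\alpha)_{\alpha>0}$ be a strongly continuous contraction resolvent of symmetric operators on $H_N$, with generator $\Delta_N$, closed form $(\mathcal E^N,\mathcal D(\mathcal E^N))$ and semigroup $(T^N_t)_{t>0}$. The following are equivalent. (i) $G_\alpha^N\to G_\alpha^\infty$ strongly for every $\alpha>0$. (ii) (a) If $u_N\in H_N$ ($N\in\overline{\mathbb N}$), $u_N\to u_\infty$ strongly and $\alpha>0$, then $\lim_{N\to\infty}\mathcal E^N_\alpha(G_\alpha^Nu_N,G_\alpha^Nu_N)=\mathcal E^\infty_\alpha(G_\alpha^\infty u_\infty,G_\alpha^\infty u_\infty)$; and (b) for every $u\in\mathcal D(\mathcal E^\infty)$ there are $u_N\in\mathcal D(\mathcal E^N)$, $N\in\mathbb N$, with $u_N\to u$ strongly and $\lim_{N\to\infty}\mathcal E^N(u_N,u_N)=\mathcal E^\infty(u,u)$. (iii) (a) If $u_N\in H_N$ ($N\in\overline{\mathbb N}$) and $u_N\to u_\infty$ weakly, then $\mathcal E^\infty(u_\infty,u_\infty)\le\liminf_{N\to\infty}\mathcal E^N(u_N,u_N)$ (where $\mathcal E^N(v,v):=+\infty$ for $v\notin\mathcal D(\mathcal E^N)$, so that finiteness of the right hand side entails $u_\infty\in\mathcal D(\mathcal E^\infty)$);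 and (b) there is a dense linear subspace $V$ of $(\mathcal D(\mathcal E^\infty),\mathcal E_1^\infty)$ such that for every $u\in V$ there are $u_N\in\mathcal D(\mathcal E^N)$, $N\in\mathbb N$, with $u_N\to u$ strongly and $\lim_{N\to\infty}\mathcal E^N(u_N,u_N)=\mathcal E^\infty(u,u)$. (iv) (a) There exists $\alpha>0$ such that for every $\varphi\in\mathcal C$ and every weak accumulation point $u$ of $(G_\alpha^N\Psi_N\varphi)_{N\in\mathbb N}$, with corresponding weakly convergent subsection $G_\alpha^{N_k}\Psi_{N_k}\varphi\to u$ ($k\to\infty$), it holds that $\mathcal E^\infty(u,u)\le\liminf_{k\to\infty}\mathcal E^{N_k}(G_\alpha^{N_k}\Psi_{N_k}\varphi,G_\alpha^{N_k}\Psi_{N_k}\varphi)$ (in particular $u\in\mathcal D(\mathcal E^\infty)$); and (b) property (b) of (iii) holds. (v) $(-\Delta_N)^p\,T^N_t\to(-\Delta_\infty)^p\,T^\infty_t$ strongly for all $t>0$ and $p\ge0$.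
   Context: All Hilbert spaces are real and separable. A sequence of converging Hilbert spaces consists of a Hilbert space $(H_\infty,\langle\cdot,\cdot\rangle_\infty)$, a dense linear subspace $\mathcal C\subseteq H_\infty$, Hilbert spaces $(H_N,\langle\cdot,\cdot\rangle_N)$, $N\in\mathbb N$, and linear maps $\Psi_N:\mathcal C\to H_N$, $N\in\overline{\mathbb N}$, such that $\Psi_\infty\varphi=\varphi$ and $\lim_{N\to\infty}\langle\Psi_N\varphi,\Psi_N\varphi\rangle_N=\langle\varphi,\varphi\rangle_\infty$ for $\varphi\in\mathcal C$. A section is a family $(u_N)_{N\in\overline{\mathbb N}}$ with $u_N\in H_N$. It converges strongly ($u_N\to u_\infty$ strongly) if $\langle u_N,\Psi_N\varphi\rangle_N\to\langle u_\infty,\varphi\rangle_\infty$ for all $\varphi\in\mathcal C$ and $\|u_N\|_N\to\|u_\infty\|_\infty$. It converges weakly if $\langle u_N,v_N\rangle_N\to\langle u_\infty,v_\infty\rangle_\infty$ for every strongly convergent section $(v_N)$. For $N_1<N_2<\dots$ in $\mathbb N$ (and $N_\infty=\infty$), $(u_{N_k})_{k\in\overline{\mathbb N}}$ is a subsection, and the notions of convergence apply to it with respect to the converging Hilbert spaces $H_{N_k}$, $k\in\mathbb N$. $u$ is a weak accumulation point of $(u_N)_{N\in\mathbb N}$ if some subsequence $(u_{N_k})$ converges weakly to $u\in H_\infty$ in this sense. Bounded linear operators $L_N$ on $H_N$, $N\in\overline{\mathbb N}$, converge strongly, $L_N\to L_\infty$, if $L_Nu_N\to L_\infty u_\infty$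 strongly for every strongly convergent section $(u_N)$. For the resolvent $(G_\alpha^N)_{\alpha>0}$ (so $\alpha G_\alpha^N$ is a contraction): $\Delta_N=\mathrm{id}-(G_1^N)^{-1}$ with domain $\mathrm{Im}(G_1^N)$, so that $G_\alpha^N=(\alpha-\Delta_N)^{-1}$; $(\mathcal E^N,\mathcal D(\mathcal E^N))$ is the closure on $H_N$ of $\mathcal E^N(u,v)=\langle u,-\Delta_Nv\rangle_N$, $u,v\in\mathcal D(\Delta_N)$; $\mathcal E^N_\alpha(u,v)=\mathcal E^N(u,v)+\alpha\langle u,v\rangle_N$; $T_t^N=\exp(t\Delta_N)$ by functional calculus (the spectrum of $\Delta_N$ lies in $(-\infty,0]$). *)

theory Defs
  imports "HOL-Analysis.Analysis"
begin

section \<open>Hilbert spaces on a carrier\<close>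

text \<open>
  HOL has no families of types, so a Hilbert space is a linear subspace \<open>H\<close> of a real vector
  space with an inner product \<open>ip\<close> of its own; \<open>ip\<close> is meaningful on \<open>H\<close> only. A family of
  Hilbert spaces has carriers in one vector space (for instance their algebraic direct sum), and
  neither a topology of that space nor a relation between the inner products is assumed.
\<close>

definition ip_norm :: "('a \<Rightarrow> 'a \<Rightarrow> real) \<Rightarrow> 'a \<Rightarrow> real" where
  "ip_norm ip x = sqrt (ip x x)"

text \<open>The locale \<open>Metric_space\<close> wants a distance that is nonnegative and symmetric also outside
  the carrier, hence the case distinction.\<close>

definition ip_dist :: "'a::real_vector set \<Rightarrow> ('a \<Rightarrow> 'a \<Rightarrow> real) \<Rightarrow> 'a \<Rightarrow> 'a \<Rightarrow> real" where
  "ip_dist H ip x y = (if x \<in> H \<and> y \<in> H then ip_norm ip (x - y) else 0)"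

abbreviation ip_topology :: "'a::real_vector set \<Rightarrow> ('a \<Rightarrow> 'a \<Rightarrow> real) \<Rightarrow> 'a topology" where
  "ip_topology H ip \<equiv> Metric_space.mtopology H (ip_dist H ip)"

definition inner_product_on :: "'a::real_vector set \<Rightarrow> ('a \<Rightarrow> 'a \<Rightarrow> real) \<Rightarrow> bool" where
  "inner_product_on H ip \<longleftrightarrow>
     (\<forall>x\<in>H. \<forall>y\<in>H. ip x y = ip y x) \<and>
     (\<forall>x\<in>H. \<forall>y\<in>H. \<forall>z\<in>H. ip (x + y) z = ip x z + ip y z) \<and>
     (\<forall>c. \<forall>x\<in>H. \<forall>y\<in>H. ip (c *\<^sub>R x) y = c * ip x y) \<and>
     (\<forall>x\<in>H. x \<noteq> 0 \<longrightarrow> ip x x > 0)"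

definition separable_hilbert_space ::
  "'a::real_vector set \<Rightarrow> ('a \<Rightarrow> 'a \<Rightarrow> real) \<Rightarrow> bool" where
  "separable_hilbert_space H ip \<longleftrightarrow>
     subspace H \<and> inner_product_on H ip \<and>
     Metric_space.mcomplete H (ip_dist H ip) \<and> separable_space (ip_topology H ip)"

definition dense_subspace ::
  "'a::real_vector set \<Rightarrow> ('a \<Rightarrow> 'a \<Rightarrow> real) \<Rightarrow> 'a set \<Rightarrow> bool" where
  "dense_subspace H ip V \<longleftrightarrow> subspace V \<and> V \<subseteq> H \<and> ip_topology H ip closure_of V = H"

definition linear_between ::
  "'a::real_vector set \<Rightarrow> 'a set \<Rightarrow> ('a \<Rightarrow> 'a) \<Rightarrow> bool" where
  "linear_between S T f \<longleftrightarrow>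
     f ` S \<subseteq> T \<and> (\<forall>x\<in>S. \<forall>y\<in>S. f (x + y) = f x + f y) \<and> (\<forall>c. \<forall>x\<in>S. f (c *\<^sub>R x) = c *\<^sub>R f x)"

definition bounded_operator ::
  "'a::real_vector set \<Rightarrow> ('a \<Rightarrow> 'a \<Rightarrow> real) \<Rightarrow> ('a \<Rightarrow> 'a) \<Rightarrow> bool" where
  "bounded_operator H ip L \<longleftrightarrow>
     linear_between H H L \<and> (\<exists>K. \<forall>x\<in>H. ip_norm ip (L x) \<le> K * ip_norm ip x)"


section \<open>Converging Hilbert spaces\<close>

text \<open>The index set \<open>\<nat> \<union> {\<infinity>}\<close> is \<^typ>\<open>enat\<close>; a section is a function on \<^typ>\<open>enat\<close>.\<close>

definition converging_hilbert_spaces ::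
  "(enat \<Rightarrow> 'a::real_vector set) \<Rightarrow> (enat \<Rightarrow> 'a \<Rightarrow> 'a \<Rightarrow> real) \<Rightarrow> 'a set \<Rightarrow>
   (enat \<Rightarrow> 'a \<Rightarrow> 'a) \<Rightarrow> bool" where
  "converging_hilbert_spaces H ip C \<Psi> \<longleftrightarrow>
     (\<forall>N. separable_hilbert_space (H N) (ip N)) \<and>
     dense_subspace (H \<infinity>) (ip \<infinity>) C \<and>
     (\<forall>N. linear_between C (H N) (\<Psi> N)) \<and>
     (\<forall>\<phi>\<in>C. \<Psi> \<infinity> \<phi> = \<phi>) \<and>
     (\<forall>\<phi>\<in>C. (\<lambda>n. ip (enat n) (\<Psi> (enat n) \<phi>) (\<Psi> (enat n) \<phi>)) \<longlonglongrightarrow> ip \<infinity> \<phi> \<phi>)"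

definition strongly_conv ::
  "(enat \<Rightarrow> 'a::real_vector set) \<Rightarrow> (enat \<Rightarrow> 'a \<Rightarrow> 'a \<Rightarrow> real) \<Rightarrow> 'a set \<Rightarrow>
   (enat \<Rightarrow> 'a \<Rightarrow> 'a) \<Rightarrow> (enat \<Rightarrow> 'a) \<Rightarrow> bool" where
  "strongly_conv H ip C \<Psi> u \<longleftrightarrow>
     (\<forall>N. u N \<in> H N) \<and>
     (\<forall>\<phi>\<in>C. (\<lambda>n. ip (enat n) (u (enat n)) (\<Psi> (enat n) \<phi>)) \<longlonglongrightarrow> ip \<infinity> (u \<infinity>) \<phi>) \<and>
     (\<lambda>n. ip_norm (ip (enat n)) (u (enat n))) \<longlonglongrightarrow> ip_norm (ip \<infinity>) (u \<infinity>)"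

definition weakly_conv ::
  "(enat \<Rightarrow> 'a::real_vector set) \<Rightarrow> (enat \<Rightarrow> 'a \<Rightarrow> 'a \<Rightarrow> real) \<Rightarrow> 'a set \<Rightarrow>
   (enat \<Rightarrow> 'a \<Rightarrow> 'a) \<Rightarrow> (enat \<Rightarrow> 'a) \<Rightarrow> bool" where
  "weakly_conv H ip C \<Psi> u \<longleftrightarrow>
     (\<forall>N. u N \<in> H N) \<and>
     (\<forall>v. strongly_conv H ip C \<Psi> v \<longrightarrow>
        (\<lambda>n. ip (enat n) (u (enat n)) (v (enat n))) \<longlonglongrightarrow> ip \<infinity> (u \<infinity>) (v \<infinity>))"

definition section_of :: "(nat \<Rightarrow> 'a) \<Rightarrow> 'a \<Rightarrow> enat \<Rightarrow> 'a" where
  "section_of x u N = (case N of enat n \<Rightarrow> x n | \<infinity> \<Rightarrow> u)"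

text \<open>For strictly increasing \<open>r\<close>, the subfamily \<open>H\<^bsub>r k\<^esub>\<close> with \<open>H\<^bsub>\<infinity>\<^esub>\<close> as limit is \<open>H \<circ> subindex r\<close>.\<close>

definition subindex :: "(nat \<Rightarrow> nat) \<Rightarrow> enat \<Rightarrow> enat" where
  "subindex r = section_of (\<lambda>k. enat (r k)) \<infinity>"

definition subseq_weakly_conv ::
  "(enat \<Rightarrow> 'a::real_vector set) \<Rightarrow> (enat \<Rightarrow> 'a \<Rightarrow> 'a \<Rightarrow> real) \<Rightarrow> 'a set \<Rightarrow>
   (enat \<Rightarrow> 'a \<Rightarrow> 'a) \<Rightarrow> (nat \<Rightarrow> nat) \<Rightarrow> (nat \<Rightarrow> 'a) \<Rightarrow> 'a \<Rightarrow> bool" where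
  "subseq_weakly_conv H ip C \<Psi> r x u \<longleftrightarrow>
     strict_mono r \<and>
     weakly_conv (H \<circ> subindex r) (ip \<circ> subindex r) C (\<Psi> \<circ> subindex r)
       (section_of (x \<circ> r) u)"

definition operators_strongly_conv ::
  "(enat \<Rightarrow> 'a::real_vector set) \<Rightarrow> (enat \<Rightarrow> 'a \<Rightarrow> 'a \<Rightarrow> real) \<Rightarrow> 'a set \<Rightarrow>
   (enat \<Rightarrow> 'a \<Rightarrow> 'a) \<Rightarrow> (enat \<Rightarrow> 'a \<Rightarrow> 'a) \<Rightarrow> bool" where
  "operators_strongly_conv H ip C \<Psi> L \<longleftrightarrow>
     (\<forall>N. bounded_operator (H N) (ip N) (L N)) \<and>
     (\<forall>u. strongly_conv H ip C \<Psi> u \<longrightarrow> strongly_conv H ip C \<Psi> (\<lambda>N. L N (u N)))"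


section \<open>Resolvents, generators and forms\<close>

definition symmetric_resolvent ::
  "'a::real_vector set \<Rightarrow> ('a \<Rightarrow> 'a \<Rightarrow> real) \<Rightarrow> (real \<Rightarrow> 'a \<Rightarrow> 'a) \<Rightarrow> bool" where
  "symmetric_resolvent H ip G \<longleftrightarrow>
     (\<forall>\<alpha>>0. linear_between H H (G \<alpha>)) \<and>
     (\<forall>\<alpha>>0. \<forall>u\<in>H. ip_norm ip (\<alpha> *\<^sub>R G \<alpha> u) \<le> ip_norm ip u) \<and>
     (\<forall>\<alpha>>0. \<forall>u\<in>H. \<forall>v\<in>H. ip (G \<alpha> u) v = ip u (G \<alpha> v)) \<and>
     (\<forall>\<alpha>>0. \<forall>\<beta>>0. \<forall>u\<in>H. G \<alpha> u - G \<beta> u = (\<beta> - \<alpha>) *\<^sub>R G \<alpha> (G \<beta> u)) \<and>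
     (\<forall>u\<in>H. ((\<lambda>\<alpha>. ip_norm ip (\<alpha> *\<^sub>R G \<alpha> u - u)) \<longlongrightarrow> 0) at_top)"

definition gen_dom :: "'a::real_vector set \<Rightarrow> (real \<Rightarrow> 'a \<Rightarrow> 'a) \<Rightarrow> 'a set" where
  "gen_dom H G = G 1 ` H"

definition gen :: "'a::real_vector set \<Rightarrow> (real \<Rightarrow> 'a \<Rightarrow> 'a) \<Rightarrow> 'a \<Rightarrow> 'a" where
  "gen H G u = u - inv_into H (G 1) u"

text \<open>Closure on \<open>H\<close> of a closable nonnegative symmetric form \<open>e\<close> with domain \<open>D\<close>: limits along
  \<open>e\<close>-Cauchy sequences in \<open>D\<close> that converge in \<open>H\<close>.\<close>

definition form_approx ::
  "'a::real_vector set \<Rightarrow> ('a \<Rightarrow> 'a \<Rightarrow> real) \<Rightarrow> 'a set \<Rightarrow> ('a \<Rightarrow> 'a \<Rightarrow> real) \<Rightarrow>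
   (nat \<Rightarrow> 'a) \<Rightarrow> 'a \<Rightarrow> bool" where
  "form_approx H ip D e w u \<longleftrightarrow>
     range w \<subseteq> D \<and> limitin (ip_topology H ip) w u sequentially \<and>
     (\<forall>\<epsilon>>0. \<exists>M. \<forall>m\<ge>M. \<forall>n\<ge>M. e (w m - w n) (w m - w n) < \<epsilon>)"

definition form_closure_dom ::
  "'a::real_vector set \<Rightarrow> ('a \<Rightarrow> 'a \<Rightarrow> real) \<Rightarrow> 'a set \<Rightarrow> ('a \<Rightarrow> 'a \<Rightarrow> real) \<Rightarrow> 'a set" where
  "form_closure_dom H ip D e = {u. \<exists>w. form_approx H ip D e w u}"

definition form_closure ::
  "'a::real_vector set \<Rightarrow> ('a \<Rightarrow> 'a \<Rightarrow> real) \<Rightarrow> 'a set \<Rightarrow> ('a \<Rightarrow> 'a \<Rightarrow> real) \<Rightarrow>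
   'a \<Rightarrow> 'a \<Rightarrow> real" where
  "form_closure H ip D e u v =
     (THE c. \<forall>w z. form_approx H ip D e w u \<longrightarrow> form_approx H ip D e z v \<longrightarrow>
        (\<lambda>n. e (w n) (z n)) \<longlonglongrightarrow> c)"

definition form_dom ::
  "'a::real_vector set \<Rightarrow> ('a \<Rightarrow> 'a \<Rightarrow> real) \<Rightarrow> (real \<Rightarrow> 'a \<Rightarrow> 'a) \<Rightarrow> 'a set" where
  "form_dom H ip G = form_closure_dom H ip (gen_dom H G) (\<lambda>u v. ip u (- gen H G v))"

definition form ::
  "'a::real_vector set \<Rightarrow> ('a \<Rightarrow> 'a \<Rightarrow> real) \<Rightarrow> (real \<Rightarrow> 'a \<Rightarrow> 'a) \<Rightarrow> 'a \<Rightarrow> 'a \<Rightarrow> real" where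
  "form H ip G = form_closure H ip (gen_dom H G) (\<lambda>u v. ip u (- gen H G v))"

definition form_shift ::
  "'a::real_vector set \<Rightarrow> ('a \<Rightarrow> 'a \<Rightarrow> real) \<Rightarrow> (real \<Rightarrow> 'a \<Rightarrow> 'a) \<Rightarrow>
   real \<Rightarrow> 'a \<Rightarrow> 'a \<Rightarrow> real" where
  "form_shift H ip G \<alpha> u v = form H ip G u v + \<alpha> * ip u v"

definition energy ::
  "'a::real_vector set \<Rightarrow> ('a \<Rightarrow> 'a \<Rightarrow> real) \<Rightarrow> (real \<Rightarrow> 'a \<Rightarrow> 'a) \<Rightarrow> 'a \<Rightarrow> ereal" where
  "energy H ip G u = (if u \<in> form_dom H ip G then ereal (form H ip G u u) else \<infinity>)"


section \<open>Functional calculus\<close>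

text \<open>
  For a self-adjoint operator \<open>A\<close> with domain \<open>D\<close> and spectrum in \<open>[0, \<infinity>)\<close>, there is exactly one
  contractive homomorphism \<open>\<Phi>\<close> from the algebra of continuous functions on \<open>[0, \<infinity>)\<close> vanishing at
  infinity to the bounded operators that maps \<open>1 / (\<alpha> + \<cdot>)\<close> to \<open>(\<alpha> + A)\<^sup>-\<^sup>1\<close>. (As a HOL function
  \<open>\<Phi>\<close> is only unique on these functions and on vectors of \<open>H\<close>, hence the choice operator.)
  It is extended to unbounded continuous \<open>f\<close> by \<open>f(A) = e(A)\<^sup>-\<^sup>1 (e f)(A)\<close>, for any \<open>e\<close> such
  that \<open>e\<close> and \<open>e f\<close> vanish at infinity and \<open>e(A)\<close> is injective; the result does not depend on \<open>e\<close>.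
\<close>

definition C0_halfline :: "(real \<Rightarrow> real) set" where
  "C0_halfline = {f. continuous_on {0..} f \<and> (f \<longlongrightarrow> 0) at_top}"

definition C0_calculus ::
  "'a::real_vector set \<Rightarrow> ('a \<Rightarrow> 'a \<Rightarrow> real) \<Rightarrow> 'a set \<Rightarrow> ('a \<Rightarrow> 'a) \<Rightarrow>
   ((real \<Rightarrow> real) \<Rightarrow> 'a \<Rightarrow> 'a) \<Rightarrow> bool" where
  "C0_calculus H ip D A \<Phi> \<longleftrightarrow>
     (\<forall>f\<in>C0_halfline. linear_between H H (\<Phi> f)) \<and>
     (\<forall>f\<in>C0_halfline. \<forall>u\<in>H. ip_norm ip (\<Phi> f u) \<le> (SUP x\<in>{0..}. \<bar>f x\<bar>) * ip_norm ip u) \<and>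
     (\<forall>f\<in>C0_halfline. \<forall>u\<in>H. \<forall>v\<in>H. ip (\<Phi> f u) v = ip u (\<Phi> f v)) \<and>
     (\<forall>f\<in>C0_halfline. \<forall>g\<in>C0_halfline. \<forall>u\<in>H. \<Phi> (\<lambda>x. f x + g x) u = \<Phi> f u + \<Phi> g u) \<and>
     (\<forall>c. \<forall>f\<in>C0_halfline. \<forall>u\<in>H. \<Phi> (\<lambda>x. c * f x) u = c *\<^sub>R \<Phi> f u) \<and>
     (\<forall>f\<in>C0_halfline. \<forall>g\<in>C0_halfline. \<forall>u\<in>H. \<Phi> (\<lambda>x. f x * g x) u = \<Phi> f (\<Phi> g u)) \<and>
     (\<forall>\<alpha>>0. (\<forall>u\<in>H. \<Phi> (\<lambda>x. 1 / (\<alpha> + x)) u \<in> D \<and>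
                 \<alpha> *\<^sub>R \<Phi> (\<lambda>x. 1 / (\<alpha> + x)) u + A (\<Phi> (\<lambda>x. 1 / (\<alpha> + x)) u) = u) \<and>
            (\<forall>u\<in>D. \<Phi> (\<lambda>x. 1 / (\<alpha> + x)) (\<alpha> *\<^sub>R u + A u) = u))"

definition fun_calc_graph ::
  "'a::real_vector set \<Rightarrow> ('a \<Rightarrow> 'a \<Rightarrow> real) \<Rightarrow> 'a set \<Rightarrow> ('a \<Rightarrow> 'a) \<Rightarrow>
   (real \<Rightarrow> real) \<Rightarrow> 'a \<Rightarrow> 'a \<Rightarrow> bool" where
  "fun_calc_graph H ip D A f u v \<longleftrightarrow>
     (let \<Phi> = (SOME \<Phi>. C0_calculus H ip D A \<Phi>) in
      u \<in> H \<and> v \<in> H \<and>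
      (\<exists>e\<in>C0_halfline. (\<lambda>x. e x * f x) \<in> C0_halfline \<and> inj_on (\<Phi> e) H \<and>
         \<Phi> e v = \<Phi> (\<lambda>x. e x * f x) u))"

definition fun_calc ::
  "'a::real_vector set \<Rightarrow> ('a \<Rightarrow> 'a \<Rightarrow> real) \<Rightarrow> 'a set \<Rightarrow> ('a \<Rightarrow> 'a) \<Rightarrow>
   (real \<Rightarrow> real) \<Rightarrow> 'a \<Rightarrow> 'a" where
  "fun_calc H ip D A f u = (THE v. fun_calc_graph H ip D A f u v)"

definition gen_semigroup ::
  "'a::real_vector set \<Rightarrow> ('a \<Rightarrow> 'a \<Rightarrow> real) \<Rightarrow> (real \<Rightarrow> 'a \<Rightarrow> 'a) \<Rightarrow> real \<Rightarrow> 'a \<Rightarrow> 'a" where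
  "gen_semigroup H ip G t =
     fun_calc H ip (gen_dom H G) (\<lambda>u. - gen H G u) (\<lambda>x. exp (- t * x))"

text \<open>In HOL \<open>0 powr 0 = 0\<close>, whereas \<open>(-\<Delta>)\<^sup>0\<close> is the identity also on the kernel of \<open>\<Delta>\<close>.\<close>

definition gen_power ::
  "'a::real_vector set \<Rightarrow> ('a \<Rightarrow> 'a \<Rightarrow> real) \<Rightarrow> (real \<Rightarrow> 'a \<Rightarrow> 'a) \<Rightarrow> real \<Rightarrow> 'a \<Rightarrow> 'a" where
  "gen_power H ip G p =
     fun_calc H ip (gen_dom H G) (\<lambda>u. - gen H G u) (\<lambda>x. if p = 0 then 1 else x powr p)"


section \<open>The equivalent conditions\<close>

definition resolvents_conv ::
  "(enat \<Rightarrow> 'a::real_vector set) \<Rightarrow> (enat \<Rightarrow> 'a \<Rightarrow> 'a \<Rightarrow> real) \<Rightarrow> 'a set \<Rightarrow>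
   (enat \<Rightarrow> 'a \<Rightarrow> 'a) \<Rightarrow> (enat \<Rightarrow> real \<Rightarrow> 'a \<Rightarrow> 'a) \<Rightarrow> bool" where
  "resolvents_conv H ip C \<Psi> G \<longleftrightarrow>
     (\<forall>\<alpha>>0. operators_strongly_conv H ip C \<Psi> (\<lambda>N. G N \<alpha>))"

definition has_recovery_sequence ::
  "(enat \<Rightarrow> 'a::real_vector set) \<Rightarrow> (enat \<Rightarrow> 'a \<Rightarrow> 'a \<Rightarrow> real) \<Rightarrow> 'a set \<Rightarrow>
   (enat \<Rightarrow> 'a \<Rightarrow> 'a) \<Rightarrow> (enat \<Rightarrow> real \<Rightarrow> 'a \<Rightarrow> 'a) \<Rightarrow> 'a \<Rightarrow> bool" where
  "has_recovery_sequence H ip C \<Psi> G u \<longleftrightarrow>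
     (\<exists>x. (\<forall>n. x n \<in> form_dom (H (enat n)) (ip (enat n)) (G (enat n))) \<and>
          strongly_conv H ip C \<Psi> (section_of x u) \<and>
          (\<lambda>n. form (H (enat n)) (ip (enat n)) (G (enat n)) (x n) (x n))
            \<longlonglongrightarrow> form (H \<infinity>) (ip \<infinity>) (G \<infinity>) u u)"

definition resolvent_energies_conv ::
  "(enat \<Rightarrow> 'a::real_vector set) \<Rightarrow> (enat \<Rightarrow> 'a \<Rightarrow> 'a \<Rightarrow> real) \<Rightarrow> 'a set \<Rightarrow>
   (enat \<Rightarrow> 'a \<Rightarrow> 'a) \<Rightarrow> (enat \<Rightarrow> real \<Rightarrow> 'a \<Rightarrow> 'a) \<Rightarrow> bool" where
  "resolvent_energies_conv H ip C \<Psi> G \<longleftrightarrow>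
     (\<forall>u. \<forall>\<alpha>>0. strongly_conv H ip C \<Psi> u \<longrightarrow>
        (\<lambda>n. form_shift (H (enat n)) (ip (enat n)) (G (enat n)) \<alpha>
               (G (enat n) \<alpha> (u (enat n))) (G (enat n) \<alpha> (u (enat n))))
          \<longlonglongrightarrow> form_shift (H \<infinity>) (ip \<infinity>) (G \<infinity>) \<alpha> (G \<infinity> \<alpha> (u \<infinity>)) (G \<infinity> \<alpha> (u \<infinity>)))"

definition recovery_on_domain ::
  "(enat \<Rightarrow> 'a::real_vector set) \<Rightarrow> (enat \<Rightarrow> 'a \<Rightarrow> 'a \<Rightarrow> real) \<Rightarrow> 'a set \<Rightarrow>
   (enat \<Rightarrow> 'a \<Rightarrow> 'a) \<Rightarrow> (enat \<Rightarrow> real \<Rightarrow> 'a \<Rightarrow> 'a) \<Rightarrow> bool" where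
  "recovery_on_domain H ip C \<Psi> G \<longleftrightarrow>
     (\<forall>u\<in>form_dom (H \<infinity>) (ip \<infinity>) (G \<infinity>). has_recovery_sequence H ip C \<Psi> G u)"

definition energy_liminf ::
  "(enat \<Rightarrow> 'a::real_vector set) \<Rightarrow> (enat \<Rightarrow> 'a \<Rightarrow> 'a \<Rightarrow> real) \<Rightarrow> 'a set \<Rightarrow>
   (enat \<Rightarrow> 'a \<Rightarrow> 'a) \<Rightarrow> (enat \<Rightarrow> real \<Rightarrow> 'a \<Rightarrow> 'a) \<Rightarrow> bool" where
  "energy_liminf H ip C \<Psi> G \<longleftrightarrow>
     (\<forall>u. weakly_conv H ip C \<Psi> u \<longrightarrow>
        energy (H \<infinity>) (ip \<infinity>) (G \<infinity>) (u \<infinity>)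
          \<le> liminf (\<lambda>n. energy (H (enat n)) (ip (enat n)) (G (enat n)) (u (enat n))))"

definition recovery_on_dense_subspace ::
  "(enat \<Rightarrow> 'a::real_vector set) \<Rightarrow> (enat \<Rightarrow> 'a \<Rightarrow> 'a \<Rightarrow> real) \<Rightarrow> 'a set \<Rightarrow>
   (enat \<Rightarrow> 'a \<Rightarrow> 'a) \<Rightarrow> (enat \<Rightarrow> real \<Rightarrow> 'a \<Rightarrow> 'a) \<Rightarrow> bool" where
  "recovery_on_dense_subspace H ip C \<Psi> G \<longleftrightarrow>
     (\<exists>V. dense_subspace (form_dom (H \<infinity>) (ip \<infinity>) (G \<infinity>)) (form_shift (H \<infinity>) (ip \<infinity>) (G \<infinity>) 1) V \<and>
          (\<forall>u\<in>V. has_recovery_sequence H ip C \<Psi> G u))"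

definition resolvent_energy_liminf ::
  "(enat \<Rightarrow> 'a::real_vector set) \<Rightarrow> (enat \<Rightarrow> 'a \<Rightarrow> 'a \<Rightarrow> real) \<Rightarrow> 'a set \<Rightarrow>
   (enat \<Rightarrow> 'a \<Rightarrow> 'a) \<Rightarrow> (enat \<Rightarrow> real \<Rightarrow> 'a \<Rightarrow> 'a) \<Rightarrow> bool" where
  "resolvent_energy_liminf H ip C \<Psi> G \<longleftrightarrow>
     (\<exists>\<alpha>>0. \<forall>\<phi>\<in>C. \<forall>r u.
        subseq_weakly_conv H ip C \<Psi> r (\<lambda>n. G (enat n) \<alpha> (\<Psi> (enat n) \<phi>)) u \<longrightarrow>
        energy (H \<infinity>) (ip \<infinity>) (G \<infinity>) u
          \<le> liminf (\<lambda>k. energy (H (enat (r k))) (ip (enat (r k))) (G (enat (r k)))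
                          (G (enat (r k)) \<alpha> (\<Psi> (enat (r k)) \<phi>))))"

definition powers_of_semigroups_conv ::
  "(enat \<Rightarrow> 'a::real_vector set) \<Rightarrow> (enat \<Rightarrow> 'a \<Rightarrow> 'a \<Rightarrow> real) \<Rightarrow> 'a set \<Rightarrow>
   (enat \<Rightarrow> 'a \<Rightarrow> 'a) \<Rightarrow> (enat \<Rightarrow> real \<Rightarrow> 'a \<Rightarrow> 'a) \<Rightarrow> bool" where
  "powers_of_semigroups_conv H ip C \<Psi> G \<longleftrightarrow>
     (\<forall>t>0. \<forall>p\<ge>0. operators_strongly_conv H ip C \<Psi>
        (\<lambda>N. gen_power (H N) (ip N) (G N) p \<circ> gen_semigroup (H N) (ip N) (G N) t))"

end

theory Submission
  imports Defs "HOL-Computational_Algebra.Polynomial" "HOL-Library.Diagonal_Subsequence"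
begin

text \<open>
  The operator \<open>G\<^bsub>1\<^esub>\<close> is a positive contraction, so positivity of Bernstein polynomials gives a
  continuous functional calculus for the generator. Functions vanishing at infinity are uniform
  limits of polynomials without constant term in \<open>1 / (\<alpha> + x)\<close>, and also in \<open>exp (- x)\<close>; hence strong
  convergence of one resolvent, or of one semigroup operator, passes to the whole calculus.

  Energies are compared through the quadratic identity
  \<open>E\<^sub>\<alpha>(G\<^sub>\<alpha>u - x) = \<langle>u, G\<^sub>\<alpha>u\<rangle> - 2 \<langle>u, x\<rangle> + E\<^sub>\<alpha>(x)\<close>: inserting a recovery sequence \<open>x\<^sub>n\<close> of
  \<open>G\<^sub>\<alpha>u\<close>, convergence of the resolvents reduces to convergence of \<open>\<langle>u\<^sub>n, G\<^sub>\<alpha>u\<^sub>n\<rangle>\<close>, which is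
  the first half of (ii), and which in (iv) follows from weak compactness and the lower bound. The
  lower bound in (iii) holds for the bounded Deny--Yosida forms
  \<open>\<beta> \<langle>u - \<beta> G\<^sub>\<beta>u, v\<rangle>\<close> and passes to their supremum.
\<close>

section \<open>Semi-inner products on a carrier\<close>

text \<open>The carriers lie in one vector space without a topology, so vectors of different
  \<open>H N\<close> are never compared directly, only through pairings with
  \<open>\<Psi> N \<phi>\<close>. Limit arguments become approximation arguments: strongly
  convergent sections are closed under approximation that is uniform for large indices, and the
  uniformity comes from operator bounds that do not depend on \<open>N\<close>. The calculus avoids
  spectral measures: the norm of \<open>p(B)\<close> is controlled by positivity of
  \<open>M\<^sup>2 - p\<^sup>2\<close>. Since each \<open>1 / (\<beta> + x)\<close> vanishes at
  infinity, convergence for a single parameter gives (i), which is why (iv) can ask for one \<alpha>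
  only. In (iv) the lower bound concerns E and not E_\<alpha>, and the norm is not weakly
  continuous. The term \<alpha> <x, x> is therefore bounded below by its tangent at a strongly
  convergent section \<open>v\<close> with the same limit, that is by \<alpha> (2 <x, v> - <v, v>).
  The weak limit \<open>u\<close> is not identified with G_\<alpha> \<phi>; comparing <\<phi>, u>
  with <\<phi>, G_\<alpha> \<phi>> already excludes a gap.\<close>

locale semi_inner_on =
  fixes S :: "'a::real_vector set" and b :: "'a \<Rightarrow> 'a \<Rightarrow> real"
  assumes subspace: "subspace S"
    and sym: "\<lbrakk>x \<in> S; y \<in> S\<rbrakk> \<Longrightarrow> b x y = b y x"
    and add_left: "\<lbrakk>x \<in> S; y \<in> S; z \<in> S\<rbrakk> \<Longrightarrow> b (x + y) z = b x z + b y z"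
    and scale_left: "\<lbrakk>x \<in> S; y \<in> S\<rbrakk> \<Longrightarrow> b (c *\<^sub>R x) y = c * b x y"
    and nonneg: "x \<in> S \<Longrightarrow> 0 \<le> b x x"
begin

abbreviation nrm :: "'a \<Rightarrow> real" where "nrm \<equiv> ip_norm b"

lemma mem [simp, intro]:
  shows "0 \<in> S"
    and "\<lbrakk>x \<in> S; y \<in> S\<rbrakk> \<Longrightarrow> x + y \<in> S"
    and "\<lbrakk>x \<in> S; y \<in> S\<rbrakk> \<Longrightarrow> x - y \<in> S"
    and "x \<in> S \<Longrightarrow> - x \<in> S"
    and "x \<in> S \<Longrightarrow> c *\<^sub>R x \<in> S"
  using subspace
  by (auto intro: subspace_0 subspace_add subspace_diff subspace_neg subspace_scale)

lemma add_right: "\<lbrakk>x \<in> S; y \<in> S; z \<in> S\<rbrakk> \<Longrightarrow> b x (y + z) = b x y + b x z"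
  by (metis add_left mem(2) sym)

lemma scale_right: "\<lbrakk>x \<in> S; y \<in> S\<rbrakk> \<Longrightarrow> b x (c *\<^sub>R y) = c * b x y"
  by (metis mem(5) scale_left sym)

lemma zero_left [simp]: "x \<in> S \<Longrightarrow> b 0 x = 0"
  using scale_left[of x x 0] by simp

lemma zero_right [simp]: "x \<in> S \<Longrightarrow> b x 0 = 0"
  using scale_right[of x x 0] by simp

lemma minus_left: "\<lbrakk>x \<in> S; y \<in> S\<rbrakk> \<Longrightarrow> b (- x) y = - b x y"
  using scale_left[of x y "-1"] by simp

lemma minus_right: "\<lbrakk>x \<in> S; y \<in> S\<rbrakk> \<Longrightarrow> b x (- y) = - b x y"
  using scale_right[of x y "-1"] by simp

lemma diff_left: "\<lbrakk>x \<in> S; y \<in> S; z \<in> S\<rbrakk> \<Longrightarrow> b (x - y) z = b x z - b y z"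
  using add_left[of x "- y" z] by (simp add: minus_left)

lemma diff_right: "\<lbrakk>x \<in> S; y \<in> S; z \<in> S\<rbrakk> \<Longrightarrow> b x (y - z) = b x y - b x z"
  using add_right[of x y "- z"] by (simp add: minus_right)

lemmas bilin = add_left add_right diff_left diff_right scale_left scale_right
  minus_left minus_right

lemma sq_add: "\<lbrakk>x \<in> S; y \<in> S\<rbrakk> \<Longrightarrow> b (x + y) (x + y) = b x x + 2 * b x y + b y y"
  by (simp add: bilin sym[of y x])

lemma sq_diff: "\<lbrakk>x \<in> S; y \<in> S\<rbrakk> \<Longrightarrow> b (x - y) (x - y) = b x x - 2 * b x y + b y y"
  by (simp add: bilin sym[of y x])

lemma young: "\<lbrakk>x \<in> S; y \<in> S\<rbrakk> \<Longrightarrow> 2 * b x y \<le> b x x + b y y"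
  using sq_diff[of x y] nonneg[of "x - y"] by simp

lemma nrm_nonneg [simp]: "x \<in> S \<Longrightarrow> 0 \<le> nrm x"
  by (simp add: ip_norm_def nonneg)

lemma nrm_sq: "x \<in> S \<Longrightarrow> (nrm x)\<^sup>2 = b x x"
  by (simp add: ip_norm_def nonneg)

lemma nrm_zero [simp]: "nrm 0 = 0"
  by (simp add: ip_norm_def)

lemma nrm_scale: "x \<in> S \<Longrightarrow> nrm (c *\<^sub>R x) = \<bar>c\<bar> * nrm x"
  by (simp add: ip_norm_def bilin real_sqrt_mult flip: mult.assoc)

lemma nrm_minus: "x \<in> S \<Longrightarrow> nrm (- x) = nrm x"
  by (simp add: ip_norm_def bilin)

lemma nrm_commute: "\<lbrakk>x \<in> S; y \<in> S\<rbrakk> \<Longrightarrow> nrm (x - y) = nrm (y - x)"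
  using nrm_minus[of "x - y"] by simp

text \<open>The form may be degenerate, as energies vanish on the kernel of the generator, so the
  discriminant argument needs a separate case \<open>b y y = 0\<close>.\<close>

lemma cauchy_schwarz:
  assumes "x \<in> S" "y \<in> S"
  shows "\<bar>b x y\<bar> \<le> nrm x * nrm y"
proof -
  have q: "0 \<le> b x x + 2 * t * b x y + t\<^sup>2 * b y y" for t
    using nonneg[of "x + t *\<^sub>R y"] assms
    by (simp add: sq_add scale_left scale_right power2_eq_square mult.assoc)
  have "(b x y)\<^sup>2 \<le> b x x * b y y"
  proof (cases "b y y = 0")
    case True
    have "b x y = 0"
    proof (rule ccontr)
      assume "b x y \<noteq> 0"
      \<comment> \<open>For \<open>b y y = 0\<close> the quadratic is affine in \<open>t\<close>,
        and this \<open>t\<close> gives it the value -1.\<close>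
      then show False
        using q[of "- (b x x + 1) / (2 * b x y)"] True nonneg[OF assms(1)]
        by (simp add: field_simps)
    qed
    then show ?thesis using True by simp
  next
    case False
    then have pos: "b y y > 0" using nonneg[OF assms(2)] by simp
    define c where "c = b x y / b y y"
    have c: "c * b y y = b x y" using pos by (simp add: c_def)
    have "0 \<le> b x x + 2 * (- c) * b x y + (- c)\<^sup>2 * b y y" by (rule q)
    moreover have "(- c)\<^sup>2 * b y y = c * b x y"
      by (simp add: power2_eq_square mult.assoc c)
    ultimately have "c * b x y \<le> b x x" by simp
    then have "c * b x y * b y y \<le> b x x * b y y"
      using pos by (intro mult_right_mono) auto
    also have "c * b x y * b y y = b x y * (c * b y y)" by (simp only: ac_simps)
    finally show ?thesis by (simp add: power2_eq_square c)
  qed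
  then have "sqrt ((b x y)\<^sup>2) \<le> sqrt (b x x * b y y)"
    by (rule real_sqrt_le_mono)
  then show ?thesis by (simp add: ip_norm_def real_sqrt_mult)
qed

lemma nrm_triangle:
  assumes "x \<in> S" "y \<in> S"
  shows "nrm (x + y) \<le> nrm x + nrm y"
proof (rule power2_le_imp_le)
  show "(nrm (x + y))\<^sup>2 \<le> (nrm x + nrm y)\<^sup>2"
    using cauchy_schwarz[OF assms] assms by (simp add: nrm_sq sq_add power2_sum)
  show "0 \<le> nrm x + nrm y" using assms by simp
qed

lemma nrm_triangle3: "\<lbrakk>x \<in> S; y \<in> S; z \<in> S\<rbrakk> \<Longrightarrow> nrm (x - z) \<le> nrm (x - y) + nrm (y - z)"
  using nrm_triangle[of "x - y" "y - z"] by simp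

lemma nrm_diff_abs: "\<lbrakk>x \<in> S; y \<in> S\<rbrakk> \<Longrightarrow> \<bar>nrm x - nrm y\<bar> \<le> nrm (x - y)"
  using nrm_triangle[of "x - y" y] nrm_triangle[of "y - x" x] nrm_commute[of x y] by auto

lemma sum_mem: "(\<And>i. i \<in> I \<Longrightarrow> f i \<in> S) \<Longrightarrow> sum f I \<in> S"
  using subspace by (rule subspace_sum)

lemma b_sum_left: "\<lbrakk>\<And>i. i \<in> I \<Longrightarrow> f i \<in> S; v \<in> S\<rbrakk> \<Longrightarrow> b (\<Sum>i\<in>I. f i) v = (\<Sum>i\<in>I. b (f i) v)"
  by (induction I rule: infinite_finite_induct) (auto simp: add_left sum_mem)

lemma nrm_tendsto:
  assumes "\<And>n. x n \<in> S" "\<And>n. y n \<in> S" "(\<lambda>n. nrm (x n - y n)) \<longlonglongrightarrow> 0" "(\<lambda>n. nrm (y n)) \<longlonglongrightarrow> c"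
  shows "(\<lambda>n. nrm (x n)) \<longlonglongrightarrow> c"
proof -
  have "(\<lambda>n. nrm (x n) - nrm (y n)) \<longlonglongrightarrow> 0"
    by (rule Lim_null_comparison[OF _ assms(3)]) (use assms in \<open>simp add: nrm_diff_abs\<close>)
  from tendsto_add[OF this assms(4)] show ?thesis by simp
qed

lemma nrm_null:
  assumes "e \<longlonglongrightarrow> 0" "\<And>n. x n \<in> S" "\<And>n. nrm (x n) \<le> e n"
  shows "(\<lambda>n. nrm (x n)) \<longlonglongrightarrow> 0"
  by (rule Lim_null_comparison[OF _ assms(1)]) (use assms in simp)

lemma nrm_lim_add:
  assumes mem: "\<And>n. x n \<in> S" "\<And>n. y n \<in> S" "u \<in> S" "v \<in> S"
    and lim: "(\<lambda>n. nrm (x n - u)) \<longlonglongrightarrow> 0" "(\<lambda>n. nrm (y n - v)) \<longlonglongrightarrow> 0"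
  shows "(\<lambda>n. nrm (x n + y n - (u + v))) \<longlonglongrightarrow> 0"
proof (rule nrm_null)
  show "(\<lambda>n. nrm (x n - u) + nrm (y n - v)) \<longlonglongrightarrow> 0"
    using tendsto_add[OF lim] by simp
  show "x n + y n - (u + v) \<in> S" for n using mem by simp
  have eq: "x n + y n - (u + v) = (x n - u) + (y n - v)" for n by simp
  show "nrm (x n + y n - (u + v)) \<le> nrm (x n - u) + nrm (y n - v)" for n
    unfolding eq using mem by (intro nrm_triangle) auto
qed

lemma b_tendsto:
  assumes "\<And>n. x n \<in> S" "\<And>n. z n \<in> S" "x' \<in> S" "z' \<in> S"
    "(\<lambda>n. nrm (x n - x')) \<longlonglongrightarrow> 0" "(\<lambda>n. nrm (z n - z')) \<longlonglongrightarrow> 0"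
  shows "(\<lambda>n. b (x n) (z n)) \<longlonglongrightarrow> b x' z'"
proof -
  have zb: "(\<lambda>n. nrm (z n)) \<longlonglongrightarrow> nrm z'"
    by (rule nrm_tendsto[OF assms(2) _ assms(6)]) (use assms in auto)
  have lim: "(\<lambda>n. nrm (x n - x') * nrm (z n) + nrm x' * nrm (z n - z')) \<longlonglongrightarrow> 0"
    using tendsto_add[OF tendsto_mult[OF assms(5) zb] tendsto_mult_left[OF assms(6), of "nrm x'"]]
    by simp
  have le: "\<bar>b (x n) (z n) - b x' z'\<bar>
      \<le> nrm (x n - x') * nrm (z n) + nrm x' * nrm (z n - z')" for n
  proof -
    have "b (x n) (z n) - b x' z' = b (x n - x') (z n) + b x' (z n - z')"
      using assms by (simp add: bilin)
    moreover have "\<bar>b (x n - x') (z n)\<bar> \<le> nrm (x n - x') * nrm (z n)"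
      using assms by (intro cauchy_schwarz) auto
    moreover have "\<bar>b x' (z n - z')\<bar> \<le> nrm x' * nrm (z n - z')"
      using assms by (intro cauchy_schwarz) auto
    ultimately show ?thesis by linarith
  qed
  have "(\<lambda>n. b (x n) (z n) - b x' z') \<longlonglongrightarrow> 0"
    by (rule Lim_null_comparison[OF _ lim]) (simp add: le)
  then show ?thesis by (simp add: LIM_zero_iff)
qed

end

locale inner_on = semi_inner_on +
  assumes pos: "\<lbrakk>x \<in> S; x \<noteq> 0\<rbrakk> \<Longrightarrow> 0 < b x x"
begin

lemma nrm_eq_0: "x \<in> S \<Longrightarrow> nrm x = 0 \<longleftrightarrow> x = 0"
  using pos[of x] by (cases "x = 0") (simp_all add: ip_norm_def)

sublocale metric: Metric_space S "ip_dist S b"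
proof
  show "ip_dist S b x y = 0 \<longleftrightarrow> x = y" if "x \<in> S" "y \<in> S" for x y
    using that by (simp add: ip_dist_def nrm_eq_0)
qed (auto simp: ip_dist_def nrm_commute nrm_triangle3)

lemma limitin_iff:
  assumes "\<And>n. w n \<in> S"
  shows "limitin (ip_topology S b) w u sequentially \<longleftrightarrow> u \<in> S \<and> (\<lambda>n. nrm (w n - u)) \<longlonglongrightarrow> 0"
proof -
  have "(\<forall>\<epsilon>>0. \<exists>N. \<forall>n\<ge>N. ip_dist S b (w n) u < \<epsilon>) \<longleftrightarrow> (\<lambda>n. nrm (w n - u)) \<longlonglongrightarrow> 0" if "u \<in> S"
    using that assms unfolding lim_sequentially by (simp add: ip_dist_def dist_norm)
  then show ?thesis
    using assms by (auto simp: metric.limit_metric_sequentially)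
qed

lemma closure_iff:
  assumes "V \<subseteq> S"
  shows "ip_topology S b closure_of V = S \<longleftrightarrow> (\<forall>u\<in>S. \<forall>\<epsilon>>0. \<exists>v\<in>V. nrm (u - v) < \<epsilon>)"
proof -
  have *: "ip_topology S b closure_of V = {x \<in> S. \<forall>\<epsilon>>0. \<exists>v\<in>V. nrm (x - v) < \<epsilon>}"
    using assms by (fastforce simp: metric.metric_closure_of metric.in_mball ip_dist_def)
  show ?thesis unfolding * by blast
qed

lemma limit_unique:
  assumes "\<And>n. w n \<in> S" "u \<in> S" "v \<in> S" "(\<lambda>n. nrm (w n - u)) \<longlonglongrightarrow> 0" "(\<lambda>n. nrm (w n - v)) \<longlonglongrightarrow> 0"
  shows "u = v"
  using metric.limitin_metric_unique[of w u sequentially v] assms limitin_iff[of w]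
  by simp

end

lemma inner_onI:
  assumes "subspace S" "inner_product_on S b"
  shows "inner_on S b"
proof -
  have z: "0 \<in> S" using assms(1) by (rule subspace_0)
  have "b x x \<ge> 0" if "x \<in> S" for x
  proof (cases "x = 0")
    case True
    have "b (0 *\<^sub>R 0) 0 = 0 * b 0 0"
      using assms(2) z unfolding inner_product_on_def by blast
    then show ?thesis using True by simp
  next
    case False
    then show ?thesis using assms(2) that by (force simp: inner_product_on_def)
  qed
  then show ?thesis
    using assms by unfold_locales (auto simp: inner_product_on_def)
qed

locale hilbert_on = inner_on +
  assumes complete: "metric.mcomplete"
begin

lemma cauchy_convergent:
  assumes "\<And>n. x n \<in> S" "\<And>\<epsilon>. 0 < \<epsilon> \<Longrightarrow> \<exists>N. \<forall>m\<ge>N. \<forall>n\<ge>N. nrm (x m - x n) < \<epsilon>"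
  obtains u where "u \<in> S" "(\<lambda>n. nrm (x n - u)) \<longlonglongrightarrow> 0"
proof -
  have "metric.MCauchy x"
    using assms by (fastforce simp: metric.MCauchy_def ip_dist_def)
  then obtain u where "limitin (ip_topology S b) x u sequentially"
    using complete by (auto simp: metric.mcomplete_def)
  then show thesis using that limitin_iff[of x u] assms(1) by auto
qed

text \<open>The representing vector minimizes \<open>b x x - 2 * l x\<close>.\<close>

lemma riesz:
  assumes add: "\<And>x y. \<lbrakk>x \<in> S; y \<in> S\<rbrakk> \<Longrightarrow> l (x + y) = l x + l y"
    and scale: "\<And>c x. x \<in> S \<Longrightarrow> l (c *\<^sub>R x) = c * l x"
    and bound: "\<And>x. x \<in> S \<Longrightarrow> \<bar>l x\<bar> \<le> K * nrm x"
  obtains u where "u \<in> S" "\<And>x. x \<in> S \<Longrightarrow> l x = b u x"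
proof -
  define J where "J x = b x x - 2 * l x" for x
  \<comment> \<open>By the bound on \<open>l\<close>, \<open>J x\<close> is at least
    \<open>(nrm x)\<^sup>2 - 2 * K * nrm x\<close>, which is
    \<open>(nrm x - K)\<^sup>2 - K\<^sup>2\<close>.\<close>
  have lower: "- K\<^sup>2 \<le> J x" if "x \<in> S" for x
  proof -
    have "0 \<le> (nrm x - K)\<^sup>2" by simp
    then show ?thesis
      using bound[OF that] nrm_sq[OF that] by (simp add: J_def power2_diff algebra_simps abs_le_iff)
  qed
  define m where "m = Inf (J ` S)"
  have bdd: "bdd_below (J ` S)" using lower by (auto intro!: bdd_belowI)
  have m: "m \<le> J x" if "x \<in> S" for x
    unfolding m_def using that bdd by (intro cInf_lower) auto
  have "\<exists>x\<in>S. J x < m + 1 / Suc n" for n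
  proof -
    have "J ` S \<noteq> {}" using mem(1) by blast
    then show ?thesis using cInf_lessD[of "J ` S" "m + 1 / Suc n"] by (auto simp: m_def)
  qed
  then obtain x where x: "\<And>n. x n \<in> S" "\<And>n. J (x n) < m + 1 / Suc n"
    by metis
  \<comment> \<open>Parallelogram identity, with \<open>m\<close> as lower bound of \<open>J\<close>
    at the midpoint; it makes a minimizing sequence Cauchy.\<close>
  have par: "b (y - z) (y - z) \<le> 2 * (J y - m) + 2 * (J z - m)" if "y \<in> S" "z \<in> S" for y z
  proof -
    have "m \<le> J ((1/2) *\<^sub>R (y + z))" using that by (intro m) auto
    also have "\<dots> = (b y y + 2 * b y z + b z z) / 4 - (l y + l z)"
      using that by (simp add: J_def scale add bilin sym[of z y] field_simps)
    finally have "4 * m \<le> (b y y + 2 * b y z + b z z) - 4 * (l y + l z)" by argo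
    then show ?thesis using that by (simp add: J_def sq_diff)
  qed
  have "\<exists>N. \<forall>i\<ge>N. \<forall>j\<ge>N. nrm (x i - x j) < \<epsilon>" if "\<epsilon> > 0" for \<epsilon>
  proof -
    obtain N where N: "4 / \<epsilon>\<^sup>2 < real N" using reals_Archimedean2 by blast
    have "nrm (x i - x j) < \<epsilon>" if "i \<ge> N" "j \<ge> N" for i j
    proof (rule power2_less_imp_less)
      have lt: "1 / Suc k < \<epsilon>\<^sup>2 / 4" if "k \<ge> N" for k
      proof -
        have "4 / \<epsilon>\<^sup>2 < real (Suc k)" using N that by linarith
        then show ?thesis using \<open>\<epsilon> > 0\<close> by (simp add: field_simps)
      qed
      have "(nrm (x i - x j))\<^sup>2 \<le> 2 * (J (x i) - m) + 2 * (J (x j) - m)"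
        using par x by (simp add: nrm_sq)
      also have "\<dots> < \<epsilon>\<^sup>2"
        using x(2)[of i] x(2)[of j] lt[OF that(1)] lt[OF that(2)] by argo
      finally show "(nrm (x i - x j))\<^sup>2 < \<epsilon>\<^sup>2" .
    qed (use \<open>\<epsilon> > 0\<close> in simp)
    then show ?thesis by blast
  qed
  then obtain u where u: "u \<in> S" "(\<lambda>n. nrm (x n - u)) \<longlonglongrightarrow> 0"
    using cauchy_convergent[of x] x by blast
  have ldiff: "l (y - z) = l y - l z" if "y \<in> S" "z \<in> S" for y z
    using add[of y "-z"] scale[of z "-1"] that by simp
  have "(\<lambda>n. l (x n) - l u) \<longlonglongrightarrow> 0"
  proof (rule Lim_null_comparison)
    show "\<forall>\<^sub>F n in sequentially. norm (l (x n) - l u) \<le> K * nrm (x n - u)"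
      using bound[of "x _ - u"] x u by (simp add: ldiff)
    show "(\<lambda>n. K * nrm (x n - u)) \<longlonglongrightarrow> 0" using tendsto_mult_left[OF u(2), of K] by simp
  qed
  then have "(\<lambda>n. l (x n)) \<longlonglongrightarrow> l u" by (simp add: LIM_zero_iff)
  moreover have "(\<lambda>n. b (x n) (x n)) \<longlonglongrightarrow> b u u"
    using x u by (intro b_tendsto) auto
  ultimately have "(\<lambda>n. J (x n)) \<longlonglongrightarrow> J u" unfolding J_def by (intro tendsto_intros)
  moreover have "(\<lambda>n. m + 1 / Suc n) \<longlonglongrightarrow> m + 0"
    by (intro tendsto_intros LIMSEQ_Suc lim_1_over_n)
  ultimately have Ju: "J u \<le> m"
    using x(2) by (intro LIMSEQ_le[of "\<lambda>n. J (x n)" _ "\<lambda>n. m + 1 / Suc n"]) (auto intro: less_imp_le)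
  have "l y = b u y" if "y \<in> S" for y
  proof -
    have "0 \<le> t\<^sup>2 * b y y + 2 * t * (b u y - l y)" for t
    proof -
      have "J u \<le> J (u + t *\<^sub>R y)" using Ju m[of "u + t *\<^sub>R y"] u that by force
      then show ?thesis
        using u that by (simp add: J_def add scale sq_add scale_left scale_right power2_eq_square
            mult.assoc right_diff_distrib)
    qed
    then have q: "0 \<le> t\<^sup>2 * b y y + 2 * t * (b u y - l y)" for t by blast
    \<comment> \<open>The denominator \<open>b y y + 1\<close> is positive even for
      \<open>y = 0\<close>. At \<open>t = - s\<close> the quadratic equals
      \<open>- (s\<^sup>2 * (b y y + 2))\<close>, so nonnegativity forces
      \<open>s = 0\<close>.\<close>
    define s where "s = (b u y - l y) / (b y y + 1)"
    have yy: "b y y \<ge> 0" using that by (rule nonneg)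
    then have s: "b u y - l y = s * (b y y + 1)" by (simp add: s_def)
    have "0 \<le> (- s)\<^sup>2 * b y y + 2 * (- s) * (s * (b y y + 1))" using q[of "- s"] s by simp
    also have "\<dots> = - (s\<^sup>2 * (b y y + 2))" by (simp add: power2_eq_square algebra_simps)
    finally have "s = 0" using yy by (simp add: mult_le_0_iff)
    then have "b u y - l y = 0" using s by simp
    then show ?thesis by simp
  qed
  then show thesis using that u by blast
qed

end

lemma hilbert_onI: "separable_hilbert_space S b \<Longrightarrow> hilbert_on S b"
  by (simp add: separable_hilbert_space_def hilbert_on_def hilbert_on_axioms_def inner_onI)

section \<open>Bernstein polynomials and continuous functions on the half-line\<close>

text \<open>The Bernstein basis of degree \<open>n\<close>, as formal polynomials rather than
  functions, because an operator is substituted for the variable below.\<close>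

definition bern :: "nat \<Rightarrow> nat \<Rightarrow> real poly" where
  "bern n k = smult (real (n choose k)) ([:0, 1:] ^ k * [:1, -1:] ^ (n - k))"

text \<open>Coefficient of \<open>x^j\<close> on the \<open>k\<close>-th element of the Bernstein
  basis of degree \<open>n\<close>. It is a quotient of falling factorials of \<open>k\<close> and
  \<open>n\<close>, hence a discrete version of \<open>(k / n)^j\<close>, and it is 0 for
  \<open>k < j\<close>.\<close>

definition bern_ratio :: "nat \<Rightarrow> nat \<Rightarrow> nat \<Rightarrow> real" where
  "bern_ratio n k j = real (k choose j) / real (n choose j)"

lemma smult_sum_right: "smult c (\<Sum>i\<in>I. f i) = (\<Sum>i\<in>I. smult c (f i))"
  by (induction I rule: infinite_finite_induct) (simp_all add: smult_add_right)

text \<open>With \<open>X + Y = 1\<close> the monomial is \<open>X^j\<close> times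
  \<open>(X + Y)^(n - j)\<close>; the binomial theorem and the identity (n choose k) (k choose j) =
  (n choose j) ((n - j) choose (k - j)) identify the coefficients.\<close>

lemma monom_eq_sum_bern:
  assumes "j \<le> n"
  shows "monom 1 j = (\<Sum>k\<le>n. smult (bern_ratio n k j) (bern n k))"
proof -
  define X Y :: "real poly" where "X = [:0, 1:]" and "Y = [:1, -1:]"
  have XY: "X + Y = 1" by (simp add: X_def Y_def one_pCons)
  have coef: "bern_ratio n k j * real (n choose k) = real ((n - j) choose (k - j))" if "j \<le> k" "k \<le> n" for k
  proof -
    have "real (n choose k) * real (k choose j) = real (n choose j) * real ((n - j) choose (k - j))"
      using choose_mult[OF that] by (metis of_nat_mult)
    moreover have "real (n choose j) > 0" using assms by simp
    ultimately show ?thesis by (simp add: bern_ratio_def field_simps)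
  qed
  have trm: "smult (bern_ratio n k j) (bern n k) =
      smult (bern_ratio n k j * real (n choose k)) (X ^ k * Y ^ (n - k))" for k
    by (simp add: bern_def X_def Y_def)
  have "(\<Sum>k\<le>n. smult (bern_ratio n k j) (bern n k)) =
      (\<Sum>k\<in>{j..n}. smult (bern_ratio n k j) (bern n k))"
    by (rule sum.mono_neutral_right) (auto simp: bern_ratio_def)
  also have "\<dots> = (\<Sum>k\<in>{j..n}. smult (real ((n - j) choose (k - j))) (X ^ k * Y ^ (n - k)))"
    by (intro sum.cong refl) (simp add: trm coef)
  also have "\<dots> = (\<Sum>i\<le>n - j. smult (real ((n - j) choose i)) (X ^ (i + j) * Y ^ (n - j - i)))"
    using assms
    by (intro sum.reindex_bij_witness[of _ "\<lambda>i. i + j" "\<lambda>k. k - j"]) auto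
  also have "\<dots> = X ^ j * (\<Sum>i\<le>n - j. of_nat ((n - j) choose i) * X ^ i * Y ^ (n - j - i))"
    unfolding sum_distrib_left
    by (intro sum.cong refl) (simp add: power_add of_nat_poly mult_ac flip: smult_1_left)
  also have "\<dots> = X ^ j * (X + Y) ^ (n - j)" by (simp add: binomial_ring)
  also have "\<dots> = monom 1 j" unfolding XY by (simp add: X_def monom_altdef)
  finally show ?thesis ..
qed

text \<open>Truncated subtraction is harmless here: for \<open>k \<le> j\<close> both sides are
  0.\<close>

lemma bern_ratio_Suc:
  assumes "j < n"
  shows "bern_ratio n k (Suc j) = bern_ratio n k j * (real (k - j) / real (n - j))"
proof -
  have "Suc j * (m choose Suc j) = (m - j) * (m choose j)" for m
    by (simp only: binomial_absorption binomial_absorb_comp)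
  then have "real (Suc j) * real (m choose Suc j) = real (m - j) * real (m choose j)" for m
    by (simp only: of_nat_mult[symmetric])
  then have c: "real (m choose Suc j) = real (m - j) * real (m choose j) / real (Suc j)" for m
    by (simp add: eq_divide_eq mult.commute del: of_nat_Suc)
  show ?thesis using assms by (simp add: bern_ratio_def c mult.commute del: of_nat_diff)
qed

text \<open>Passing from \<open>j\<close> to \<open>j + 1\<close> multiplies the ratio by
  \<open>(k - j) / (n - j)\<close> instead of \<open>k / n\<close>. These factors differ by at most
  \<open>j / (n - j)\<close>, and since everything lies in \<open>[0, 1]\<close> the errors merely
  add up.\<close>

lemma bern_ratio_bound:
  assumes "j < n" "k \<le> n"
  shows "\<bar>bern_ratio n k j - (k / n) ^ j\<bar> \<le> (real j)\<^sup>2 / (real n - real j)"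
  using assms(1)
proof (induction j)
  case 0
  then show ?case by (simp add: bern_ratio_def)
next
  case (Suc j)
  let ?r = "bern_ratio n k j" and ?x = "real k / real n" and ?y = "real (k - j) / real (n - j)"
  have n: "real n > 0" "real n - real j > 0" "real n - real (Suc j) > 0" using Suc.prems by simp_all
  have r: "0 \<le> ?r" "?r \<le> 1"
    using Suc.prems assms(2) by (auto simp: bern_ratio_def binomial_right_mono divide_le_eq_1)
  have x: "0 \<le> ?x" "?x \<le> 1" using assms n by (auto simp: divide_le_eq_1)
  have "\<bar>?y - ?x\<bar> \<le> real j / (real n - real j)"
  proof (cases "j \<le> k")
    case True
    have "?x - ?y = real j * (real n - real k) / (real n * (real n - real j))"
      using True Suc.prems n by (simp add: of_nat_diff field_simps)
    moreover have "\<dots> \<le> real j * real n / (real n * (real n - real j))"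
      using n assms by (intro divide_right_mono mult_left_mono) auto
    moreover have "0 \<le> real j * (real n - real k) / (real n * (real n - real j))"
      using n assms by auto
    ultimately show ?thesis using n by (simp add: abs_if)
  next
    case False
    \<comment> \<open>Here \<open>k < j\<close>, so the truncated factor \<open>?y\<close> is 0 and
      only \<open>k / n\<close> has to be estimated.\<close>
    have "?x \<le> real j / (real n - real j)"
      using False n by (intro frac_le) auto
    then show ?thesis using False x by simp
  qed
  then have "?r * \<bar>?y - ?x\<bar> \<le> 1 * (real j / (real n - real j))"
    using r by (intro mult_mono) auto
  moreover have "\<bar>?r - ?x ^ j\<bar> * ?x \<le> (real j)\<^sup>2 / (real n - real j) * 1"
    using Suc x n by (intro mult_mono) auto
  moreover have "bern_ratio n k (Suc j) - ?x ^ Suc j = ?r * (?y - ?x) + (?r - ?x ^ j) * ?x"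
    using Suc.prems by (simp add: bern_ratio_Suc algebra_simps)
  moreover have "\<bar>?r * (?y - ?x) + (?r - ?x ^ j) * ?x\<bar> \<le> ?r * \<bar>?y - ?x\<bar> + \<bar>?r - ?x ^ j\<bar> * ?x"
    using abs_triangle_ineq[of "?r * (?y - ?x)" "(?r - ?x ^ j) * ?x"] r(1) x(1)
    by (simp add: abs_mult)
  ultimately have "\<bar>bern_ratio n k (Suc j) - ?x ^ Suc j\<bar>
      \<le> real j / (real n - real j) + (real j)\<^sup>2 / (real n - real j)" by simp
  also have "\<dots> = (real j + (real j)\<^sup>2) / (real n - real j)" by (simp add: add_divide_distrib)
  also have "\<dots> \<le> (real (Suc j))\<^sup>2 / (real n - real (Suc j))"
    using n by (intro frac_le) (auto simp: power2_eq_square algebra_simps)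
  finally show ?case .
qed

lemma weierstrass_poly:
  fixes g :: "real \<Rightarrow> real"
  assumes "continuous_on {0..1} g" "0 < e"
  obtains p :: "real poly" where "\<And>x. x \<in> {0..1} \<Longrightarrow> \<bar>g x - poly p x\<bar> < e"
proof -
  obtain h where "real_polynomial_function h" and h: "\<And>x. x \<in> {0..1} \<Longrightarrow> \<bar>g x - h x\<bar> < e"
    using Stone_Weierstrass_real_polynomial_function[of "{0..1}" g e] assms by auto
  then obtain a n where "h = (\<lambda>x. \<Sum>i\<le>n. a i * x ^ i)"
    by (auto simp: real_polynomial_function_iff_sum)
  then have "h x = poly (\<Sum>i\<le>n. monom (a i) i) x" for x
    by (simp add: poly_sum poly_monom)
  then show thesis using that h by metis
qed

section \<open>Functions on the half-line that vanish at infinity\<close>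

lemma C0_halfline_add: "\<lbrakk>f \<in> C0_halfline; g \<in> C0_halfline\<rbrakk> \<Longrightarrow> (\<lambda>x. f x + g x) \<in> C0_halfline"
  using tendsto_add[of f 0 at_top g 0] by (auto simp: C0_halfline_def intro: continuous_on_add)

lemma C0_halfline_cmult: "f \<in> C0_halfline \<Longrightarrow> (\<lambda>x. c * f x) \<in> C0_halfline"
  using tendsto_mult_left[of f 0 at_top c] by (auto simp: C0_halfline_def intro: continuous_on_mult)

lemma C0_halfline_mult: "\<lbrakk>f \<in> C0_halfline; g \<in> C0_halfline\<rbrakk> \<Longrightarrow> (\<lambda>x. f x * g x) \<in> C0_halfline"
  using tendsto_mult[of f 0 at_top g 0] by (auto simp: C0_halfline_def intro: continuous_on_mult)

lemma C0_halfline_bounded: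
  assumes "f \<in> C0_halfline"
  obtains M where "\<And>x. 0 \<le> x \<Longrightarrow> \<bar>f x\<bar> \<le> M"
proof -
  have "\<forall>\<^sub>F x in at_top. \<bar>f x\<bar> < 1"
    using assms tendstoD[of f 0 at_top 1] by (simp add: C0_halfline_def dist_norm)
  then obtain R where R: "\<And>x. R \<le> x \<Longrightarrow> \<bar>f x\<bar> < 1" by (auto simp: eventually_at_top_linorder)
  have "continuous_on {0..max 0 R} f"
    using assms by (auto simp: C0_halfline_def intro: continuous_on_subset)
  then have "bounded (f ` {0..max 0 R})"
    by (intro compact_imp_bounded compact_continuous_image) auto
  then obtain M where M: "\<And>x. x \<in> {0..max 0 R} \<Longrightarrow> \<bar>f x\<bar> \<le> M" by (force simp: bounded_iff)
  have "\<bar>f x\<bar> \<le> max M 1" if "0 \<le> x" for x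
    using R[of x] M[of x] that by (cases "R \<le> x") (auto simp: le_max_iff_disj)
  then show thesis by (rule that)
qed

lemma C0_halfline_le_SUP:
  assumes "f \<in> C0_halfline" "0 \<le> x"
  shows "\<bar>f x\<bar> \<le> (SUP x\<in>{0..}. \<bar>f x\<bar>)"
proof -
  obtain M where "\<And>x. 0 \<le> x \<Longrightarrow> \<bar>f x\<bar> \<le> M" using C0_halfline_bounded[OF assms(1)] by metis
  then have "bdd_above ((\<lambda>x. \<bar>f x\<bar>) ` {0..})" by (auto intro!: bdd_aboveI)
  then show ?thesis using assms(2) by (intro cSUP_upper) auto
qed

lemma C0_halfline_resolvent: "0 < \<alpha> \<Longrightarrow> (\<lambda>x. 1 / (\<alpha> + x)) \<in> C0_halfline"
proof -
  assume "0 < \<alpha>"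
  moreover have "((\<lambda>x::real. 1 / (\<alpha> + x)) \<longlongrightarrow> 0) at_top"
    by (intro tendsto_divide_0[OF tendsto_const] filterlim_at_top_imp_at_infinity
        filterlim_tendsto_add_at_top[OF tendsto_const] filterlim_ident)
  ultimately show ?thesis by (auto simp: C0_halfline_def intro!: continuous_intros)
qed

text \<open>Transport of \<open>f\<close> to \<open>[0, 1]\<close> along a map \<eta> from
  \<open>(0, 1]\<close> to the half-line. The point 0 stands for infinity, so for \<open>f\<close>
  vanishing at infinity the value 0 there is the continuous one.\<close>

definition pull_unit :: "(real \<Rightarrow> real) \<Rightarrow> (real \<Rightarrow> real) \<Rightarrow> real \<Rightarrow> real" where
  "pull_unit \<eta> f s = (if s = 0 then 0 else f (\<eta> s))"

lemma continuous_on_pull_unit: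
  assumes f: "f \<in> C0_halfline"
    and \<eta>: "continuous_on {0<..1} \<eta>" "\<And>s. \<lbrakk>0 < s; s \<le> 1\<rbrakk> \<Longrightarrow> 0 \<le> \<eta> s" "filterlim \<eta> at_top (at_right 0)"
  shows "continuous_on {0..1} (pull_unit \<eta> f)"
  unfolding continuous_on_def
proof
  fix s :: real assume s: "s \<in> {0..1}"
  show "(pull_unit \<eta> f \<longlongrightarrow> pull_unit \<eta> f s) (at s within {0..1})"
  proof (cases "s = 0")
    case True
    have "((\<lambda>s. f (\<eta> s)) \<longlongrightarrow> 0) (at_right 0)"
      using f by (intro filterlim_compose[OF _ \<eta>(3)]) (simp add: C0_halfline_def)
    moreover have "\<forall>\<^sub>F s in at_right 0. f (\<eta> s) = pull_unit \<eta> f s"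
      by (auto simp: eventually_at_filter pull_unit_def)
    ultimately have "(pull_unit \<eta> f \<longlongrightarrow> 0) (at_right 0)" by (rule Lim_transform_eventually)
    then show ?thesis using True by (simp add: at_within_Icc_at_right pull_unit_def)
  next
    case False
    then have s': "s \<in> {0<..1}" using s by auto
    have "continuous_on {0<..1} (\<lambda>s. f (\<eta> s))"
    proof (rule continuous_on_compose2[where f = \<eta> and g = f and t = "{0..}"])
      show "continuous_on {0..} f" using f by (simp add: C0_halfline_def)
      show "\<eta> ` {0<..1} \<subseteq> {0..}" using \<eta>(2) by auto
    qed (rule \<eta>(1))
    then have "continuous_on {0<..1} (pull_unit \<eta> f)"
      by (rule continuous_on_eq) (simp add: pull_unit_def)
    then have "(pull_unit \<eta> f \<longlongrightarrow> pull_unit \<eta> f s) (at s within {0<..1})"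
      using s' by (simp add: continuous_on_def)
    also have "at s within {0<..1} = at s within {0..1}"
      using s' by (intro at_within_nhd[of s "{0<..}"]) auto
    finally show ?thesis .
  qed
qed

text \<open>A generator \<open>\<theta>\<close> is a homeomorphism of the half-line onto \<open>(0, 1]\<close> that decreases to \<open>0\<close>.\<close>

lemma C0_halfline_approx:
  assumes f: "f \<in> C0_halfline" and "0 < e"
    and \<eta>: "continuous_on {0<..1} \<eta>" "\<And>s. \<lbrakk>0 < s; s \<le> 1\<rbrakk> \<Longrightarrow> 0 \<le> \<eta> s" "filterlim \<eta> at_top (at_right 0)"
    and \<theta>: "\<And>x. 0 \<le> x \<Longrightarrow> 0 < \<theta> x \<and> \<theta> x \<le> 1 \<and> \<eta> (\<theta> x) = x"
  obtains q :: "real poly" where "\<And>x. 0 \<le> x \<Longrightarrow> \<bar>f x - \<theta> x * poly q (\<theta> x)\<bar> \<le> e"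
proof -
  obtain p where p: "\<And>s. s \<in> {0..1} \<Longrightarrow> \<bar>pull_unit \<eta> f s - poly p s\<bar> < e / 2"
    using weierstrass_poly[OF continuous_on_pull_unit[OF f \<eta>], of "e / 2"] \<open>0 < e\<close> by auto
  obtain a q where aq: "p = pCons a q" by (cases p)
  have a: "\<bar>a\<bar> < e / 2" using p[of 0] by (simp add: aq pull_unit_def)
  have "\<bar>f x - \<theta> x * poly q (\<theta> x)\<bar> \<le> e" if "0 \<le> x" for x
  proof -
    have "\<bar>f x - (a + \<theta> x * poly q (\<theta> x))\<bar> < e / 2"
      using p[of "\<theta> x"] \<theta>[OF that] by (simp add: pull_unit_def aq)
    then show ?thesis using a by linarith
  qed
  then show thesis by (rule that)
qed

section \<open>Continuous functional calculus of a positive contraction\<close>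

locale positive_contraction = hilbert_on S b for S :: "'a::real_vector set" and b +
  fixes B :: "'a \<Rightarrow> 'a"
  assumes B_linear: "linear_between S S B"
    and B_sym: "\<lbrakk>x \<in> S; y \<in> S\<rbrakk> \<Longrightarrow> b (B x) y = b x (B y)"
    and B_nonneg: "x \<in> S \<Longrightarrow> 0 \<le> b (B x) x"
    and B_le: "x \<in> S \<Longrightarrow> b (B x) x \<le> b x x"
begin

lemma B_mem [simp]: "x \<in> S \<Longrightarrow> B x \<in> S"
  and B_add: "\<lbrakk>x \<in> S; y \<in> S\<rbrakk> \<Longrightarrow> B (x + y) = B x + B y"
  and B_scale: "x \<in> S \<Longrightarrow> B (c *\<^sub>R x) = c *\<^sub>R B x"
  using B_linear by (auto simp: linear_between_def)

lemma B_zero [simp]: "B 0 = 0"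
  using B_scale[of 0 0] by simp

lemma B_minus [simp]: "x \<in> S \<Longrightarrow> B (- x) = - B x"
  using B_scale[of x "-1"] by simp

section \<open>Polynomials of the operator and their positivity\<close>

definition pop :: "real poly \<Rightarrow> 'a \<Rightarrow> 'a" where
  "pop p = fold_coeffs (\<lambda>a f u. a *\<^sub>R u + B (f u)) p (\<lambda>u. 0)"

lemma pop_0 [simp]: "pop 0 u = 0"
  by (simp add: pop_def)

lemma pop_pCons [simp]: "pop (pCons a p) u = a *\<^sub>R u + B (pop p u)"
  by (cases "a = 0 \<and> p = 0") (auto simp: pop_def)

lemma pop_mem [simp]: "u \<in> S \<Longrightarrow> pop p u \<in> S"
  by (induction p) auto

lemma pop_add_right: "\<lbrakk>u \<in> S; v \<in> S\<rbrakk> \<Longrightarrow> pop p (u + v) = pop p u + pop p v"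
  by (induction p) (auto simp: B_add scaleR_add_right)

lemma pop_scale_right: "u \<in> S \<Longrightarrow> pop p (c *\<^sub>R u) = c *\<^sub>R pop p u"
  by (induction p) (auto simp: B_scale scaleR_add_right)

lemma pop_diff_right: "\<lbrakk>u \<in> S; v \<in> S\<rbrakk> \<Longrightarrow> pop p (u - v) = pop p u - pop p v"
  using pop_add_right[of u "- v" p] pop_scale_right[of v p "-1"] by simp

lemma pop_add: "u \<in> S \<Longrightarrow> pop (p + q) u = pop p u + pop q u"
  by (induction p q rule: poly_induct2) (auto simp: B_add scaleR_add_left)

lemma pop_smult: "u \<in> S \<Longrightarrow> pop (smult c p) u = c *\<^sub>R pop p u"
  by (induction p) (auto simp: B_scale scaleR_add_right)

lemma pop_diff: "u \<in> S \<Longrightarrow> pop (p - q) u = pop p u - pop q u"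
  using pop_add[of u p "- q"] pop_smult[of u "-1" q] by simp

lemma pop_B: "u \<in> S \<Longrightarrow> pop p (B u) = B (pop p u)"
  by (induction p) (auto simp: B_add B_scale)

lemma pop_mult: "u \<in> S \<Longrightarrow> pop (p * q) u = pop p (pop q u)"
  by (induction p) (auto simp: pop_add pop_smult)

lemma pop_1 [simp]: "u \<in> S \<Longrightarrow> pop 1 u = u"
  by (simp add: one_pCons)

lemma pop_sum: "u \<in> S \<Longrightarrow> pop (\<Sum>i\<in>I. f i) u = (\<Sum>i\<in>I. pop (f i) u)"
  by (induction I rule: infinite_finite_induct) (auto simp: pop_add)

lemma pop_sym: "\<lbrakk>u \<in> S; v \<in> S\<rbrakk> \<Longrightarrow> b (pop p u) v = b u (pop p v)"
proof (induction p arbitrary: v)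
  case (pCons a p)
  then show ?case by (simp add: bilin B_sym pop_B)
qed simp

definition nonneg_op :: "real poly \<Rightarrow> bool" where
  "nonneg_op p \<longleftrightarrow> (\<forall>u\<in>S. 0 \<le> b (pop p u) u)"

text \<open>Conjugation by a symmetric operator: the quadratic form of \<open>p(B) q(B) p(B)\<close>
  at \<open>u\<close> is that of \<open>q(B)\<close> at \<open>p(B) u\<close>.\<close>

lemma nonneg_op_square: "nonneg_op q \<Longrightarrow> nonneg_op (p * p * q)"
proof -
  have eq: "p * p * q = p * (q * p)" by (simp only: ac_simps)
  have "b (pop (p * (q * p)) u) u = b (pop q (pop p u)) (pop p u)" if "u \<in> S" for u
    using that by (simp add: pop_mult pop_sym[of "pop q (pop p u)" u p])
  then show "nonneg_op q \<Longrightarrow> nonneg_op (p * p * q)"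
    unfolding eq by (simp add: nonneg_op_def)
qed

text \<open>That a product of commuting nonnegative operators is nonnegative is usually seen from a
  square root, which would presuppose the calculus. Here squares are split off both powers, so that
  only the four products of \<open>X\<close> and \<open>1 - X\<close> with exponents 0 and 1
  remain.\<close>

lemma nonneg_op_bern: "nonneg_op (bern n k)"
proof -
  define X Y :: "real poly" where "X = [:0, 1:]" and "Y = [:1, -1:]"
  have XY: "nonneg_op 1" "nonneg_op X" "nonneg_op Y"
    by (auto simp: nonneg_op_def X_def Y_def nonneg B_nonneg B_le bilin)
  \<comment> \<open>Since \<open>X + Y = 1\<close>, the product of the two factors is a sum of two
    terms, each a square times a nonnegative factor.\<close>
  have "X * Y = X * X * Y + Y * Y * X" by (simp add: X_def Y_def algebra_simps)
  then have "nonneg_op (X * Y)"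
    using nonneg_op_square[OF XY(2), of Y] nonneg_op_square[OF XY(3), of X]
    by (auto simp: nonneg_op_def pop_add bilin)
  then have base: "nonneg_op (X ^ (i mod 2) * Y ^ (j mod 2))" for i j
    using XY by (cases "even i"; cases "even j") (auto simp: mod_2_eq_odd)
  have "nonneg_op (X ^ i * Y ^ j)" for i j
  proof -
    have "X ^ i = X ^ (i div 2) * X ^ (i div 2) * X ^ (i mod 2)" for i and X :: "real poly"
      by (simp flip: power_add add: mult_2[symmetric])
    then have "X ^ i * Y ^ j = X ^ (i div 2) * X ^ (i div 2) * X ^ (i mod 2) *
        (Y ^ (j div 2) * Y ^ (j div 2) * Y ^ (j mod 2))" by metis
    also have "\<dots> = (X ^ (i div 2) * Y ^ (j div 2)) * (X ^ (i div 2) * Y ^ (j div 2)) *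
        (X ^ (i mod 2) * Y ^ (j mod 2))" by (simp only: ac_simps)
    finally show ?thesis using nonneg_op_square[OF base] by simp
  qed
  from this[of k "n - k"] show ?thesis
    by (auto simp: nonneg_op_def bern_def pop_smult bilin simp flip: X_def Y_def)
qed

text \<open>The coefficients of \<open>p\<close> in the Bernstein basis of degree \<open>n\<close> tend to the values \<open>p(k/n)\<close>.\<close>

lemma nonneg_opI:
  assumes p: "\<And>x. x \<in> {0..1} \<Longrightarrow> 0 \<le> poly p x"
  shows "nonneg_op p"
  unfolding nonneg_op_def
proof
  fix u assume u: "u \<in> S"
  define d where "d = degree p"
  \<comment> \<open>With \<open>n = d + m + 1\<close> every \<open>j \<le> d\<close> has
    \<open>n - j \<ge> m + 1\<close>, so \<open>M / (m + 1)\<close> bounds the distance between the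
    Bernstein coefficient \<open>c k\<close> and the value of \<open>p\<close> at
    \<open>k / n\<close>.\<close>
  define M where "M = (\<Sum>j\<le>d. \<bar>coeff p j\<bar> * (real d)\<^sup>2)"
  have "- (M * b u u / real (Suc m)) \<le> b (pop p u) u" for m
  proof -
    define n where "n = d + Suc m"
    define c where "c k = (\<Sum>j\<le>d. coeff p j * bern_ratio n k j)" for k
    have exp: "p = (\<Sum>k\<le>n. smult (c k) (bern n k))"
    proof -
      have "p = (\<Sum>j\<le>d. smult (coeff p j) (monom 1 j))"
        by (simp add: d_def smult_monom poly_as_sum_of_monoms)
      also have "\<dots> = (\<Sum>j\<le>d. smult (coeff p j) (\<Sum>k\<le>n. smult (bern_ratio n k j) (bern n k)))"
        by (intro sum.cong refl) (subst monom_eq_sum_bern[of _ n], auto simp: n_def)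
      also have "\<dots> = (\<Sum>j\<le>d. \<Sum>k\<le>n. smult (coeff p j * bern_ratio n k j) (bern n k))"
        by (simp add: smult_sum_right)
      also have "\<dots> = (\<Sum>k\<le>n. \<Sum>j\<le>d. smult (coeff p j * bern_ratio n k j) (bern n k))"
        by (rule sum.swap)
      finally show ?thesis by (simp add: c_def smult_sum)
    qed
    have c: "- M / real (Suc m) \<le> c k" if "k \<le> n" for k
    proof -
      have "- M / real (Suc m) = (\<Sum>j\<le>d. - (\<bar>coeff p j\<bar> * ((real d)\<^sup>2 / real (Suc m))))"
        by (simp add: M_def sum_negf sum_divide_distrib)
      also have "\<dots> \<le> (\<Sum>j\<le>d. coeff p j * bern_ratio n k j - coeff p j * (k / n) ^ j)"
      proof (rule sum_mono)
        fix j assume j: "j \<in> {..d}"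
        have "\<bar>bern_ratio n k j - (k / n) ^ j\<bar> \<le> (real j)\<^sup>2 / (real n - real j)"
          using that j by (intro bern_ratio_bound) (auto simp: n_def)
        also have "\<dots> \<le> (real d)\<^sup>2 / real (Suc m)"
          using j by (intro frac_le) (auto simp: n_def)
        finally have "\<bar>coeff p j\<bar> * \<bar>bern_ratio n k j - (k / n) ^ j\<bar>
            \<le> \<bar>coeff p j\<bar> * ((real d)\<^sup>2 / real (Suc m))" by (intro mult_left_mono) auto
        then have "\<bar>coeff p j * bern_ratio n k j - coeff p j * (k / n) ^ j\<bar>
            \<le> \<bar>coeff p j\<bar> * ((real d)\<^sup>2 / real (Suc m))"
          by (simp flip: abs_mult right_diff_distrib)
        then show "- (\<bar>coeff p j\<bar> * ((real d)\<^sup>2 / real (Suc m)))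
            \<le> coeff p j * bern_ratio n k j - coeff p j * (k / n) ^ j"
          by (subst minus_le_iff) (rule abs_le_D2)
      qed
      also have "\<dots> = c k - poly p (k / n)"
        by (simp add: c_def sum_subtractf poly_altdef d_def)
      also have "\<dots> \<le> c k" using p[of "k / n"] that by (auto simp: divide_le_eq_1 n_def)
      finally show ?thesis .
    qed
    \<comment> \<open>Partition of unity: a lower bound common to all \<open>c k\<close> becomes the
      same multiple of \<open>b u u\<close>.\<close>
    have one: "(\<Sum>k\<le>n. bern n k) = 1"
      using monom_eq_sum_bern[of 0 n] by (simp add: bern_ratio_def monom_0 one_pCons)
    have "- (M * b u u / real (Suc m)) = - M / real (Suc m) * b (pop (\<Sum>k\<le>n. bern n k) u) u"
      using u by (simp add: one)
    also have "\<dots> = (\<Sum>k\<le>n. - M / real (Suc m) * b (pop (bern n k) u) u)"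
      using u by (simp add: pop_sum b_sum_left sum_distrib_left)
    also have "\<dots> \<le> (\<Sum>k\<le>n. c k * b (pop (bern n k) u) u)"
      using c u nonneg_op_bern by (intro sum_mono mult_right_mono) (auto simp: nonneg_op_def)
    also have "\<dots> = b (pop p u) u"
      using u by (subst exp) (simp add: pop_sum pop_smult b_sum_left bilin)
    finally show ?thesis .
  qed
  moreover have "(\<lambda>m. - (M * b u u * (1 / real (Suc m)))) \<longlonglongrightarrow> - (M * b u u * 0)"
    by (intro tendsto_intros LIMSEQ_Suc lim_1_over_n)
  ultimately show "0 \<le> b (pop p u) u"
    by (intro LIMSEQ_le_const2[of "\<lambda>m. - (M * b u u * (1 / real (Suc m)))"]) auto
qed

text \<open>Positivity of \<open>M\<^sup>2 - p\<^sup>2\<close> on \<open>[0, 1]\<close> passes to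
  the operator, and by symmetry the quadratic form of \<open>p\<^sup>2\<close> at \<open>u\<close>
  is the squared norm of \<open>p(B) u\<close>.\<close>

lemma pop_bound:
  assumes "\<And>x. x \<in> {0..1} \<Longrightarrow> \<bar>poly p x\<bar> \<le> M" "0 \<le> M" "u \<in> S"
  shows "nrm (pop p u) \<le> M * nrm u"
proof -
  have "nonneg_op ([:M\<^sup>2:] - p * p)"
  proof (rule nonneg_opI)
    fix x :: real assume "x \<in> {0..1}"
    then have "\<bar>poly p x\<bar>\<^sup>2 \<le> M\<^sup>2" using assms(1) by (intro power_mono) auto
    then show "0 \<le> poly ([:M\<^sup>2:] - p * p) x" by (simp add: power2_eq_square)
  qed
  then have "(nrm (pop p u))\<^sup>2 \<le> (M * nrm u)\<^sup>2"
    using assms(3) by (simp add: nonneg_op_def pop_diff pop_mult pop_sym bilin nrm_sq power_mult_distrib)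
  then show ?thesis
    by (rule power2_le_imp_le) (use assms in simp)
qed

section \<open>Continuous functions of the operator as uniform limits of polynomials\<close>

definition uapprox :: "(nat \<Rightarrow> real poly) \<Rightarrow> (real \<Rightarrow> real) \<Rightarrow> bool" where
  "uapprox q g \<longleftrightarrow> (\<exists>e. e \<longlonglongrightarrow> 0 \<and> (\<forall>n. \<forall>x\<in>{0..1}. \<bar>poly (q n) x - g x\<bar> \<le> e n))"

lemma uapproxI: "\<lbrakk>e \<longlonglongrightarrow> 0; \<And>n x. x \<in> {0..1} \<Longrightarrow> \<bar>poly (q n) x - g x\<bar> \<le> e n\<rbrakk> \<Longrightarrow> uapprox q g"
  by (auto simp: uapprox_def)

lemma uapprox_exists:
  assumes "continuous_on {0..1} g"
  shows "\<exists>q. uapprox q g"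
proof -
  have "\<exists>p :: real poly. \<forall>x\<in>{0..1}. \<bar>g x - poly p x\<bar> < 1 / Suc n" for n
    by (rule weierstrass_poly[OF assms, of "1 / Suc n"]) (simp, blast)
  then obtain q where "\<And>n x. x \<in> {0..1} \<Longrightarrow> \<bar>g x - poly (q n) x\<bar> < 1 / Suc n" by metis
  then have "uapprox q g"
    by (intro uapproxI[of "\<lambda>n. 1 / Suc n"] LIMSEQ_Suc lim_1_over_n)
      (auto simp: abs_minus_commute intro: less_imp_le)
  then show ?thesis by blast
qed

text \<open>It serves twice: with \<open>p = q\<close> it makes \<open>pop (p n) u\<close> a Cauchy
  sequence, with different sequences it makes the limit independent of the approximation.\<close>

lemma uapprox_pop_diff:
  assumes "uapprox p g" "uapprox q g" "u \<in> S"
  shows "\<exists>e. e \<longlonglongrightarrow> 0 \<and> (\<forall>m n. nrm (pop (p m) u - pop (q n) u) \<le> e m + e n)"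
proof -
  obtain e f where e: "e \<longlonglongrightarrow> 0" "\<And>n x. x \<in> {0..1} \<Longrightarrow> \<bar>poly (p n) x - g x\<bar> \<le> e n"
    and f: "f \<longlonglongrightarrow> 0" "\<And>n x. x \<in> {0..1} \<Longrightarrow> \<bar>poly (q n) x - g x\<bar> \<le> f n"
    using assms by (auto simp: uapprox_def)
  have pos: "0 \<le> e n" "0 \<le> f n" for n
    using e(2)[of 0 n] f(2)[of 0 n] by auto
  have "(\<lambda>n. (e n + f n) * nrm u) \<longlonglongrightarrow> (0 + 0) * nrm u"
    by (intro tendsto_intros e f)
  moreover have "nrm (pop (p m) u - pop (q n) u) \<le> (e m + f m) * nrm u + (e n + f n) * nrm u" for m n
  proof -
    have "nrm (pop (p m - q n) u) \<le> (e m + f n) * nrm u"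
    proof (rule pop_bound)
      fix x :: real assume "x \<in> {0..1}"
      then show "\<bar>poly (p m - q n) x\<bar> \<le> e m + f n"
        using e(2)[of x m] f(2)[of x n] by simp
    qed (use pos assms in auto)
    also have "\<dots> \<le> (e m + f m) * nrm u + (e n + f n) * nrm u"
      using pos assms by (simp add: algebra_simps)
    finally show ?thesis using assms by (simp add: pop_diff)
  qed
  ultimately show ?thesis by (intro exI[of _ "\<lambda>n. (e n + f n) * nrm u"]) simp
qed

text \<open>Chosen as the limit along every uniform approximation at once, so that each rule below
  may work with the polynomials that suit it.\<close>

definition cfc :: "(real \<Rightarrow> real) \<Rightarrow> 'a \<Rightarrow> 'a" where
  "cfc g u = (SOME v. v \<in> S \<and> (\<forall>q. uapprox q g \<longrightarrow> (\<lambda>n. nrm (pop (q n) u - v)) \<longlonglongrightarrow> 0))"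

lemma cfc:
  assumes "continuous_on {0..1} g" "u \<in> S"
  shows cfc_mem: "cfc g u \<in> S"
    and cfc_lim: "uapprox q g \<Longrightarrow> (\<lambda>n. nrm (pop (q n) u - cfc g u)) \<longlonglongrightarrow> 0"
proof -
  obtain p where p: "uapprox p g" using uapprox_exists[OF assms(1)] ..
  obtain e where e: "e \<longlonglongrightarrow> 0" "\<And>m n. nrm (pop (p m) u - pop (p n) u) \<le> e m + e n"
    using uapprox_pop_diff[OF p p assms(2)] by blast
  have cauchy: "\<exists>N. \<forall>m\<ge>N. \<forall>n\<ge>N. nrm (pop (p m) u - pop (p n) u) < \<epsilon>" if "\<epsilon> > 0" for \<epsilon>
  proof -
    obtain N where N: "\<And>n. n \<ge> N \<Longrightarrow> \<bar>e n\<bar> < \<epsilon> / 2"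
      using LIMSEQ_D[OF e(1), of "\<epsilon> / 2"] \<open>\<epsilon> > 0\<close> by auto
    have "nrm (pop (p m) u - pop (p n) u) < \<epsilon>" if "m \<ge> N" "n \<ge> N" for m n
      using e(2)[of m n] N[OF that(1)] N[OF that(2)] by argo
    then show ?thesis by blast
  qed
  have mem': "pop (p n) u \<in> S" for n using assms by simp
  obtain v where v: "v \<in> S" "(\<lambda>n. nrm (pop (p n) u - v)) \<longlonglongrightarrow> 0"
    by (rule cauchy_convergent[OF mem' cauchy])
  have "(\<lambda>n. nrm (pop (q n) u - v)) \<longlonglongrightarrow> 0" if q: "uapprox q g" for q
  proof -
    obtain f where f: "f \<longlonglongrightarrow> 0" "\<And>m n. nrm (pop (q m) u - pop (p n) u) \<le> f m + f n"
      using uapprox_pop_diff[OF q p assms(2)] by blast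
    have "(\<lambda>n. f n + f n + nrm (pop (p n) u - v)) \<longlonglongrightarrow> 0 + 0 + 0"
      by (intro tendsto_intros f v)
    then have lim: "(\<lambda>n. f n + f n + nrm (pop (p n) u - v)) \<longlonglongrightarrow> 0" by simp
    have "nrm (pop (q n) u - v) \<le> f n + f n + nrm (pop (p n) u - v)" for n
      using nrm_triangle3[of "pop (q n) u" "pop (p n) u" v] f(2)[of n n] assms v by simp
    then show ?thesis
      using assms v by (intro nrm_null[OF lim]) auto
  qed
  with v(1) have "\<exists>v. v \<in> S \<and> (\<forall>q. uapprox q g \<longrightarrow> (\<lambda>n. nrm (pop (q n) u - v)) \<longlonglongrightarrow> 0)" by blast
  from someI_ex[OF this]
  show "cfc g u \<in> S" "uapprox q g \<Longrightarrow> (\<lambda>n. nrm (pop (q n) u - cfc g u)) \<longlonglongrightarrow> 0"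
    by (auto simp: cfc_def)
qed

lemma cfcI:
  assumes "continuous_on {0..1} g" "u \<in> S" "uapprox q g" "v \<in> S"
    "(\<lambda>n. nrm (pop (q n) u - v)) \<longlonglongrightarrow> 0"
  shows "cfc g u = v"
  using limit_unique[of "\<lambda>n. pop (q n) u" "cfc g u" v] cfc[OF assms(1,2)] assms by simp

lemma cfc_poly: "u \<in> S \<Longrightarrow> cfc (poly p) u = pop p u"
  by (rule cfcI[of _ _ "\<lambda>n. p"]) (auto intro!: continuous_intros uapproxI[of "\<lambda>_. 0"])

lemma cfc_cong: "(\<And>x. x \<in> {0..1} \<Longrightarrow> g x = h x) \<Longrightarrow> cfc g u = cfc h u"
  by (simp add: cfc_def uapprox_def)

lemma cfc_add:
  assumes "continuous_on {0..1} g" "continuous_on {0..1} h" "u \<in> S"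
  shows "cfc (\<lambda>x. g x + h x) u = cfc g u + cfc h u"
proof -
  obtain p q where pq: "uapprox p g" "uapprox q h" using uapprox_exists assms by metis
  obtain e f where e: "e \<longlonglongrightarrow> 0" "\<And>n x. x \<in> {0..1} \<Longrightarrow> \<bar>poly (p n) x - g x\<bar> \<le> e n"
    and f: "f \<longlonglongrightarrow> 0" "\<And>n x. x \<in> {0..1} \<Longrightarrow> \<bar>poly (q n) x - h x\<bar> \<le> f n"
    using pq by (auto simp: uapprox_def)
  have "(\<lambda>n. e n + f n) \<longlonglongrightarrow> 0 + 0" by (intro tendsto_intros e f)
  moreover have "\<bar>poly (p n + q n) x - (g x + h x)\<bar> \<le> e n + f n" if "x \<in> {0..1}" for n x
    using e(2)[OF that, of n] f(2)[OF that, of n] by simp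
  ultimately have ap: "uapprox (\<lambda>n. p n + q n) (\<lambda>x. g x + h x)" by (intro uapproxI) auto
  have "(\<lambda>n. nrm (pop (p n) u + pop (q n) u - (cfc g u + cfc h u))) \<longlonglongrightarrow> 0"
    using assms by (intro nrm_lim_add cfc_lim pq) (simp_all add: cfc_mem)
  then have "(\<lambda>n. nrm (pop (p n + q n) u - (cfc g u + cfc h u))) \<longlonglongrightarrow> 0"
    using assms by (simp add: pop_add)
  then show ?thesis
    using assms ap by (intro cfcI) (auto intro: continuous_intros cfc_mem)
qed

lemma cfc_mult:
  assumes "continuous_on {0..1} g" "continuous_on {0..1} h" "u \<in> S"
  shows "cfc (\<lambda>x. g x * h x) u = cfc g (cfc h u)"
proof -
  obtain p q where pq: "uapprox p g" "uapprox q h" using uapprox_exists assms by metis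
  obtain e f where e: "e \<longlonglongrightarrow> 0" "\<And>n x. x \<in> {0..1} \<Longrightarrow> \<bar>poly (p n) x - g x\<bar> \<le> e n"
    and f: "f \<longlonglongrightarrow> 0" "\<And>n x. x \<in> {0..1} \<Longrightarrow> \<bar>poly (q n) x - h x\<bar> \<le> f n"
    using pq by (auto simp: uapprox_def)
  have "bounded (g ` {0..1})" "bounded (h ` {0..1})"
    using assms by (auto intro!: compact_imp_bounded compact_continuous_image)
  then obtain K L where KL: "\<And>x. x \<in> {0..1} \<Longrightarrow> \<bar>g x\<bar> \<le> K" "\<And>x. x \<in> {0..1} \<Longrightarrow> \<bar>h x\<bar> \<le> L"
    unfolding bounded_iff by (metis imageI real_norm_def)
  have pos: "0 \<le> e n" "0 \<le> f n" "0 \<le> K" "0 \<le> L" for n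
    using e(2)[of 0 n] f(2)[of 0 n] KL[of 0] by auto
  have pb: "\<bar>poly (p n) x\<bar> \<le> K + e n" if "x \<in> {0..1}" for n x
    using e(2)[OF that, of n] KL(1)[OF that] by linarith
  \<comment> \<open>Error bound for the product, from
    \<open>p q - g h = p (q - h) + (p - g) h\<close> with \<open>p n\<close> bounded by
    \<open>K + e n\<close> and \<open>h\<close> by \<open>L\<close>.\<close>
  have "(\<lambda>n. (K + e n) * f n + e n * L) \<longlonglongrightarrow> (K + 0) * 0 + 0 * L" by (intro tendsto_intros e f)
  moreover have "\<bar>poly (p n * q n) x - g x * h x\<bar> \<le> (K + e n) * f n + e n * L" if "x \<in> {0..1}" for n x
  proof -
    have "poly (p n * q n) x - g x * h x =
        poly (p n) x * (poly (q n) x - h x) + (poly (p n) x - g x) * h x"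
      by (simp add: algebra_simps)
    moreover have "\<bar>poly (p n) x * (poly (q n) x - h x)\<bar> \<le> (K + e n) * f n"
      unfolding abs_mult using pb[OF that] f(2)[OF that] pos by (intro mult_mono) auto
    moreover have "\<bar>(poly (p n) x - g x) * h x\<bar> \<le> e n * L"
      unfolding abs_mult using e(2)[OF that] KL(2)[OF that] pos by (intro mult_mono) auto
    ultimately show ?thesis by linarith
  qed
  ultimately have ap: "uapprox (\<lambda>n. p n * q n) (\<lambda>x. g x * h x)" by (intro uapproxI) auto
  let ?v = "cfc h u"
  have v: "?v \<in> S" using assms by (intro cfc_mem)
  have "(\<lambda>n. (K + e n) * nrm (pop (q n) u - ?v)) \<longlonglongrightarrow> (K + 0) * 0"
    by (intro tendsto_intros e cfc_lim assms pq)
  then have lim: "(\<lambda>n. (K + e n) * nrm (pop (q n) u - ?v)) \<longlonglongrightarrow> 0" by simp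
  \<comment> \<open>\<open>pop (p n)\<close> acts on \<open>pop (q n) u\<close>, which varies with
    \<open>n\<close>. This vector is split into its distance from \<open>?v\<close>, on which the
    norm bound \<open>K + e n\<close> suffices, and the fixed vector \<open>?v\<close>.\<close>
  have "(\<lambda>n. nrm (pop (p n) (pop (q n) u - ?v) - 0)) \<longlonglongrightarrow> 0"
  proof (rule nrm_null[OF lim])
    show "nrm (pop (p n) (pop (q n) u - ?v) - 0) \<le> (K + e n) * nrm (pop (q n) u - ?v)" for n
      using pop_bound[of "p n" "K + e n" "pop (q n) u - ?v"] pb pos assms v by simp
  qed (use assms v in simp)
  then have "(\<lambda>n. nrm (pop (p n) (pop (q n) u - ?v) + pop (p n) ?v - (0 + cfc g ?v))) \<longlonglongrightarrow> 0"
    using assms v by (intro nrm_lim_add cfc_lim pq) (simp_all add: cfc_mem)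
  then have "(\<lambda>n. nrm (pop (p n * q n) u - cfc g ?v)) \<longlonglongrightarrow> 0"
    using assms v by (simp add: pop_mult pop_diff_right)
  then show ?thesis
    using assms ap v by (intro cfcI) (auto intro: continuous_intros cfc_mem)
qed

lemma cfc_const: "u \<in> S \<Longrightarrow> cfc (\<lambda>x. c) u = c *\<^sub>R u"
  using cfc_poly[of u "[:c:]"] by (simp add: poly_pCons cong: cfc_cong)

lemma cfc_cmult:
  assumes "continuous_on {0..1} g" "u \<in> S"
  shows "cfc (\<lambda>x. c * g x) u = c *\<^sub>R cfc g u"
  using cfc_mult[of "\<lambda>x. c" g u] assms by (simp add: cfc_const cfc_mem)

lemma cfc_add_right:
  assumes "continuous_on {0..1} g" "u \<in> S" "v \<in> S"
  shows "cfc g (u + v) = cfc g u + cfc g v"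
proof -
  obtain p where p: "uapprox p g" using uapprox_exists assms by metis
  have "(\<lambda>n. nrm (pop (p n) u + pop (p n) v - (cfc g u + cfc g v))) \<longlonglongrightarrow> 0"
    using assms by (intro nrm_lim_add cfc_lim p) (simp_all add: cfc_mem)
  then have "(\<lambda>n. nrm (pop (p n) (u + v) - (cfc g u + cfc g v))) \<longlonglongrightarrow> 0"
    using assms by (simp add: pop_add_right)
  then show ?thesis
    using assms p by (intro cfcI) (auto intro: cfc_mem)
qed

lemma cfc_scale_right:
  assumes "continuous_on {0..1} g" "u \<in> S"
  shows "cfc g (c *\<^sub>R u) = c *\<^sub>R cfc g u"
  using cfc_mult[of "\<lambda>x. c" g u] cfc_mult[of g "\<lambda>x. c" u] assms
  by (simp add: cfc_const cfc_mem mult.commute)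

lemma cfc_sym:
  assumes "continuous_on {0..1} g" "u \<in> S" "v \<in> S"
  shows "b (cfc g u) v = b u (cfc g v)"
proof -
  obtain p where p: "uapprox p g" using uapprox_exists assms by metis
  have "(\<lambda>n. b (pop (p n) u) v) \<longlonglongrightarrow> b (cfc g u) v"
    using assms by (intro b_tendsto cfc_lim p) (auto intro: cfc_mem)
  moreover have "(\<lambda>n. b u (pop (p n) v)) \<longlonglongrightarrow> b u (cfc g v)"
    using assms by (intro b_tendsto cfc_lim p) (auto intro: cfc_mem)
  ultimately show ?thesis using assms by (simp add: pop_sym LIMSEQ_unique)
qed

lemma cfc_bound:
  assumes g: "continuous_on {0..1} g" and M: "\<And>x. x \<in> {0..1} \<Longrightarrow> \<bar>g x\<bar> \<le> M" and u: "u \<in> S"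
  shows "nrm (cfc g u) \<le> M * nrm u"
proof -
  obtain p where p: "uapprox p g" using uapprox_exists g by metis
  obtain e where e: "e \<longlonglongrightarrow> 0" "\<And>n x. x \<in> {0..1} \<Longrightarrow> \<bar>poly (p n) x - g x\<bar> \<le> e n"
    using p by (auto simp: uapprox_def)
  have "0 \<le> M" using M[of 0] by auto
  moreover have "0 \<le> e n" for n using e(2)[of 0 n] by auto
  moreover have "\<bar>poly (p n) x\<bar> \<le> M + e n" if "x \<in> {0..1}" for n x
    using e(2)[OF that, of n] M[OF that] by linarith
  ultimately have le: "nrm (pop (p n) u) \<le> (M + e n) * nrm u" for n
    using u by (intro pop_bound) auto
  have "(\<lambda>n. nrm (cfc g u)) \<longlonglongrightarrow> nrm (cfc g u)" by simp
  then have "(\<lambda>n. nrm (pop (p n) u)) \<longlonglongrightarrow> nrm (cfc g u)"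
    using u g by (intro nrm_tendsto[OF _ _ cfc_lim[OF g u p]]) (auto intro: cfc_mem)
  moreover have "(\<lambda>n. (M + e n) * nrm u) \<longlonglongrightarrow> (M + 0) * nrm u" by (intro tendsto_intros e)
  ultimately have "nrm (cfc g u) \<le> (M + 0) * nrm u" using le by (intro LIMSEQ_le) auto
  then show ?thesis by simp
qed

end

section \<open>Closable forms\<close>

locale closable_form = hilbert_on S b + E0: semi_inner_on D e
  for S :: "'a::real_vector set" and b and D :: "'a set" and e +
  assumes D_subset: "D \<subseteq> S"
    and closable: "form_approx S b D e w 0 \<Longrightarrow> (\<lambda>n. e (w n) (w n)) \<longlonglongrightarrow> 0"
begin

abbreviation approx :: "(nat \<Rightarrow> 'a) \<Rightarrow> 'a \<Rightarrow> bool" where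
  "approx \<equiv> form_approx S b D e"

abbreviation dom :: "'a set" where "dom \<equiv> form_closure_dom S b D e"
abbreviation E :: "'a \<Rightarrow> 'a \<Rightarrow> real" where "E \<equiv> form_closure S b D e"

lemma D_mem [simp]: "x \<in> D \<Longrightarrow> x \<in> S"
  using D_subset by auto

text \<open>The Cauchy condition is restated in the seminorm of the form, where the triangle
  inequality applies; the definition has squares.\<close>

lemma approx_iff:
  "approx w u \<longleftrightarrow> (\<forall>n. w n \<in> D) \<and> u \<in> S \<and> (\<lambda>n. nrm (w n - u)) \<longlonglongrightarrow> 0 \<and>
     (\<forall>\<epsilon>>0. \<exists>N. \<forall>m\<ge>N. \<forall>n\<ge>N. E0.nrm (w m - w n) < \<epsilon>)"
proof (cases "\<forall>n. w n \<in> D")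
  case True
  then have lim: "limitin (ip_topology S b) w u sequentially \<longleftrightarrow> u \<in> S \<and> (\<lambda>n. nrm (w n - u)) \<longlonglongrightarrow> 0"
    by (intro limitin_iff) simp
  have "(\<forall>\<epsilon>>0. \<exists>N. \<forall>m\<ge>N. \<forall>n\<ge>N. e (w m - w n) (w m - w n) < \<epsilon>) \<longleftrightarrow>
      (\<forall>\<epsilon>>0. \<exists>N. \<forall>m\<ge>N. \<forall>n\<ge>N. E0.nrm (w m - w n) < \<epsilon>)" (is "?l \<longleftrightarrow> ?r")
  proof
    assume l: ?l
    show ?r
    proof (intro allI impI)
      fix \<epsilon> :: real assume "\<epsilon> > 0"
      then have "\<epsilon>\<^sup>2 > 0" by simp
      then obtain N where "\<forall>m\<ge>N. \<forall>n\<ge>N. e (w m - w n) (w m - w n) < \<epsilon>\<^sup>2" using l by blast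
      then have "\<forall>m\<ge>N. \<forall>n\<ge>N. E0.nrm (w m - w n) < \<epsilon>"
        using \<open>\<epsilon> > 0\<close> by (simp add: ip_norm_def real_less_lsqrt)
      then show "\<exists>N. \<forall>m\<ge>N. \<forall>n\<ge>N. E0.nrm (w m - w n) < \<epsilon>" by blast
    qed
  next
    assume r: ?r
    show ?l
    proof (intro allI impI)
      fix \<epsilon> :: real assume "\<epsilon> > 0"
      then have "sqrt \<epsilon> > 0" by simp
      then obtain N where "\<forall>m\<ge>N. \<forall>n\<ge>N. E0.nrm (w m - w n) < sqrt \<epsilon>" using r by blast
      then have "\<forall>m\<ge>N. \<forall>n\<ge>N. e (w m - w n) (w m - w n) < \<epsilon>"
        by (simp add: ip_norm_def)
      then show "\<exists>N. \<forall>m\<ge>N. \<forall>n\<ge>N. e (w m - w n) (w m - w n) < \<epsilon>" by blast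
    qed
  qed
  with True lim show ?thesis by (auto simp: form_approx_def)
qed (auto simp: form_approx_def)

lemma approxD:
  assumes "approx w u"
  shows "w n \<in> D" "w n \<in> S" "u \<in> S" "(\<lambda>n. nrm (w n - u)) \<longlonglongrightarrow> 0"
    "0 < \<epsilon> \<Longrightarrow> \<exists>N. \<forall>m\<ge>N. \<forall>n\<ge>N. E0.nrm (w m - w n) < \<epsilon>"
  using assms unfolding approx_iff by auto

lemma approx_const: "u \<in> D \<Longrightarrow> approx (\<lambda>_. u) u"
  by (simp add: approx_iff)

lemma approx_add:
  assumes "approx w u" "approx z v"
  shows "approx (\<lambda>n. w n + z n) (u + v)"
  unfolding approx_iff
proof (intro conjI allI impI)
  note w = approxD(1-4)[OF assms(1)] and z = approxD(1-4)[OF assms(2)]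
  show "w n + z n \<in> D" for n using w z by simp
  show "u + v \<in> S" using w z by simp
  show "(\<lambda>n. nrm (w n + z n - (u + v))) \<longlonglongrightarrow> 0"
    using w z by (intro nrm_lim_add) auto
  fix \<epsilon> :: real assume "\<epsilon> > 0"
  then have "\<epsilon> / 2 > 0" by simp
  obtain M where M: "\<forall>m\<ge>M. \<forall>n\<ge>M. E0.nrm (w m - w n) < \<epsilon> / 2"
    using approxD(5)[OF assms(1) \<open>\<epsilon> / 2 > 0\<close>] by blast
  obtain N where N: "\<forall>m\<ge>N. \<forall>n\<ge>N. E0.nrm (z m - z n) < \<epsilon> / 2"
    using approxD(5)[OF assms(2) \<open>\<epsilon> / 2 > 0\<close>] by blast
  have "E0.nrm (w m + z m - (w n + z n)) < \<epsilon>" if "m \<ge> max M N" "n \<ge> max M N" for m n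
  proof -
    have eq: "w m + z m - (w n + z n) = (w m - w n) + (z m - z n)" by simp
    have "E0.nrm (w m + z m - (w n + z n)) \<le> E0.nrm (w m - w n) + E0.nrm (z m - z n)"
      unfolding eq using w z by (intro E0.nrm_triangle) auto
    moreover have "E0.nrm (w m - w n) < \<epsilon> / 2" "E0.nrm (z m - z n) < \<epsilon> / 2"
      using M N that by auto
    ultimately show ?thesis by argo
  qed
  then show "\<exists>N. \<forall>m\<ge>N. \<forall>n\<ge>N. E0.nrm (w m + z m - (w n + z n)) < \<epsilon>" by blast
qed

lemma approx_scale:
  assumes "approx w u"
  shows "approx (\<lambda>n. c *\<^sub>R w n) (c *\<^sub>R u)"
  unfolding approx_iff
proof (intro conjI allI impI)
  note w = approxD(1-4)[OF assms]
  show "c *\<^sub>R w n \<in> D" for n using w by simp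
  show "c *\<^sub>R u \<in> S" using w by simp
  have "nrm (c *\<^sub>R w n - c *\<^sub>R u) = \<bar>c\<bar> * nrm (w n - u)" for n
    using w nrm_scale[of "w n - u" c] by (simp add: scaleR_diff_right)
  then show "(\<lambda>n. nrm (c *\<^sub>R w n - c *\<^sub>R u)) \<longlonglongrightarrow> 0"
    using tendsto_mult_left[OF w(4), of "\<bar>c\<bar>"] by simp
  fix \<epsilon> :: real assume "\<epsilon> > 0"
  then have "\<epsilon> / (\<bar>c\<bar> + 1) > 0" by simp
  obtain N where N: "\<forall>m\<ge>N. \<forall>n\<ge>N. E0.nrm (w m - w n) < \<epsilon> / (\<bar>c\<bar> + 1)"
    using approxD(5)[OF assms \<open>\<epsilon> / (\<bar>c\<bar> + 1) > 0\<close>] by blast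
  have "E0.nrm (c *\<^sub>R w m - c *\<^sub>R w n) < \<epsilon>" if "m \<ge> N" "n \<ge> N" for m n
  proof -
    have "E0.nrm (c *\<^sub>R w m - c *\<^sub>R w n) = \<bar>c\<bar> * E0.nrm (w m - w n)"
      using w E0.nrm_scale[of "w m - w n" c] by (simp add: scaleR_diff_right)
    also have "\<dots> \<le> (\<bar>c\<bar> + 1) * E0.nrm (w m - w n)"
      using w by (intro mult_right_mono) auto
    also have "\<dots> < \<epsilon>" using N that by (simp add: pos_less_divide_eq mult.commute)
    finally show ?thesis .
  qed
  then show "\<exists>N. \<forall>m\<ge>N. \<forall>n\<ge>N. E0.nrm (c *\<^sub>R w m - c *\<^sub>R w n) < \<epsilon>" by blast
qed

lemma approx_diff: "\<lbrakk>approx w u; approx z v\<rbrakk> \<Longrightarrow> approx (\<lambda>n. w n - z n) (u - v)"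
  using approx_add[OF _ approx_scale[of z v "-1"], of w u] by simp

lemma approx_bounded:
  assumes "approx w u"
  obtains K where "0 < K" "\<And>n. E0.nrm (w n) \<le> K"
proof -
  note w = approxD(1-4)[OF assms]
  obtain N where N: "\<forall>m\<ge>N. \<forall>n\<ge>N. E0.nrm (w m - w n) < 1"
    using approxD(5)[OF assms, of 1] by auto
  have 1: "E0.nrm (w n) \<le> E0.nrm (w N) + 1" if "n \<ge> N" for n
    using E0.nrm_diff_abs[of "w n" "w N"] N that w by (smt (verit) order_refl)
  have 2: "E0.nrm (w n) \<le> (\<Sum>i<N. E0.nrm (w i))" if "n < N" for n
    using that w by (intro member_le_sum) auto
  have 3: "0 \<le> (\<Sum>i<N. E0.nrm (w i))" "0 \<le> E0.nrm (w N)" using w by (auto intro: sum_nonneg)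
  have "E0.nrm (w n) \<le> (\<Sum>i<N. E0.nrm (w i)) + E0.nrm (w N) + 1" for n
    using 1[of n] 2[of n] 3 by (cases "n < N") auto
  then show thesis
    using that[of "(\<Sum>i<N. E0.nrm (w i)) + E0.nrm (w N) + 1"] 3 by auto
qed

lemma approx_convergent:
  assumes "approx w u" "approx z v"
  shows "convergent (\<lambda>n. e (w n) (z n))"
proof -
  note w = approxD(1-4)[OF assms(1)] and z = approxD(1-4)[OF assms(2)]
  obtain K where K: "0 < K" "\<And>n. E0.nrm (w n) \<le> K" using approx_bounded[OF assms(1)] by metis
  obtain L where L: "0 < L" "\<And>n. E0.nrm (z n) \<le> L" using approx_bounded[OF assms(2)] by metis
  have "\<exists>N. \<forall>m\<ge>N. \<forall>n\<ge>N. norm (e (w m) (z m) - e (w n) (z n)) < \<epsilon>" if "\<epsilon> > 0" for \<epsilon>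
  proof -
    have p: "\<epsilon> / (2 * L) > 0" "\<epsilon> / (2 * K) > 0" using that K L by auto
    obtain M where M: "\<forall>m\<ge>M. \<forall>n\<ge>M. E0.nrm (w m - w n) < \<epsilon> / (2 * L)"
      using approxD(5)[OF assms(1) p(1)] by blast
    obtain N where N: "\<forall>m\<ge>N. \<forall>n\<ge>N. E0.nrm (z m - z n) < \<epsilon> / (2 * K)"
      using approxD(5)[OF assms(2) p(2)] by blast
    have "norm (e (w m) (z m) - e (w n) (z n)) < \<epsilon>" if "m \<ge> max M N" "n \<ge> max M N" for m n
    proof -
      have "e (w m) (z m) - e (w n) (z n) = e (w m - w n) (z m) + e (w n) (z m - z n)"
        using w z by (simp add: E0.bilin)
      moreover have "\<bar>e (w m - w n) (z m)\<bar> \<le> E0.nrm (w m - w n) * E0.nrm (z m)"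
        using w z by (intro E0.cauchy_schwarz) auto
      moreover have "E0.nrm (w m - w n) * E0.nrm (z m) \<le> E0.nrm (w m - w n) * L"
        using w z L by (intro mult_left_mono) auto
      moreover have "E0.nrm (w m - w n) * L < \<epsilon> / 2"
        using M that L by (simp add: field_simps)
      moreover have "\<bar>e (w n) (z m - z n)\<bar> \<le> E0.nrm (w n) * E0.nrm (z m - z n)"
        using w z by (intro E0.cauchy_schwarz) auto
      moreover have "E0.nrm (w n) * E0.nrm (z m - z n) \<le> K * E0.nrm (z m - z n)"
        using w z K by (intro mult_right_mono) auto
      moreover have "K * E0.nrm (z m - z n) < \<epsilon> / 2"
        using N that K by (simp add: field_simps)
      ultimately show ?thesis unfolding real_norm_def by argo
    qed
    then show ?thesis by blast
  qed
  then show ?thesis by (intro Cauchy_convergent CauchyI) auto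
qed

text \<open>Closability speaks of \<open>e (w n) (w n)\<close>; Cauchy-Schwarz and boundedness of
  the second sequence extend it to mixed terms.\<close>

lemma approx_zero_product:
  assumes "approx w 0" "approx z v"
  shows "(\<lambda>n. e (w n) (z n)) \<longlonglongrightarrow> 0"
proof -
  note w = approxD(1-4)[OF assms(1)] and z = approxD(1-4)[OF assms(2)]
  obtain L where L: "0 < L" "\<And>n. E0.nrm (z n) \<le> L" using approx_bounded[OF assms(2)] by metis
  have "(\<lambda>n. sqrt (e (w n) (w n)) * L) \<longlonglongrightarrow> sqrt 0 * L"
    by (intro tendsto_intros closable assms)
  then have lim: "(\<lambda>n. sqrt (e (w n) (w n)) * L) \<longlonglongrightarrow> 0" by simp
  have "\<bar>e (w n) (z n)\<bar> \<le> sqrt (e (w n) (w n)) * L" for n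
  proof -
    have "\<bar>e (w n) (z n)\<bar> \<le> E0.nrm (w n) * E0.nrm (z n)"
      using w z by (intro E0.cauchy_schwarz) auto
    also have "\<dots> \<le> E0.nrm (w n) * L"
      using w z L by (intro mult_left_mono) auto
    finally show ?thesis by (simp add: ip_norm_def)
  qed
  then show ?thesis by (intro Lim_null_comparison[OF _ lim]) simp
qed

text \<open>Two approximations of one vector differ by an approximation of 0, so exchanging them
  keeps the limit. This gives the definite description in \<open>form_closure\<close> its
  meaning.\<close>

lemma approx_limit_unique:
  assumes "approx w u" "approx z v" "approx w' u" "approx z' v"
    and "(\<lambda>n. e (w n) (z n)) \<longlonglongrightarrow> c"
  shows "(\<lambda>n. e (w' n) (z' n)) \<longlonglongrightarrow> c"
proof -
  have d: "approx (\<lambda>n. w' n - w n) 0" "approx (\<lambda>n. z' n - z n) 0"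
    using approx_diff[OF assms(3,1)] approx_diff[OF assms(4,2)] by simp_all
  have "(\<lambda>n. e (w' n - w n) (z' n) + e (z' n - z n) (w n) + e (w n) (z n)) \<longlonglongrightarrow> 0 + 0 + c"
    by (rule tendsto_add[OF tendsto_add[OF approx_zero_product[OF d(1) assms(4)]
          approx_zero_product[OF d(2) assms(1)]] assms(5)])
  moreover have "e (w' n - w n) (z' n) + e (z' n - z n) (w n) + e (w n) (z n) = e (w' n) (z' n)" for n
    using approxD(1)[OF assms(1)] approxD(1)[OF assms(2)] approxD(1)[OF assms(3)] approxD(1)[OF assms(4)]
    by (simp add: E0.bilin E0.sym[of "w n"])
  ultimately show ?thesis by simp
qed

lemma form_lim:
  assumes "approx w u" "approx z v"
  shows "(\<lambda>n. e (w n) (z n)) \<longlonglongrightarrow> E u v"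
proof -
  obtain c where c: "(\<lambda>n. e (w n) (z n)) \<longlonglongrightarrow> c"
    using approx_convergent[OF assms] by (auto simp: convergent_def)
  have "E u v = c"
    unfolding form_closure_def
  proof (rule the_equality)
    show "\<forall>w z. approx w u \<longrightarrow> approx z v \<longrightarrow> (\<lambda>n. e (w n) (z n)) \<longlonglongrightarrow> c"
      using approx_limit_unique[OF assms _ _ c] by blast
    show "c' = c" if "\<forall>w z. approx w u \<longrightarrow> approx z v \<longrightarrow> (\<lambda>n. e (w n) (z n)) \<longlonglongrightarrow> c'" for c'
      using that assms c LIMSEQ_unique by blast
  qed
  with c show ?thesis by simp
qed

lemma domE: "u \<in> dom \<Longrightarrow> (\<And>w. approx w u \<Longrightarrow> thesis) \<Longrightarrow> thesis"
  by (auto simp: form_closure_dom_def)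

lemma domI: "approx w u \<Longrightarrow> u \<in> dom"
  by (auto simp: form_closure_dom_def)

lemma dom_mem [simp]: "u \<in> dom \<Longrightarrow> u \<in> S"
  by (auto elim: domE simp: approx_iff)

lemma D_dom [simp]: "u \<in> D \<Longrightarrow> u \<in> dom"
  by (rule domI[OF approx_const])

lemma form_D: "\<lbrakk>u \<in> D; v \<in> D\<rbrakk> \<Longrightarrow> E u v = e u v"
  using form_lim[OF approx_const approx_const, of u v] by (simp add: LIMSEQ_const_iff)

sublocale E: semi_inner_on dom E
proof
  show "subspace dom"
    by (rule subspaceI) (auto intro: domI[OF approx_add] domI[OF approx_scale] elim!: domE)
  show "E x y = E y x" if xy: "x \<in> dom" "y \<in> dom" for x y
  proof -
    obtain w z where wz: "approx w x" "approx z y" using xy by (auto elim!: domE)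
    have "e (w n) (z n) = e (z n) (w n)" for n
      using wz by (intro E0.sym) (auto dest: approxD)
    then show ?thesis
      using form_lim[OF wz] form_lim[OF wz(2,1)] by (simp add: LIMSEQ_unique)
  qed
  show "E (x + y) z = E x z + E y z" if xyz: "x \<in> dom" "y \<in> dom" "z \<in> dom" for x y z
  proof -
    obtain u v w where uvw: "approx u x" "approx v y" "approx w z" using xyz by (auto elim!: domE)
    have "e (u n + v n) (w n) = e (u n) (w n) + e (v n) (w n)" for n
      using uvw by (intro E0.add_left) (auto dest: approxD)
    then show ?thesis
      using form_lim[OF approx_add[OF uvw(1,2)] uvw(3)]
        tendsto_add[OF form_lim[OF uvw(1,3)] form_lim[OF uvw(2,3)]]
      by (simp add: LIMSEQ_unique)
  qed
  show "E (c *\<^sub>R x) y = c * E x y" if xy: "x \<in> dom" "y \<in> dom" for c x y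
  proof -
    obtain w z where wz: "approx w x" "approx z y" using xy by (auto elim!: domE)
    have "e (c *\<^sub>R w n) (z n) = c * e (w n) (z n)" for n
      using wz by (intro E0.scale_left) (auto dest: approxD)
    then show ?thesis
      using form_lim[OF approx_scale[OF wz(1), of c] wz(2)] tendsto_mult_left[OF form_lim[OF wz], of c]
      by (simp add: LIMSEQ_unique)
  qed
  show "0 \<le> E x x" if x: "x \<in> dom" for x
  proof -
    obtain w where w: "approx w x" using x by (auto elim!: domE)
    show ?thesis
      by (rule LIMSEQ_le_const[OF form_lim[OF w w]]) (auto intro: E0.nonneg approxD(1)[OF w])
  qed
qed

end

section \<open>Symmetric resolvents\<close>

locale resolvent_on = hilbert_on S b for S :: "'a::real_vector set" and b +
  fixes G :: "real \<Rightarrow> 'a \<Rightarrow> 'a"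
  assumes resolvent: "symmetric_resolvent S b G"
begin

lemma G_mem [simp]: "\<lbrakk>0 < \<alpha>; u \<in> S\<rbrakk> \<Longrightarrow> G \<alpha> u \<in> S"
  and G_add: "\<lbrakk>0 < \<alpha>; u \<in> S; v \<in> S\<rbrakk> \<Longrightarrow> G \<alpha> (u + v) = G \<alpha> u + G \<alpha> v"
  and G_scale: "\<lbrakk>0 < \<alpha>; u \<in> S\<rbrakk> \<Longrightarrow> G \<alpha> (c *\<^sub>R u) = c *\<^sub>R G \<alpha> u"
  and G_sym: "\<lbrakk>0 < \<alpha>; u \<in> S; v \<in> S\<rbrakk> \<Longrightarrow> b (G \<alpha> u) v = b u (G \<alpha> v)"
  and G_eq: "\<lbrakk>0 < \<alpha>; 0 < \<beta>; u \<in> S\<rbrakk> \<Longrightarrow> G \<alpha> u - G \<beta> u = (\<beta> - \<alpha>) *\<^sub>R G \<alpha> (G \<beta> u)"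
  and G_lim: "u \<in> S \<Longrightarrow> ((\<lambda>\<alpha>. nrm (\<alpha> *\<^sub>R G \<alpha> u - u)) \<longlongrightarrow> 0) at_top"
  and G_contraction': "\<lbrakk>0 < \<alpha>; u \<in> S\<rbrakk> \<Longrightarrow> nrm (\<alpha> *\<^sub>R G \<alpha> u) \<le> nrm u"
  using resolvent unfolding symmetric_resolvent_def linear_between_def image_subset_iff
  by simp_all

lemma G_contraction: "\<lbrakk>0 < \<alpha>; u \<in> S\<rbrakk> \<Longrightarrow> \<alpha> * nrm (G \<alpha> u) \<le> nrm u"
  using G_contraction'[of \<alpha> u] by (simp add: nrm_scale)

lemma G_diff: "\<lbrakk>0 < \<alpha>; u \<in> S; v \<in> S\<rbrakk> \<Longrightarrow> G \<alpha> (u - v) = G \<alpha> u - G \<alpha> v"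
  using G_add[of \<alpha> u "- v"] G_scale[of \<alpha> v "-1"] by simp

text \<open>The left side of the resolvent equation changes sign when the two parameters are
  exchanged.\<close>

lemma G_commute:
  assumes "0 < \<alpha>" "0 < \<beta>" "u \<in> S"
  shows "G \<alpha> (G \<beta> u) = G \<beta> (G \<alpha> u)"
proof (cases "\<alpha> = \<beta>")
  case False
  have "(\<beta> - \<alpha>) *\<^sub>R G \<alpha> (G \<beta> u) = (\<beta> - \<alpha>) *\<^sub>R G \<beta> (G \<alpha> u)"
    using G_eq[OF assms] G_eq[OF assms(2,1,3)] by (metis minus_diff_eq scaleR_minus_left)
  then show ?thesis using False by simp
qed simp

text \<open>If one resolvent kills \<open>u\<close>, the resolvent equation makes all of them do so,
  and strong continuity at infinity leaves \<open>u = 0\<close>. The resulting injectivity is what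
  makes \<open>inv_into\<close> in \<open>gen\<close> a true inverse.\<close>

lemma G_eq_0:
  assumes "0 < \<alpha>" "u \<in> S" "G \<alpha> u = 0"
  shows "u = 0"
proof -
  have z: "G \<beta> 0 = 0" if "0 < \<beta>" for \<beta> using G_scale[of \<beta> 0 0] that by simp
  have "G \<beta> u = 0" if "0 < \<beta>" for \<beta>
    using G_eq[OF that assms(1,2)] assms(3) that by (simp add: z)
  then have "nrm (\<beta> *\<^sub>R G \<beta> u - u) = nrm u" if "0 < \<beta>" for \<beta>
    using that assms by (simp add: nrm_minus)
  then have "\<forall>\<^sub>F \<beta> in at_top. nrm (\<beta> *\<^sub>R G \<beta> u - u) = nrm u"
    by (rule eventually_mono[OF eventually_gt_at_top[of 0]])
  then have "((\<lambda>\<beta>::real. nrm u) \<longlongrightarrow> 0) at_top"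
    using G_lim[OF assms(2)] by (rule Lim_transform_eventually[rotated])
  then have "nrm u = 0" by (simp add: tendsto_const_iff)
  then show ?thesis using assms nrm_eq_0 by blast
qed

lemma G_inj: "0 < \<alpha> \<Longrightarrow> inj_on (G \<alpha>) S"
  using G_eq_0 G_diff by (intro inj_onI) (metis diff_self eq_iff_diff_eq_0 mem(3))

section \<open>The negative \<open>A\<close> of the generator, with its domain\<close>

abbreviation D :: "'a set" where "D \<equiv> gen_dom S G"
definition A :: "'a \<Rightarrow> 'a" where "A u = - gen S G u"

lemma A_G1: "z \<in> S \<Longrightarrow> A (G 1 z) = z - G 1 z"
  by (simp add: A_def gen_def inv_into_f_f[OF G_inj])

text \<open>The domain of the generator is defined with the parameter 1; this form of the resolvent
  equation exhibits a preimage under \<open>G 1\<close> of each \<open>G \<alpha> u\<close>.\<close>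

lemma G_eq_G1:
  assumes "0 < \<alpha>" "u \<in> S"
  shows "G \<alpha> u = G 1 (u + (1 - \<alpha>) *\<^sub>R G \<alpha> u)"
proof -
  have "G 1 (u + (1 - \<alpha>) *\<^sub>R G \<alpha> u) = G 1 u + (1 - \<alpha>) *\<^sub>R G 1 (G \<alpha> u)"
    using assms by (simp add: G_add G_scale)
  also have "\<dots> = G 1 u + (G \<alpha> u - G 1 u)"
    using G_eq[of \<alpha> 1 u] assms G_commute[of \<alpha> 1 u] by simp
  finally show ?thesis by simp
qed

lemma G_D [simp]: "\<lbrakk>0 < \<alpha>; u \<in> S\<rbrakk> \<Longrightarrow> G \<alpha> u \<in> D"
  by (subst G_eq_G1) (auto simp: gen_dom_def)

lemma DE:
  assumes "v \<in> D" "0 < \<alpha>"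
  obtains u where "u \<in> S" "v = G \<alpha> u" "u = \<alpha> *\<^sub>R v + A v"
proof -
  obtain z where z: "z \<in> S" "v = G 1 z" using assms by (auto simp: gen_dom_def)
  have *: "\<alpha> *\<^sub>R v + A v = z + (\<alpha> - 1) *\<^sub>R G 1 z"
    using z by (simp add: A_G1 scaleR_diff_left)
  have "G 1 z - G \<alpha> z = (\<alpha> - 1) *\<^sub>R G 1 (G \<alpha> z)"
    using z assms by (intro G_eq) auto
  moreover have "G \<alpha> (\<alpha> *\<^sub>R v + A v) = G \<alpha> z + (\<alpha> - 1) *\<^sub>R G 1 (G \<alpha> z)"
    using z assms unfolding * by (simp add: G_add G_scale G_commute[of \<alpha> 1])
  ultimately have "G \<alpha> (\<alpha> *\<^sub>R v + A v) = v"
    using z by (metis add_diff_cancel_left' diff_add_cancel add.commute)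
  then show thesis using that[of "\<alpha> *\<^sub>R v + A v"] z * by simp
qed

lemma G_A: "\<lbrakk>v \<in> D; 0 < \<alpha>\<rbrakk> \<Longrightarrow> G \<alpha> (\<alpha> *\<^sub>R v + A v) = v"
  by (rule DE) auto

lemma A_G:
  assumes "0 < \<alpha>" "u \<in> S"
  shows "A (G \<alpha> u) = u - \<alpha> *\<^sub>R G \<alpha> u"
proof -
  have "A (G \<alpha> u) = A (G 1 (u + (1 - \<alpha>) *\<^sub>R G \<alpha> u))" using G_eq_G1[OF assms] by simp
  also have "\<dots> = u + (1 - \<alpha>) *\<^sub>R G \<alpha> u - G 1 (u + (1 - \<alpha>) *\<^sub>R G \<alpha> u)"
    using assms by (intro A_G1) auto
  also have "G 1 (u + (1 - \<alpha>) *\<^sub>R G \<alpha> u) = G \<alpha> u" using G_eq_G1[OF assms] by simp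
  finally show ?thesis by (simp add: scaleR_diff_left)
qed

lemma D_mem' [simp]: "v \<in> D \<Longrightarrow> v \<in> S"
  by (auto simp: gen_dom_def)

lemma A_mem [simp]: "v \<in> D \<Longrightarrow> A v \<in> S"
  by (auto simp: gen_dom_def A_G1)

text \<open>Contractivity of \<open>\<gamma> *\<^sub>R G \<gamma>\<close> says that the norm of
  \<open>\<gamma> *\<^sub>R v + A v\<close> is at least \<gamma> times that of \<open>v\<close>.
  After squaring and dividing by \<gamma>, the term \<open>b (A v) (A v) / \<gamma>\<close>
  disappears as \<gamma> grows.\<close>

lemma A_nonneg:
  assumes "v \<in> D"
  shows "0 \<le> b v (A v)"
proof -
  have "- (b (A v) (A v) / real (Suc n)) \<le> 2 * b v (A v)" for n
  proof -
    define \<gamma> where "\<gamma> = real (Suc n)"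
    have \<gamma>: "\<gamma> > 0" by (simp add: \<gamma>_def)
    have "\<gamma> * nrm v \<le> nrm (\<gamma> *\<^sub>R v + A v)"
      using G_contraction[of \<gamma> "\<gamma> *\<^sub>R v + A v"] G_A[OF assms \<gamma>] assms \<gamma> by simp
    then have "(\<gamma> * nrm v)\<^sup>2 \<le> (nrm (\<gamma> *\<^sub>R v + A v))\<^sup>2"
      using \<gamma> assms by (intro power_mono) auto
    then have "0 \<le> 2 * \<gamma> * b v (A v) + b (A v) (A v)"
      using assms by (simp only: nrm_sq sq_add power_mult_distrib mem A_mem D_mem' scale_left scale_right)
         (simp add: power2_eq_square)
    then show ?thesis using \<gamma> unfolding \<gamma>_def[symmetric] by (simp add: field_simps)
  qed
  moreover have "(\<lambda>m. - (b (A v) (A v) * (1 / real (Suc m)))) \<longlonglongrightarrow> - (b (A v) (A v) * 0)"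
    by (intro tendsto_intros LIMSEQ_Suc lim_1_over_n)
  ultimately have "0 \<le> 2 * b v (A v)"
    by (intro LIMSEQ_le_const2[of "\<lambda>m. - (b (A v) (A v) * (1 / real (Suc m)))"]) auto
  then show ?thesis by simp
qed

lemma G_pos:
  assumes "0 < \<alpha>" "u \<in> S"
  shows "\<alpha> * b (G \<alpha> u) (G \<alpha> u) \<le> b (G \<alpha> u) u"
  using A_nonneg[of "G \<alpha> u"] assms by (simp add: A_G bilin)

lemma G_nonneg: "\<lbrakk>0 < \<alpha>; u \<in> S\<rbrakk> \<Longrightarrow> 0 \<le> b (G \<alpha> u) u"
  using G_pos[of \<alpha> u] nonneg[of "G \<alpha> u"] by (smt (verit) G_mem mult_nonneg_nonneg)

lemma D_iff: "u \<in> D \<longleftrightarrow> (\<exists>y\<in>S. u = G 1 y)"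
  by (auto simp: gen_dom_def)

lemma D_add [simp]:
  assumes "u \<in> D" "v \<in> D"
  shows "u + v \<in> D"
proof -
  obtain y z where yz: "y \<in> S" "u = G 1 y" "z \<in> S" "v = G 1 z" using assms by (auto simp: D_iff)
  then have "u + v = G 1 (y + z)" by (simp add: G_add)
  then show ?thesis using yz by (auto simp: D_iff)
qed

lemma D_scale [simp]:
  assumes "u \<in> D"
  shows "c *\<^sub>R u \<in> D" and A_scale: "A (c *\<^sub>R u) = c *\<^sub>R A u"
proof -
  obtain y where y: "y \<in> S" "u = G 1 y" using assms by (auto simp: D_iff)
  then have cu: "c *\<^sub>R u = G 1 (c *\<^sub>R y)" by (simp add: G_scale)
  show "c *\<^sub>R u \<in> D" using y cu by (auto simp: D_iff)
  have "A (c *\<^sub>R u) = c *\<^sub>R y - c *\<^sub>R u" using y A_G1[of "c *\<^sub>R y"] cu by simp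
  then show "A (c *\<^sub>R u) = c *\<^sub>R A u" using y by (simp add: A_G1 scaleR_diff_right)
qed

lemma A_sym:
  assumes "u \<in> D" "v \<in> D"
  shows "b u (A v) = b v (A u)"
proof -
  obtain y z where yz: "y \<in> S" "u = G 1 y" "z \<in> S" "v = G 1 z" using assms by (auto simp: D_iff)
  have "b u (A v) = b (G 1 y) z - b (G 1 y) (G 1 z)" using yz by (simp add: A_G1 diff_right)
  also have "b (G 1 y) z = b (G 1 z) y" using yz by (simp add: G_sym sym[of y])
  also have "b (G 1 y) (G 1 z) = b (G 1 z) (G 1 y)" using yz by (intro sym) auto
  finally show ?thesis using yz by (simp add: A_G1 diff_right)
qed

text \<open>For closability the energy of \<open>w n - w m\<close> is expanded. With
  \<open>n\<close> fixed, the mixed term \<open>b (w m) (A (w n))\<close> tends to 0 because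
  \<open>w m\<close> does so in \<open>S\<close>, and the energy of \<open>w m\<close> is
  nonnegative. Hence the energy of \<open>w n\<close> is at most the small Cauchy term plus a null
  term.\<close>

sublocale form: closable_form S b D "\<lambda>u v. b u (A v)"
proof -
  have D: "subspace D"
    by (rule subspaceI) (use D_scale[of "G 1 0" 0] in auto)
  interpret e: semi_inner_on D "\<lambda>u v. b u (A v)"
    by unfold_locales
      (rule D, erule (1) A_sym, simp_all add: A_nonneg add_left scale_left)
  show "closable_form S b D (\<lambda>u v. b u (A v))"
  proof
    show "D \<subseteq> S" by auto
    fix w assume w: "form_approx S b D (\<lambda>u v. b u (A v)) w 0"
    then have wD: "w n \<in> D" for n by (auto simp: form_approx_def)
    have "limitin (ip_topology S b) w 0 sequentially" using w by (simp add: form_approx_def)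
    then have w0: "(\<lambda>n. nrm (w n - 0)) \<longlonglongrightarrow> 0" using limitin_iff[of w 0] wD by simp
    show "(\<lambda>n. b (w n) (A (w n))) \<longlonglongrightarrow> 0"
    proof (rule LIMSEQ_I)
      fix \<epsilon> :: real assume "\<epsilon> > 0"
      then have "\<epsilon> / 2 > 0" by simp
      then obtain N where N: "\<And>m n. \<lbrakk>m \<ge> N; n \<ge> N\<rbrakk> \<Longrightarrow> b (w m - w n) (A (w m - w n)) < \<epsilon> / 2"
        using w unfolding form_approx_def by meson
      have "b (w n) (A (w n)) < \<epsilon>" if "n \<ge> N" for n
      proof -
        have "(\<lambda>m. b (w m) (A (w n))) \<longlonglongrightarrow> b 0 (A (w n))"
          using w0 wD by (intro b_tendsto) auto
        then have "\<forall>\<^sub>F m in sequentially. b (w m) (A (w n)) < \<epsilon> / 4"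
          using \<open>\<epsilon> > 0\<close> wD by (intro order_tendstoD(2)) auto
        then obtain M where "\<forall>m\<ge>M. b (w m) (A (w n)) < \<epsilon> / 4"
          by (auto simp: eventually_sequentially)
        then obtain m where m: "m \<ge> N" "b (w m) (A (w n)) < \<epsilon> / 4"
          using max.cobounded1 max.cobounded2 by blast
        have "b (w n - w m) (A (w n - w m)) =
            b (w n) (A (w n)) - 2 * b (w m) (A (w n)) + b (w m) (A (w m))"
          using e.sq_diff[of "w n" "w m"] A_sym[of "w n" "w m"] wD by simp
        then show ?thesis
          using N[OF that m(1)] m(2) A_nonneg[OF wD, of m] by argo
      qed
      then show "\<exists>N. \<forall>n\<ge>N. norm (b (w n) (A (w n)) - 0) < \<epsilon>"
        using A_nonneg[OF wD] by auto
    qed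
  qed
qed

lemma form_dom_eq: "form_dom S b G = form.dom"
  and form_eq: "Defs.form S b G = form.E"
  by (simp_all add: form_dom_def Defs.form_def A_def)

text \<open>Symmetry moves \<open>A\<close> from the approximating sequence to the fixed vector
  \<open>u\<close>; then convergence in \<open>S\<close> determines the limit.\<close>

lemma form_D_left:
  assumes "u \<in> D" "v \<in> form.dom"
  shows "form.E u v = b v (A u)"
proof -
  obtain z where z: "form.approx z v" using assms(2) by (auto elim: form.domE)
  note zD = form.approxD(1-4)[OF z]
  have "(\<lambda>n. b u (A (z n))) \<longlonglongrightarrow> form.E u v"
    by (rule form.form_lim[OF form.approx_const[OF assms(1)] z])
  then have "(\<lambda>n. b (z n) (A u)) \<longlonglongrightarrow> form.E u v"
    using zD assms A_sym[of u] by simp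
  moreover have "(\<lambda>n. b (z n) (A u)) \<longlonglongrightarrow> b v (A u)"
    using zD assms by (intro b_tendsto) auto
  ultimately show ?thesis by (rule LIMSEQ_unique)
qed

text \<open>The variational characterization of the resolvent, E_\<alpha>(G_\<alpha> u, v) = <u, v>,
  solved for E. The quadratic identities for energies rest on it.\<close>

lemma form_G:
  assumes "0 < \<alpha>" "u \<in> S" "v \<in> form.dom"
  shows "form.E (G \<alpha> u) v = b u v - \<alpha> * b (G \<alpha> u) v"
  using assms by (simp add: form_D_left A_G bilin sym[of v])

lemma G_dom [simp]: "\<lbrakk>0 < \<alpha>; u \<in> S\<rbrakk> \<Longrightarrow> G \<alpha> u \<in> form.dom"
  by simp

text \<open>The form alone may be degenerate; the term \<open>\<alpha> * b x x\<close> makes it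
  definite, so that density in the form domain can be tested by distances.\<close>

lemma form_shift_inner_on:
  assumes "0 < \<alpha>"
  shows "inner_on form.dom (form_shift S b G \<alpha>)"
proof
  show "subspace form.dom" by (rule form.E.subspace)
  fix x y z c
  show "form_shift S b G \<alpha> x y = form_shift S b G \<alpha> y x" if "x \<in> form.dom" "y \<in> form.dom"
    using that by (simp add: form_shift_def form_eq form.E.sym[of x y] sym[of x y])
  show "form_shift S b G \<alpha> (x + y) z = form_shift S b G \<alpha> x z + form_shift S b G \<alpha> y z"
    if "x \<in> form.dom" "y \<in> form.dom" "z \<in> form.dom"
    using that by (simp add: form_shift_def form_eq form.E.add_left add_left distrib_left)
  show "form_shift S b G \<alpha> (c *\<^sub>R x) y = c * form_shift S b G \<alpha> x y"
    if "x \<in> form.dom" "y \<in> form.dom"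
    using that by (simp add: form_shift_def form_eq form.E.scale_left scale_left distrib_left)
  show "0 \<le> form_shift S b G \<alpha> x x" if "x \<in> form.dom"
    using that assms by (simp add: form_shift_def form_eq form.E.nonneg nonneg)
  show "0 < form_shift S b G \<alpha> x x" if "x \<in> form.dom" "x \<noteq> 0"
    using that assms pos[of x] form.E.nonneg[of x]
    by (simp add: form_shift_def form_eq add_nonneg_pos)
qed

subsection \<open>Deny--Yosida approximation\<close>

definition yosida :: "real \<Rightarrow> 'a \<Rightarrow> 'a \<Rightarrow> real" where
  "yosida \<beta> u v = \<beta> * b (u - \<beta> *\<^sub>R G \<beta> u) v"

text \<open>Nonnegativity at \<open>u - v\<close>. The left side is affine in \<open>u\<close>,
  which is what survives weak convergence of \<open>u\<close> while \<open>v\<close> converges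
  strongly.\<close>

lemma yosida_sq_diff:
  assumes "0 < \<beta>" "u \<in> S" "v \<in> S"
  shows "2 * yosida \<beta> v u - yosida \<beta> v v \<le> yosida \<beta> u u"
proof -
  have n: "0 \<le> b (u - \<beta> *\<^sub>R G \<beta> u) u" if "u \<in> S" for u
  proof -
    have "b (\<beta> *\<^sub>R G \<beta> u) u \<le> nrm (\<beta> *\<^sub>R G \<beta> u) * nrm u"
      using cauchy_schwarz[of "\<beta> *\<^sub>R G \<beta> u" u] that assms by simp
    also have "\<dots> \<le> nrm u * nrm u"
      using that assms by (intro mult_right_mono G_contraction') auto
    also have "\<dots> = b u u" using nrm_sq[OF that] by (simp add: power2_eq_square)
    finally show ?thesis using that assms by (simp add: diff_left)
  qed
  have "b (u - v - \<beta> *\<^sub>R G \<beta> (u - v)) (u - v) =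
      b (u - \<beta> *\<^sub>R G \<beta> u) u - 2 * b (v - \<beta> *\<^sub>R G \<beta> v) u + b (v - \<beta> *\<^sub>R G \<beta> v) v"
    using assms
    by (simp add: bilin G_diff G_sym[of \<beta> u v] sym[of u v] sym[of u "G \<beta> v"] algebra_simps)
  then have "0 \<le> b (u - \<beta> *\<^sub>R G \<beta> u) u - 2 * b (v - \<beta> *\<^sub>R G \<beta> v) u + b (v - \<beta> *\<^sub>R G \<beta> v) v"
    using n[of "u - v"] assms by simp
  then have "0 \<le> \<beta> * (b (u - \<beta> *\<^sub>R G \<beta> u) u - 2 * b (v - \<beta> *\<^sub>R G \<beta> v) u + b (v - \<beta> *\<^sub>R G \<beta> v) v)"
    using assms by simp
  then show ?thesis by (simp add: yosida_def algebra_simps)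
qed

text \<open>With \<open>g = \<beta> *\<^sub>R G \<beta> u\<close> the form satisfies
  \<open>E g v = \<beta> * b (u - g) v\<close>, and the claim is the expansion of the nonnegative
  energy of \<open>u - g\<close>.\<close>

lemma yosida_le_form:
  assumes "0 < \<beta>" "u \<in> form.dom"
  shows "yosida \<beta> u u \<le> form.E u u"
proof -
  define g where "g = \<beta> *\<^sub>R G \<beta> u"
  have u: "u \<in> S" using assms by simp
  have g: "g \<in> form.dom" "g \<in> S" using assms u by (simp_all add: g_def form.E.mem)
  have gE: "form.E g v = \<beta> * b (u - g) v" if "v \<in> form.dom" for v
    using that assms u by (simp add: g_def form.E.scale_left form_G bilin)
  have "0 \<le> form.E (u - g) (u - g)" using g assms by (intro form.E.nonneg) auto
  also have "\<dots> = form.E u u - 2 * form.E g u + form.E g g"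
    using g assms by (simp add: form.E.sq_diff form.E.sym[of u g])
  also have "\<dots> = form.E u u - \<beta> * b (u - g) u - \<beta> * b (u - g) (u - g)"
    using g assms u by (simp add: gE diff_right algebra_simps)
  also have "\<dots> \<le> form.E u u - \<beta> * b (u - g) u"
    using g u assms nonneg[of "u - g"] by simp
  finally show ?thesis by (simp add: yosida_def g_def)
qed

text \<open>As \<open>\<gamma>\<close> increases, the energies of \<open>\<gamma> *\<^sub>R G \<gamma> u\<close> increase, and they control the energies of
  the differences.\<close>

lemma yosida_bounded:
  assumes u: "u \<in> S" and c: "\<And>\<beta>. 0 < \<beta> \<Longrightarrow> yosida \<beta> u u \<le> c"
  shows "u \<in> form.dom" and "form.E u u \<le> c"
proof -
  define g where "g \<beta> = \<beta> *\<^sub>R G \<beta> u" for \<beta>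
  define e where "e v w = b v (A w)" for v w
  have g: "g \<beta> \<in> D" "g \<beta> \<in> S" if "0 < \<beta>" for \<beta> using that u by (simp_all add: g_def)
  have Ag: "A (g \<beta>) = \<beta> *\<^sub>R (u - g \<beta>)" if "0 < \<beta>" for \<beta>
    using that u by (simp add: g_def A_scale A_G)
  have diff: "e (g \<gamma> - g \<beta>) (g \<gamma> - g \<beta>) \<le> e (g \<gamma>) (g \<gamma>) - e (g \<beta>) (g \<beta>)" if \<beta>\<gamma>: "0 < \<beta>" "\<beta> \<le> \<gamma>" for \<beta> \<gamma>
  proof -
    define h where "h = u - g \<beta>"
    define d where "d = g \<gamma> - g \<beta>"
    have \<gamma>: "0 < \<gamma>" using \<beta>\<gamma> by simp
    have h: "h \<in> S" "G \<gamma> h \<in> S" and d: "d \<in> D" "d \<in> S"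
      using g \<beta>\<gamma> \<gamma> u form.E0.mem by (auto simp: h_def d_def)
    have "(\<gamma> - \<beta>) *\<^sub>R G \<gamma> h = (\<gamma> - \<beta>) *\<^sub>R G \<gamma> u - \<beta> *\<^sub>R ((\<gamma> - \<beta>) *\<^sub>R G \<beta> (G \<gamma> u))"
      using \<beta>\<gamma> \<gamma> u by (simp add: h_def g_def G_diff G_scale scaleR_diff_right G_commute[of \<gamma> \<beta>])
    also have "(\<gamma> - \<beta>) *\<^sub>R G \<beta> (G \<gamma> u) = G \<beta> u - G \<gamma> u"
      using G_eq[of \<beta> \<gamma> u] \<beta>\<gamma> \<gamma> u by simp
    finally have d_eq: "d = (\<gamma> - \<beta>) *\<^sub>R G \<gamma> h"
      by (simp add: d_def g_def scaleR_diff_left scaleR_diff_right)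
    have pos: "\<gamma> * b (G \<gamma> h) (G \<gamma> h) \<le> b (G \<gamma> h) h" using G_pos[OF \<gamma> h(1)] .
    have "e d (g \<beta>) = \<beta> * (\<gamma> - \<beta>) * b (G \<gamma> h) h"
      using \<beta>\<gamma> h d by (simp add: e_def Ag d_eq bilin flip: h_def)
    moreover have "0 \<le> \<beta> * (\<gamma> - \<beta>) * b (G \<gamma> h) h"
      using \<beta>\<gamma> G_nonneg[OF \<gamma> h(1)] by simp
    ultimately have 1: "0 \<le> e d (g \<beta>)" by simp
    have "e (g \<gamma>) (g \<gamma>) = e (g \<beta>) (g \<beta>) + 2 * e d (g \<beta>) + e d d"
    proof -
      have "g \<gamma> = d + g \<beta>" by (simp add: d_def)
      then show ?thesis
        using form.E0.sq_add[of d "g \<beta>"] d g \<beta>\<gamma> by (simp add: e_def)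
    qed
    with 1 show ?thesis by (simp add: d_def)
  qed
  define w where "w n = g (real (Suc n))" for n
  have w: "w n \<in> D" "w n \<in> S" for n using g by (simp_all add: w_def)
  have "incseq (\<lambda>n. e (w n) (w n))"
  proof (rule incseq_SucI)
    fix n
    have "0 \<le> e (w (Suc n) - w n) (w (Suc n) - w n)"
      using w unfolding e_def by (intro A_nonneg) (auto intro: form.E0.mem)
    also have "\<dots> \<le> e (w (Suc n)) (w (Suc n)) - e (w n) (w n)"
      unfolding w_def by (intro diff) auto
    finally show "e (w n) (w n) \<le> e (w (Suc n)) (w (Suc n))" by simp
  qed
  have le: "e (w n) (w n) \<le> c" for n
  proof -
    define \<beta> where "\<beta> = real (Suc n)"
    have \<beta>: "0 < \<beta>" by (simp add: \<beta>_def)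
    \<comment> \<open>As \<open>A (g \<beta>) = \<beta> *\<^sub>R (u - g \<beta>)\<close>, the
      energy of \<open>g \<beta>\<close> falls short of the Yosida form at \<open>u\<close> by
      \<beta> times a square.\<close>
    have "e (g \<beta>) (g \<beta>) = yosida \<beta> u u - \<beta> * b (u - g \<beta>) (u - g \<beta>)"
      using \<beta> u g by (simp add: e_def Ag yosida_def flip: g_def)
        (simp add: bilin sym[of u "g \<beta>"] algebra_simps)
    also have "\<dots> \<le> yosida \<beta> u u" using \<beta> u g nonneg[of "u - g \<beta>"] by simp
    also have "\<dots> \<le> c" using \<beta> by (rule c)
    finally show ?thesis by (simp add: w_def \<beta>_def)
  qed
  obtain l where l: "(\<lambda>n. e (w n) (w n)) \<longlonglongrightarrow> l"
    by (rule incseq_convergent[OF \<open>incseq (\<lambda>n. e (w n) (w n))\<close>, of c]) (use le in auto)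
  have approx: "form.approx w u"
    unfolding form_approx_def
  proof (intro conjI allI impI)
    show "range w \<subseteq> D" using w by auto
    have "filterlim (\<lambda>n. real (Suc n)) at_top sequentially"
      by (rule filterlim_compose[OF filterlim_real_sequentially filterlim_Suc])
    then have "(\<lambda>n. nrm (w n - u)) \<longlonglongrightarrow> 0"
      unfolding w_def g_def by (rule filterlim_compose[OF G_lim[OF u]])
    then show "limitin (ip_topology S b) w u sequentially"
      using u w by (simp add: limitin_iff)
    fix \<epsilon> :: real assume "\<epsilon> > 0"
    then obtain N where N: "\<And>m n. \<lbrakk>m \<ge> N; n \<ge> N\<rbrakk> \<Longrightarrow> \<bar>e (w m) (w m) - e (w n) (w n)\<bar> < \<epsilon>"
      using CauchyD[OF LIMSEQ_imp_Cauchy[OF l], of \<epsilon>] by auto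
    have "e (w m - w n) (w m - w n) < \<epsilon>" if "m \<ge> N" "n \<ge> N" for m n
    proof -
      have *: "e (w m - w n) (w m - w n) < \<epsilon>" if "n \<le> m" "m \<ge> N" "n \<ge> N" for m n
        using diff[of "real (Suc n)" "real (Suc m)"] N[OF that(2,3)] that by (simp add: w_def)
      show ?thesis
      proof (cases "n \<le> m")
        case False
        have "e (w m - w n) (w m - w n) = e (w n - w m) (w n - w m)"
          using form.E0.sq_diff[of "w m" "w n"] form.E0.sq_diff[of "w n" "w m"] w
            form.E0.sym[of "w m" "w n"] by (simp add: e_def)
        then show ?thesis using * that False by simp
      qed (use * that in blast)
    qed
    then show "\<exists>M. \<forall>m\<ge>M. \<forall>n\<ge>M. b (w m - w n) (A (w m - w n)) < \<epsilon>"
      unfolding e_def by blast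
  qed
  show "u \<in> form.dom" by (rule form.domI[OF approx])
  have "(\<lambda>n. e (w n) (w n)) \<longlonglongrightarrow> form.E u u"
    unfolding e_def by (rule form.form_lim[OF approx approx])
  then show "form.E u u \<le> c" using le by (intro LIMSEQ_le_const2) auto
qed

section \<open>Functional calculus of the generator\<close>

lemma positive_contraction_G1: "positive_contraction S b (G 1)"
proof
  show "linear_between S S (G 1)"
    by (auto simp: linear_between_def G_add G_scale)
  fix x y
  show "b (G 1 x) y = b x (G 1 y)" if "x \<in> S" "y \<in> S" using that by (simp add: G_sym)
  show "0 \<le> b (G 1 x) x" if "x \<in> S" using that by (simp add: G_nonneg)
  show "b (G 1 x) x \<le> b x x" if "x \<in> S"
  proof -
    have "b (G 1 x) x \<le> nrm (G 1 x) * nrm x" using cauchy_schwarz[of "G 1 x" x] that by simp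
    also have "\<dots> \<le> nrm x * nrm x"
      using G_contraction[of 1 x] that by (intro mult_right_mono) auto
    finally show ?thesis using nrm_sq[OF that] by (simp add: power2_eq_square)
  qed
qed

text \<open>A function of \<open>A = inverse (G 1) - 1\<close> is a function on \<open>[0, 1]\<close> of \<open>G 1\<close>.\<close>

lemma C0_calculus_exists: "\<exists>\<Phi>. C0_calculus S b D A \<Phi>"
proof -
  interpret B: positive_contraction S b "G 1" by (rule positive_contraction_G1)
  \<comment> \<open>Inverse of \<open>x \<mapsto> 1 / (1 + x)\<close>, the function that turns
    \<open>A\<close> into \<open>G 1\<close>.\<close>
  define \<eta> where "\<eta> s = 1 / s - 1" for s :: real
  define P where "P = pull_unit \<eta>"
  have \<eta>: "continuous_on {0<..1} \<eta>" "\<And>s. \<lbrakk>0 < s; s \<le> 1\<rbrakk> \<Longrightarrow> 0 \<le> \<eta> s"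
    unfolding \<eta>_def by (auto intro!: continuous_intros simp: field_simps)
  have "filterlim (\<lambda>s::real. inverse s + (- 1)) at_top (at_right 0)"
    using filterlim_tendsto_add_at_top[OF tendsto_const filterlim_inverse_at_top_right, of "- 1 :: real"]
    by (simp add: add.commute)
  then have \<eta>': "filterlim \<eta> at_top (at_right 0)"
    unfolding \<eta>_def by (simp add: inverse_eq_divide)
  have cont: "continuous_on {0..1} (P f)" if "f \<in> C0_halfline" for f
    unfolding P_def by (rule continuous_on_pull_unit[OF that \<eta> \<eta>'])
  define \<Phi> where "\<Phi> f = B.cfc (P f)" for f
  have mem: "\<Phi> f u \<in> S" if "f \<in> C0_halfline" "u \<in> S" for f u
    unfolding \<Phi>_def by (rule B.cfc_mem[OF cont[OF that(1)] that(2)])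
  \<comment> \<open>In the variable \<open>s = 1 / (1 + x)\<close> the function
    \<open>1 / (\<alpha> + x)\<close> has the denominator \<open>1 + (\<alpha> - 1) * s\<close> and
    the numerator \<open>s\<close>. Writing \<open>u\<close> as
    \<open>w + (\<alpha> - 1) *\<^sub>R G 1 w\<close> cancels the denominator and leaves
    \<open>G 1 w\<close>, which is \<open>G \<alpha> u\<close>.\<close>
  have res: "\<Phi> (\<lambda>x. 1 / (\<alpha> + x)) u = G \<alpha> u" if \<alpha>: "0 < \<alpha>" and u: "u \<in> S" for \<alpha> u
  proof -
    define w where "w = u + (1 - \<alpha>) *\<^sub>R G \<alpha> u"
    have w: "w \<in> S" "G 1 w = G \<alpha> u" using \<alpha> u G_eq_G1[OF \<alpha> u] by (simp_all add: w_def)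
    let ?r = "P (\<lambda>x. 1 / (\<alpha> + x))"
    have cr: "continuous_on {0..1} ?r" using \<alpha> by (intro cont C0_halfline_resolvent)
    have "B.pop [:1, \<alpha> - 1:] w = w + (\<alpha> - 1) *\<^sub>R G 1 w"
      using w by (simp add: G_scale G_add)
    also have "\<dots> = u" unfolding w(2) by (simp add: w_def scaleR_diff_left)
    finally have pu: "B.pop [:1, \<alpha> - 1:] w = u" .
    have "B.cfc ?r u = B.cfc ?r (B.cfc (poly [:1, \<alpha> - 1:]) w)"
      using w by (simp only: B.cfc_poly pu)
    also have "\<dots> = B.cfc (\<lambda>x. ?r x * poly [:1, \<alpha> - 1:] x) w"
      using w cr by (intro B.cfc_mult[symmetric]) (auto intro!: continuous_intros)
    also have "\<dots> = B.cfc (poly [:0, 1:]) w"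
    proof (rule B.cfc_cong)
      fix s :: real assume s: "s \<in> {0..1}"
      show "?r s * poly [:1, \<alpha> - 1:] s = poly [:0, 1:] s"
      proof (cases "s = 0")
        case False
        then have "s > 0" using s by auto
        have p: "\<alpha> * s + (1 - s) > 0"
          using s \<open>s > 0\<close> \<alpha> by (intro add_pos_nonneg mult_pos_pos) auto
        have "\<alpha> + (1 / s - 1) = (\<alpha> * s + (1 - s)) / s"
          using \<open>s > 0\<close> by (simp add: field_simps)
        then have 1: "?r s = s / (\<alpha> * s + (1 - s))"
          using \<open>s > 0\<close> by (simp add: P_def pull_unit_def \<eta>_def)
        have 2: "poly [:1, \<alpha> - 1:] s = \<alpha> * s + (1 - s)" by (simp add: algebra_simps)
        show ?thesis unfolding 1 2 using p by simp
      qed (simp add: P_def pull_unit_def)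
    qed
    also have "\<dots> = G \<alpha> u" using w by (simp add: B.cfc_poly)
    finally show ?thesis by (simp add: \<Phi>_def)
  qed
  have "C0_calculus S b D A \<Phi>"
    unfolding C0_calculus_def
  proof (intro conjI ballI allI impI)
    fix f assume f: "f \<in> C0_halfline"
    show "linear_between S S (\<Phi> f)"
      using mem[OF f] B.cfc_add_right[OF cont[OF f]] B.cfc_scale_right[OF cont[OF f]]
      unfolding linear_between_def \<Phi>_def by blast
    show "nrm (\<Phi> f u) \<le> (SUP x\<in>{0..}. \<bar>f x\<bar>) * nrm u" if u: "u \<in> S" for u
      unfolding \<Phi>_def
    proof (rule B.cfc_bound[OF cont[OF f] _ u])
      fix s :: real assume s: "s \<in> {0..1}"
      show "\<bar>P f s\<bar> \<le> (SUP x\<in>{0..}. \<bar>f x\<bar>)"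
        using C0_halfline_le_SUP[OF f, of 0] C0_halfline_le_SUP[OF f \<eta>(2)[of s]] s
        by (auto simp: P_def pull_unit_def)
    qed
    show "b (\<Phi> f u) v = b u (\<Phi> f v)" if "u \<in> S" "v \<in> S" for u v
      unfolding \<Phi>_def by (rule B.cfc_sym[OF cont[OF f] that])
    show "\<Phi> (\<lambda>x. c * f x) u = c *\<^sub>R \<Phi> f u" if "u \<in> S" for c u
    proof -
      have "P (\<lambda>x. c * f x) = (\<lambda>s. c * P f s)" by (auto simp: P_def pull_unit_def)
      then show ?thesis using B.cfc_cmult[OF cont[OF f] that] by (simp add: \<Phi>_def)
    qed
    fix g assume g: "g \<in> C0_halfline"
    show "\<Phi> (\<lambda>x. f x + g x) u = \<Phi> f u + \<Phi> g u" if "u \<in> S" for u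
    proof -
      have "P (\<lambda>x. f x + g x) = (\<lambda>s. P f s + P g s)" by (auto simp: P_def pull_unit_def)
      then show ?thesis using B.cfc_add[OF cont[OF f] cont[OF g] that] by (simp add: \<Phi>_def)
    qed
    show "\<Phi> (\<lambda>x. f x * g x) u = \<Phi> f (\<Phi> g u)" if "u \<in> S" for u
    proof -
      have "P (\<lambda>x. f x * g x) = (\<lambda>s. P f s * P g s)" by (auto simp: P_def pull_unit_def)
      then show ?thesis using B.cfc_mult[OF cont[OF f] cont[OF g] that] by (simp add: \<Phi>_def)
    qed
  next
    fix \<alpha> :: real assume \<alpha>: "0 < \<alpha>"
    show "\<Phi> (\<lambda>x. 1 / (\<alpha> + x)) u \<in> D" if "u \<in> S" for u
      using \<alpha> that by (simp add: res)
    show "\<alpha> *\<^sub>R \<Phi> (\<lambda>x. 1 / (\<alpha> + x)) u + A (\<Phi> (\<lambda>x. 1 / (\<alpha> + x)) u) = u" if "u \<in> S" for u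
      using \<alpha> that by (simp add: res A_G)
    show "\<Phi> (\<lambda>x. 1 / (\<alpha> + x)) (\<alpha> *\<^sub>R u + A u) = u" if "u \<in> D" for u
      using \<alpha> that by (simp add: res G_A)
  qed
  then show ?thesis by blast
qed

text \<open>The same choice term as in \<open>fun_calc_graph\<close>; facts about it therefore come
  from the axioms in \<open>C0_calculus\<close> and not from the calculus just constructed.\<close>

definition Phi :: "(real \<Rightarrow> real) \<Rightarrow> 'a \<Rightarrow> 'a" where
  "Phi = (SOME \<Phi>. C0_calculus S b D A \<Phi>)"

lemma Phi: "C0_calculus S b D A Phi"
  unfolding Phi_def by (rule someI_ex[OF C0_calculus_exists])

lemma Phi_linear: "f \<in> C0_halfline \<Longrightarrow> linear_between S S (Phi f)"
  and Phi_bound: "\<lbrakk>f \<in> C0_halfline; u \<in> S\<rbrakk> \<Longrightarrow> nrm (Phi f u) \<le> (SUP x\<in>{0..}. \<bar>f x\<bar>) * nrm u"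
  and Phi_add: "\<lbrakk>f \<in> C0_halfline; g \<in> C0_halfline; u \<in> S\<rbrakk> \<Longrightarrow> Phi (\<lambda>x. f x + g x) u = Phi f u + Phi g u"
  and Phi_cmult: "\<lbrakk>f \<in> C0_halfline; u \<in> S\<rbrakk> \<Longrightarrow> Phi (\<lambda>x. c * f x) u = c *\<^sub>R Phi f u"
  and Phi_mult: "\<lbrakk>f \<in> C0_halfline; g \<in> C0_halfline; u \<in> S\<rbrakk> \<Longrightarrow> Phi (\<lambda>x. f x * g x) u = Phi f (Phi g u)"
  and Phi_resolvent_D: "\<lbrakk>0 < \<alpha>; u \<in> S\<rbrakk> \<Longrightarrow> Phi (\<lambda>x. 1 / (\<alpha> + x)) u \<in> D"
  and Phi_resolvent_eq: "\<lbrakk>0 < \<alpha>; u \<in> S\<rbrakk> \<Longrightarrow>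
    \<alpha> *\<^sub>R Phi (\<lambda>x. 1 / (\<alpha> + x)) u + A (Phi (\<lambda>x. 1 / (\<alpha> + x)) u) = u"
  using Phi unfolding C0_calculus_def by simp_all

lemma Phi_mem [simp]: "\<lbrakk>f \<in> C0_halfline; u \<in> S\<rbrakk> \<Longrightarrow> Phi f u \<in> S"
  using Phi_linear[of f] by (auto simp: linear_between_def)

lemma Phi_resolvent: "\<lbrakk>0 < \<alpha>; u \<in> S\<rbrakk> \<Longrightarrow> Phi (\<lambda>x. 1 / (\<alpha> + x)) u = G \<alpha> u"
  using G_A[of "Phi (\<lambda>x. 1 / (\<alpha> + x)) u" \<alpha>] Phi_resolvent_D[of \<alpha> u] Phi_resolvent_eq[of \<alpha> u] by simp

lemma Phi_dist:
  assumes "f \<in> C0_halfline" "g \<in> C0_halfline" "\<And>x. 0 \<le> x \<Longrightarrow> \<bar>f x - g x\<bar> \<le> \<epsilon>" "u \<in> S"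
  shows "nrm (Phi f u - Phi g u) \<le> \<epsilon> * nrm u"
proof -
  have "(\<lambda>x. - 1 * g x) \<in> C0_halfline" by (rule C0_halfline_cmult[OF assms(2)])
  from C0_halfline_add[OF assms(1) this] Phi_add[OF assms(1) this assms(4)] Phi_cmult[OF assms(2,4), of "-1"]
  have fg: "(\<lambda>x. f x - g x) \<in> C0_halfline" "Phi (\<lambda>x. f x - g x) u = Phi f u - Phi g u" by simp_all
  have "nrm (Phi (\<lambda>x. f x - g x) u) \<le> (SUP x\<in>{0..}. \<bar>f x - g x\<bar>) * nrm u"
    by (rule Phi_bound[OF fg(1) assms(4)])
  also have "\<dots> \<le> \<epsilon> * nrm u"
    using assms by (intro mult_right_mono cSUP_least) auto
  finally show ?thesis by (simp add: fg)
qed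

text \<open>Two regularizing functions are compared after multiplication with each other: the
  calculus is multiplicative, functions commute, and injectivity of both operators cancels them. So
  the definite description in \<open>fun_calc\<close> can be evaluated with any convenient
  \<open>e\<close>.\<close>

lemma fun_calc_eq:
  assumes uv: "u \<in> S" "v \<in> S" and e: "e \<in> C0_halfline" "(\<lambda>x. e x * f x) \<in> C0_halfline" "inj_on (Phi e) S"
    "Phi e v = Phi (\<lambda>x. e x * f x) u"
  shows "fun_calc S b D (\<lambda>u. - gen S G u) f u = v"
proof -
  have graph: "fun_calc_graph S b D (\<lambda>u. - gen S G u) f u v' \<longleftrightarrow> v' \<in> S \<and>
      (\<exists>e\<in>C0_halfline. (\<lambda>x. e x * f x) \<in> C0_halfline \<and> inj_on (Phi e) S \<and> Phi e v' = Phi (\<lambda>x. e x * f x) u)"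
    for v'
    using uv unfolding fun_calc_graph_def Phi_def A_def[abs_def] by (simp add: Let_def)
  show ?thesis
    unfolding fun_calc_def
  proof (rule the_equality)
    show "fun_calc_graph S b D (\<lambda>u. - gen S G u) f u v" using graph uv e by blast
    fix v' assume "fun_calc_graph S b D (\<lambda>u. - gen S G u) f u v'"
    then obtain e' where v': "v' \<in> S" and e': "e' \<in> C0_halfline" "(\<lambda>x. e' x * f x) \<in> C0_halfline"
      "inj_on (Phi e') S" "Phi e' v' = Phi (\<lambda>x. e' x * f x) u" using graph by blast
    have "Phi e (Phi e' v') = Phi (\<lambda>x. e x * (e' x * f x)) u"
      using e e' uv by (simp only: e'(4) Phi_mult[symmetric])
    also have "(\<lambda>x. e x * (e' x * f x)) = (\<lambda>x. e' x * (e x * f x))" by (simp add: mult.left_commute)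
    also have "Phi (\<lambda>x. e' x * (e x * f x)) u = Phi e' (Phi e v)"
      using e e' uv by (simp only: e(4) Phi_mult[symmetric])
    also have "Phi e' (Phi e v) = Phi (\<lambda>x. e' x * e x) v" using e e' uv by (simp only: Phi_mult)
    also have "(\<lambda>x. e' x * e x) = (\<lambda>x. e x * e' x)" by (simp add: mult.commute)
    also have "Phi (\<lambda>x. e x * e' x) v = Phi e (Phi e' v)" using e e' uv by (simp only: Phi_mult)
    finally have "Phi e' v' = Phi e' v" using e(3) e'(1) uv v' by (simp add: inj_on_eq_iff)
    then show "v' = v" using e'(3) uv v' by (simp add: inj_on_eq_iff)
  qed
qed

text \<open>These are the regularizing functions: powers of the resolvent are injective as iterates
  of \<open>G 1\<close>, and their exponent can be adapted to the growth of the function.\<close>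

lemma Phi_resolvent_power:
  "(\<lambda>x. (1 / (1 + x)) ^ Suc m) \<in> C0_halfline \<and> inj_on (Phi (\<lambda>x. (1 / (1 + x)) ^ Suc m)) S"
proof (induction m)
  case 0
  have "inj_on (Phi (\<lambda>x. 1 / (1 + x))) S"
    using G_inj[of 1] inj_on_cong[of S "Phi (\<lambda>x. 1 / (1 + x))" "G 1"] Phi_resolvent[of 1] by simp
  then show ?case using C0_halfline_resolvent[of 1] by simp
next
  case (Suc m)
  let ?r = "\<lambda>x::real. 1 / (1 + x)" and ?e = "\<lambda>x::real. (1 / (1 + x)) ^ Suc m"
  have r: "?r \<in> C0_halfline" using C0_halfline_resolvent[of 1] by simp
  have e: "?e \<in> C0_halfline" "inj_on (Phi ?e) S" using Suc by auto
  have eq: "(\<lambda>x::real. (1 / (1 + x)) ^ Suc (Suc m)) = (\<lambda>x. ?r x * ?e x)" by (simp only: power_Suc)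
  have re: "Phi (\<lambda>x. ?r x * ?e x) u = G 1 (Phi ?e u)" if "u \<in> S" for u
    using Phi_mult[OF r e(1) that] Phi_resolvent[of 1 "Phi ?e u"] that e by simp
  have "inj_on (Phi (\<lambda>x. ?r x * ?e x)) S"
  proof (rule inj_onI)
    fix u v assume uv: "u \<in> S" "v \<in> S" "Phi (\<lambda>x. ?r x * ?e x) u = Phi (\<lambda>x. ?r x * ?e x) v"
    then have "G 1 (Phi ?e u) = G 1 (Phi ?e v)" by (simp only: re)
    then have "Phi ?e u = Phi ?e v" using inj_onD[OF G_inj[of 1]] uv e by simp
    then show "u = v" using inj_onD[OF e(2)] uv by blast
  qed
  then show ?case unfolding eq using C0_halfline_mult[OF r e(1)] by blast
qed

end

section \<open>Powers of the variable, damped by resolvents and exponentials\<close>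

definition xpow :: "real \<Rightarrow> real \<Rightarrow> real" where
  "xpow p x = (if p = 0 then 1 else x powr p)"

lemma continuous_on_xpow: "0 \<le> p \<Longrightarrow> continuous_on {0..} (xpow p)"
proof (cases "p = 0")
  case False
  assume "0 \<le> p"
  then have "continuous_on {0..} (\<lambda>x::real. x powr p)"
    using False by (intro continuous_on_powr' continuous_on_id continuous_on_const) auto
  then show ?thesis using False by (simp add: xpow_def[abs_def])
qed (simp add: xpow_def[abs_def])

lemma xpow_le: "\<lbrakk>0 \<le> p; p \<le> real m; 0 \<le> x\<rbrakk> \<Longrightarrow> \<bar>xpow p x\<bar> \<le> (1 + x) ^ m"
proof -
  assume *: "0 \<le> p" "p \<le> real m" "0 \<le> x"
  have "x powr p \<le> (1 + x) powr p" using * by (intro powr_mono2) auto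
  also have "\<dots> \<le> (1 + x) powr real m" using * by (intro powr_mono) auto
  also have "\<dots> = (1 + x) ^ m" using * by (simp add: powr_realpow)
  finally show ?thesis using * by (simp add: xpow_def)
qed

text \<open>\<open>m\<close> factors absorb the growth of the power, and the one left over tends to
  0.\<close>

lemma C0_halfline_resolvent_xpow:
  assumes "0 \<le> p" "p \<le> real m"
  shows "(\<lambda>x. (1 / (1 + x)) ^ Suc m * xpow p x) \<in> C0_halfline"
proof -
  have r: "(\<lambda>x. 1 / (1 + x :: real)) \<in> C0_halfline" using C0_halfline_resolvent[of 1] by simp
  have lim: "((\<lambda>x. 1 / (1 + x :: real)) \<longlongrightarrow> 0) at_top" using r by (simp add: C0_halfline_def)
  have "\<forall>\<^sub>F x in at_top. norm ((1 / (1 + x)) ^ Suc m * xpow p x) \<le> 1 / (1 + x)"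
    using eventually_ge_at_top[of 0]
  proof eventually_elim
    case (elim x)
    have "norm ((1 / (1 + x)) ^ Suc m * xpow p x) = (1 / (1 + x)) ^ Suc m * \<bar>xpow p x\<bar>"
      using elim by (simp add: abs_mult power_abs)
    also have "\<dots> \<le> (1 / (1 + x)) ^ Suc m * (1 + x) ^ m"
      using elim assms by (intro mult_left_mono xpow_le) auto
    also have "\<dots> = 1 / (1 + x) * (1 / (1 + x) * (1 + x)) ^ m"
      by (simp only: power_mult_distrib power_Suc mult.assoc)
    also have "\<dots> = 1 / (1 + x)" using elim by simp
    finally show ?case .
  qed
  then have "((\<lambda>x. (1 / (1 + x)) ^ Suc m * xpow p x) \<longlongrightarrow> 0) at_top"
    by (rule Lim_null_comparison[OF _ lim])
  moreover have "continuous_on {0..} (\<lambda>x. (1 / (1 + x)) ^ Suc m * xpow p x)"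
    using assms by (intro continuous_intros continuous_on_xpow) auto
  ultimately show ?thesis by (simp add: C0_halfline_def)
qed

lemma C0_halfline_exp:
  assumes "0 < t"
  shows "(\<lambda>x. exp (- t * x)) \<in> C0_halfline"
proof -
  have "filterlim (\<lambda>x. t * x) at_top at_top"
    by (rule filterlim_tendsto_pos_mult_at_top[OF tendsto_const assms filterlim_ident])
  then have "((\<lambda>x. exp (- (t * x))) \<longlongrightarrow> 0) at_top"
    by (intro filterlim_compose[OF exp_at_bot] filterlim_compose[OF filterlim_uminus_at_bot_at_top])
  then show ?thesis by (auto simp: C0_halfline_def intro!: continuous_intros)
qed

text \<open>Half of the exponential dominates the power, the other half still decays.\<close>

lemma C0_halfline_xpow_exp:
  assumes "0 < t" "0 \<le> p"
  shows "(\<lambda>x. xpow p x * exp (- t * x)) \<in> C0_halfline"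
proof -
  obtain m :: nat where m: "p \<le> real m" using real_arch_simple by blast
  \<comment> \<open>Chosen such that \<open>real m * \<sigma> \<le> t / 2\<close>, with
    \<open>Suc m\<close> in the denominator to cover \<open>m = 0\<close>; the constant
    \<open>c\<close> below yields \<open>1 + x \<le> c * (1 + \<sigma> * x)\<close>.\<close>
  define \<sigma> where "\<sigma> = t / (2 * real (Suc m))"
  have \<sigma>: "\<sigma> > 0" using assms by (simp add: \<sigma>_def)
  define c where "c = 1 + 1 / \<sigma>"
  have "(\<lambda>x. exp (- (t / 2) * x)) \<in> C0_halfline" using assms by (intro C0_halfline_exp) simp
  then have "(\<lambda>x. c ^ m * exp (- (t / 2) * x)) \<in> C0_halfline" by (rule C0_halfline_cmult)
  then have lim: "((\<lambda>x. c ^ m * exp (- (t / 2) * x)) \<longlongrightarrow> 0) at_top" by (simp add: C0_halfline_def)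
  have "\<forall>\<^sub>F x in at_top. norm (xpow p x * exp (- t * x)) \<le> c ^ m * exp (- (t / 2) * x)"
    using eventually_ge_at_top[of 0]
  proof eventually_elim
    case (elim x)
    have "1 + x \<le> c * (1 + \<sigma> * x)"
      using \<sigma> elim by (simp add: c_def field_simps)
    also have "\<dots> \<le> c * exp (\<sigma> * x)"
      using \<sigma> by (intro mult_left_mono exp_ge_add_one_self) (simp add: c_def)
    finally have "(1 + x) ^ m \<le> (c * exp (\<sigma> * x)) ^ m" using elim by (intro power_mono) auto
    also have "\<dots> = c ^ m * exp (real m * (\<sigma> * x))"
      by (simp add: power_mult_distrib exp_of_nat_mult)
    also have "\<dots> \<le> c ^ m * exp (t / 2 * x)"
    proof -
      have "real m * \<sigma> \<le> real (Suc m) * \<sigma>" using \<sigma> by (intro mult_right_mono) auto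
      also have "\<dots> = t / 2" by (simp add: \<sigma>_def del: of_nat_Suc)
      finally have "real m * \<sigma> * x \<le> t / 2 * x" using elim by (intro mult_right_mono) auto
      then show ?thesis using \<sigma> by (intro mult_left_mono) (simp_all add: c_def mult.assoc)
    qed
    finally have le: "\<bar>xpow p x\<bar> \<le> c ^ m * exp (t / 2 * x)"
      using xpow_le[OF assms(2) m elim] by linarith
    have "norm (xpow p x * exp (- t * x)) = \<bar>xpow p x\<bar> * exp (- t * x)" by (simp add: abs_mult)
    also have "\<dots> \<le> c ^ m * exp (t / 2 * x) * exp (- t * x)" using le by (intro mult_right_mono) auto
    also have "\<dots> = c ^ m * exp (- (t / 2) * x)"
      by (simp add: mult.assoc flip: exp_add)
    finally show ?case .
  qed
  then have "((\<lambda>x. xpow p x * exp (- t * x)) \<longlongrightarrow> 0) at_top"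
    by (rule Lim_null_comparison[OF _ lim])
  moreover have "continuous_on {0..} (\<lambda>x. xpow p x * exp (- t * x))"
    using assms by (intro continuous_intros continuous_on_xpow) auto
  ultimately show ?thesis by (simp add: C0_halfline_def)
qed

context resolvent_on
begin

lemma gen_semigroup_eq:
  assumes "0 < t" "u \<in> S"
  shows "gen_semigroup S b G t u = Phi (\<lambda>x. exp (- t * x)) u"
  unfolding gen_semigroup_def
proof (rule fun_calc_eq[where e = "\<lambda>x. (1 / (1 + x)) ^ Suc 0"])
  note e = conjunct1[OF Phi_resolvent_power[of 0]] conjunct2[OF Phi_resolvent_power[of 0]]
  note f = C0_halfline_exp[OF assms(1)]
  show "(\<lambda>x. (1 / (1 + x)) ^ Suc 0) \<in> C0_halfline" "inj_on (Phi (\<lambda>x. (1 / (1 + x)) ^ Suc 0)) S"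
    by (rule e)+
  show "(\<lambda>x. (1 / (1 + x)) ^ Suc 0 * exp (- t * x)) \<in> C0_halfline"
    by (rule C0_halfline_mult[OF e(1) f])
  show "Phi (\<lambda>x. (1 / (1 + x)) ^ Suc 0) (Phi (\<lambda>x. exp (- t * x)) u) =
      Phi (\<lambda>x. (1 / (1 + x)) ^ Suc 0 * exp (- t * x)) u"
    by (rule Phi_mult[OF e(1) f assms(2), symmetric])
  show "Phi (\<lambda>x. exp (- t * x)) u \<in> S" using f assms by simp
qed (rule assms)

text \<open>The power is unbounded, but the semigroup maps into its domain. After regularization by
  a power of the resolvent, the claim is associativity of a product of three functions.\<close>

lemma gen_power_semigroup_eq:
  assumes "0 < t" "0 \<le> p" "u \<in> S"
  shows "gen_power S b G p (gen_semigroup S b G t u) = Phi (\<lambda>x. xpow p x * exp (- t * x)) u"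
proof -
  obtain m :: nat where m: "p \<le> real m" using real_arch_simple by blast
  let ?e = "\<lambda>x::real. (1 / (1 + x)) ^ Suc m" and ?g = "\<lambda>x::real. exp (- t * x)"
  note e = conjunct1[OF Phi_resolvent_power[of m]] conjunct2[OF Phi_resolvent_power[of m]]
  note g = C0_halfline_exp[OF assms(1)] and h = C0_halfline_xpow_exp[OF assms(1,2)]
  note ef = C0_halfline_resolvent_xpow[OF assms(2) m]
  have "fun_calc S b D (\<lambda>u. - gen S G u) (xpow p) (Phi ?g u) = Phi (\<lambda>x. xpow p x * ?g x) u"
  proof (rule fun_calc_eq[where e = ?e])
    have "Phi ?e (Phi (\<lambda>x. xpow p x * ?g x) u) = Phi (\<lambda>x. ?e x * (xpow p x * ?g x)) u"
      by (rule Phi_mult[OF e(1) h assms(3), symmetric])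
    also have "(\<lambda>x. ?e x * (xpow p x * ?g x)) = (\<lambda>x. (?e x * xpow p x) * ?g x)"
      by (simp only: mult.assoc)
    also have "Phi \<dots> u = Phi (\<lambda>x. ?e x * xpow p x) (Phi ?g u)"
      by (rule Phi_mult[OF ef g assms(3)])
    finally show "Phi ?e (Phi (\<lambda>x. xpow p x * ?g x) u) = Phi (\<lambda>x. ?e x * xpow p x) (Phi ?g u)" .
  qed (use e ef g h assms in auto)
  then show ?thesis
    using assms by (simp add: gen_power_def gen_semigroup_eq xpow_def[abs_def])
qed

end

declare [[coercion "enat :: nat \<Rightarrow> enat"]]

section \<open>Sections of converging Hilbert spaces\<close>

text \<open>Both the comparison sequence and its limit may depend on \<epsilon>. This is the
  interchange of limits used whenever a section is approximated by better behaved ones.\<close>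

lemma tendsto_approx:
  fixes x :: "nat \<Rightarrow> real"
  assumes "\<And>\<epsilon>. 0 < \<epsilon> \<Longrightarrow> \<exists>y l. y \<longlonglongrightarrow> l \<and> \<bar>l - L\<bar> \<le> \<epsilon> \<and> (\<forall>\<^sub>F n in sequentially. \<bar>x n - y n\<bar> \<le> \<epsilon>)"
  shows "x \<longlonglongrightarrow> L"
proof (rule LIMSEQ_I)
  fix \<epsilon> :: real assume "0 < \<epsilon>"
  then have "0 < \<epsilon> / 4" by simp
  then obtain y l where y: "y \<longlonglongrightarrow> l" "\<bar>l - L\<bar> \<le> \<epsilon> / 4" "\<forall>\<^sub>F n in sequentially. \<bar>x n - y n\<bar> \<le> \<epsilon> / 4"
    using assms by meson
  have "\<forall>\<^sub>F n in sequentially. \<bar>y n - l\<bar> < \<epsilon> / 4"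
    using tendstoD[OF y(1) \<open>0 < \<epsilon> / 4\<close>] by (simp add: dist_norm)
  with y(3) have "\<forall>\<^sub>F n in sequentially. norm (x n - L) < \<epsilon>"
  proof eventually_elim
    case (elim n)
    then show ?case using y(2) \<open>0 < \<epsilon>\<close> unfolding real_norm_def by argo
  qed
  then show "\<exists>N. \<forall>n\<ge>N. norm (x n - L) < \<epsilon>" by (simp add: eventually_sequentially)
qed

text \<open>\<open>\<kappa> n\<close> is the largest \<open>k \<le> n\<close> such that
  \<open>n\<close> has passed the thresholds of all \<open>j \<le> k\<close>; it is unbounded, but
  grows slowly enough.\<close>

lemma diagonal_choice:
  fixes P :: "nat \<Rightarrow> nat \<Rightarrow> bool"
  assumes "\<And>k. \<forall>\<^sub>F n in sequentially. P k n"
  obtains \<kappa> where "filterlim \<kappa> at_top sequentially" "\<forall>\<^sub>F n in sequentially. P (\<kappa> n) n"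
proof -
  obtain M where M: "\<And>k n. M k \<le> n \<Longrightarrow> P k n"
    using assms unfolding eventually_sequentially by metis
  define K where "K n = {k. k \<le> n \<and> (\<forall>j\<le>k. M j \<le> n)}" for n
  define \<kappa> where "\<kappa> n = Max (K n)" for n
  have fin: "finite (K n)" for n by (simp add: K_def)
  have in_K: "\<kappa> n \<in> K n" if "M 0 \<le> n" for n
  proof -
    have "0 \<in> K n" using that by (simp add: K_def)
    then show ?thesis unfolding \<kappa>_def using fin by (intro Max_in) auto
  qed
  have "\<forall>\<^sub>F n in sequentially. P (\<kappa> n) n"
    using eventually_ge_at_top[of "M 0"]
    by eventually_elim (use in_K M in \<open>auto simp: K_def\<close>)
  moreover have "filterlim \<kappa> at_top sequentially"
    unfolding filterlim_at_top
  proof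
    fix k
    define N where "N = Max (insert k (M ` {..k}))"
    have N: "k \<le> N" unfolding N_def by (rule Max_ge) auto
    have N': "M j \<le> N" if "j \<le> k" for j unfolding N_def using that by (intro Max_ge) auto
    show "\<forall>\<^sub>F n in sequentially. k \<le> \<kappa> n"
      using eventually_ge_at_top[of N]
    proof eventually_elim
      case (elim n)
      then have "k \<in> K n" using N N' by (force simp: K_def)
      then show ?case unfolding \<kappa>_def using fin by (intro Max_ge)
    qed
  qed
  ultimately show thesis using that by blast
qed

lemma tendsto_fill:
  fixes a c :: "nat \<Rightarrow> real"
  assumes "strict_mono r" "(a \<circ> r) \<longlonglongrightarrow> l" "c \<longlonglongrightarrow> l" "\<And>n. n \<notin> range r \<Longrightarrow> a n = c n"
  shows "a \<longlonglongrightarrow> l"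
proof (rule LIMSEQ_I)
  fix \<epsilon> :: real assume "0 < \<epsilon>"
  obtain K where K: "\<And>k. K \<le> k \<Longrightarrow> norm ((a \<circ> r) k - l) < \<epsilon>"
    using LIMSEQ_D[OF assms(2) \<open>0 < \<epsilon>\<close>] by blast
  obtain N where N: "\<And>n. N \<le> n \<Longrightarrow> norm (c n - l) < \<epsilon>"
    using LIMSEQ_D[OF assms(3) \<open>0 < \<epsilon>\<close>] by blast
  have "norm (a n - l) < \<epsilon>" if n: "max N (r K) \<le> n" for n
  proof (cases "n \<in> range r")
    case True
    then obtain k where k: "n = r k" by blast
    then have "K \<le> k" using n strict_mono_less_eq[OF assms(1)] by simp
    then show ?thesis using K k by simp
  qed (use N n assms(4) in simp)
  then show "\<exists>N. \<forall>n\<ge>N. norm (a n - l) < \<epsilon>" by blast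
qed

lemma section_of_simps [simp]:
  "section_of x u (enat n) = x n" "section_of x u \<infinity> = u"
  by (simp_all add: section_of_def)

lemma subindex_simps [simp]: "subindex r (enat k) = enat (r k)" "subindex r \<infinity> = \<infinity>"
  by (simp_all add: subindex_def)

locale converging =
  fixes H :: "enat \<Rightarrow> 'a::real_vector set" and ip C \<Psi>
  assumes conv: "converging_hilbert_spaces H ip C \<Psi>"
begin

sublocale Hil: hilbert_on "H N" "ip N" for N
  using conv by (intro hilbert_onI) (simp add: converging_hilbert_spaces_def)

abbreviation nrm :: "enat \<Rightarrow> 'a \<Rightarrow> real" where "nrm N \<equiv> ip_norm (ip N)"
abbreviation sc :: "(enat \<Rightarrow> 'a) \<Rightarrow> bool" where "sc \<equiv> strongly_conv H ip C \<Psi>"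
abbreviation wc :: "(enat \<Rightarrow> 'a) \<Rightarrow> bool" where "wc \<equiv> weakly_conv H ip C \<Psi>"

lemma C_subspace: "subspace C" and C_mem: "\<phi> \<in> C \<Longrightarrow> \<phi> \<in> H \<infinity>"
  using conv by (auto simp: converging_hilbert_spaces_def dense_subspace_def)

lemma C_dense: "\<lbrakk>u \<in> H \<infinity>; 0 < \<epsilon>\<rbrakk> \<Longrightarrow> \<exists>\<phi>\<in>C. nrm \<infinity> (u - \<phi>) < \<epsilon>"
  using conv Hil.closure_iff[of C \<infinity>] by (auto simp: converging_hilbert_spaces_def dense_subspace_def)

lemma Psi_mem [simp]: "\<phi> \<in> C \<Longrightarrow> \<Psi> N \<phi> \<in> H N"
  and Psi_add: "\<lbrakk>\<phi> \<in> C; \<psi> \<in> C\<rbrakk> \<Longrightarrow> \<Psi> N (\<phi> + \<psi>) = \<Psi> N \<phi> + \<Psi> N \<psi>"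
  and Psi_inf [simp]: "\<phi> \<in> C \<Longrightarrow> \<Psi> \<infinity> \<phi> = \<phi>"
  and Psi_sq: "\<phi> \<in> C \<Longrightarrow> (\<lambda>n. ip n (\<Psi> n \<phi>) (\<Psi> n \<phi>)) \<longlonglongrightarrow> ip \<infinity> \<phi> \<phi>"
  using conv unfolding converging_hilbert_spaces_def linear_between_def image_subset_iff
  by simp_all

lemma scD:
  assumes "sc u"
  shows "u N \<in> H N" "(\<lambda>n. nrm n (u n)) \<longlonglongrightarrow> nrm \<infinity> (u \<infinity>)"
    "\<phi> \<in> C \<Longrightarrow> (\<lambda>n. ip n (u n) (\<Psi> n \<phi>)) \<longlonglongrightarrow> ip \<infinity> (u \<infinity>) \<phi>"
  using assms by (auto simp: strongly_conv_def)

text \<open>Polarization: convergence of squared norms at \<open>\<phi> + \<psi>\<close>, \<phi> and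
  \<psi> gives that of inner products.\<close>

lemma Psi_sc: "\<phi> \<in> C \<Longrightarrow> sc (\<lambda>N. \<Psi> N \<phi>)"
proof -
  assume \<phi>: "\<phi> \<in> C"
  have "(\<lambda>n. ip n (\<Psi> n \<phi>) (\<Psi> n \<psi>)) \<longlonglongrightarrow> ip \<infinity> \<phi> \<psi>" if \<psi>: "\<psi> \<in> C" for \<psi>
  proof -
    have "\<phi> + \<psi> \<in> C" using \<phi> \<psi> C_subspace by (rule_tac subspace_add)
    from tendsto_diff[OF tendsto_diff[OF Psi_sq[OF this] Psi_sq[OF \<phi>]] Psi_sq[OF \<psi>]]
    have "(\<lambda>n. 2 * ip n (\<Psi> n \<phi>) (\<Psi> n \<psi>)) \<longlonglongrightarrow> 2 * ip \<infinity> \<phi> \<psi>"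
      using \<phi> \<psi> by (simp add: Psi_add Hil.sq_add C_mem)
    then show ?thesis by (rule tendsto_mult_left_iff[THEN iffD1, rotated]) simp
  qed
  then show ?thesis
    using \<phi> tendsto_real_sqrt[OF Psi_sq[OF \<phi>]] by (simp add: strongly_conv_def ip_norm_def C_mem)
qed

lemma sc_sq: "sc u \<Longrightarrow> (\<lambda>n. ip n (u n) (u n)) \<longlonglongrightarrow> ip \<infinity> (u \<infinity>) (u \<infinity>)"
proof -
  assume u: "sc u"
  have "(\<lambda>n. (nrm n (u n))\<^sup>2) \<longlonglongrightarrow> (nrm \<infinity> (u \<infinity>))\<^sup>2"
    by (intro tendsto_power scD(2) u)
  then show ?thesis using scD(1)[OF u] by (simp add: Hil.nrm_sq)
qed

text \<open>The bridge between different spaces: if \<phi> is close to the limit vector, then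
  \<open>\<Psi> n \<phi>\<close> is as close to \<open>u n\<close> for all large
  \<open>n\<close>.\<close>

lemma sc_diff_Psi:
  assumes "sc u" "\<phi> \<in> C"
  shows "(\<lambda>n. nrm n (u n - \<Psi> n \<phi>)) \<longlonglongrightarrow> nrm \<infinity> (u \<infinity> - \<phi>)"
proof -
  have "(\<lambda>n. ip n (u n) (u n) - 2 * ip n (u n) (\<Psi> n \<phi>)
      + ip n (\<Psi> n \<phi>) (\<Psi> n \<phi>))
    \<longlonglongrightarrow> ip \<infinity> (u \<infinity>) (u \<infinity>) - 2 * ip \<infinity> (u \<infinity>) \<phi> + ip \<infinity> \<phi> \<phi>"
    by (intro tendsto_intros sc_sq scD(3) Psi_sq assms)
  then have "(\<lambda>n. ip n (u n - \<Psi> n \<phi>) (u n - \<Psi> n \<phi>))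
      \<longlonglongrightarrow> ip \<infinity> (u \<infinity> - \<phi>) (u \<infinity> - \<phi>)"
    using assms scD(1)[OF assms(1)] by (simp add: Hil.sq_diff C_mem)
  then show ?thesis unfolding ip_norm_def by (rule tendsto_real_sqrt)
qed

lemma tendsto_inner_approx:
  fixes x :: "nat \<Rightarrow> 'a"
  assumes K: "0 < K" "\<forall>\<^sub>F n in sequentially. nrm n (x n) \<le> K" "nrm \<infinity> y \<le> K"
    and mem: "\<And>n. x n \<in> H n" "\<And>N. v N \<in> H N" "y \<in> H \<infinity>"
    and approx: "\<And>\<epsilon>. 0 < \<epsilon> \<Longrightarrow> \<exists>w. (\<forall>N. w N \<in> H N) \<and> nrm \<infinity> (v \<infinity> - w \<infinity>) \<le> \<epsilon> \<and>
      (\<forall>\<^sub>F n in sequentially. nrm n (v n - w n) \<le> \<epsilon>) \<and>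
      (\<lambda>n. ip n (x n) (w n)) \<longlonglongrightarrow> ip \<infinity> y (w \<infinity>)"
  shows "(\<lambda>n. ip n (x n) (v n)) \<longlonglongrightarrow> ip \<infinity> y (v \<infinity>)"
proof (rule tendsto_approx)
  fix \<epsilon> :: real assume "0 < \<epsilon>"
  then have "0 < \<epsilon> / K" using K by simp
  then obtain w where w: "\<And>N. w N \<in> H N" "nrm \<infinity> (v \<infinity> - w \<infinity>) \<le> \<epsilon> / K"
    "\<forall>\<^sub>F n in sequentially. nrm n (v n - w n) \<le> \<epsilon> / K"
    "(\<lambda>n. ip n (x n) (w n)) \<longlonglongrightarrow> ip \<infinity> y (w \<infinity>)" using approx by meson
  have bound: "\<bar>ip N a (v N) - ip N a (w N)\<bar> \<le> \<epsilon>"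
    if "a \<in> H N" "nrm N a \<le> K" "nrm N (v N - w N) \<le> \<epsilon> / K" for N a
  proof -
    have "ip N a (v N) - ip N a (w N) = ip N a (v N - w N)"
      using that mem w by (simp add: Hil.diff_right)
    also have "\<bar>\<dots>\<bar> \<le> nrm N a * nrm N (v N - w N)"
      using that mem w by (intro Hil.cauchy_schwarz) auto
    also have "\<dots> \<le> K * (\<epsilon> / K)" using that mem w K by (intro mult_mono) auto
    finally show ?thesis using K by simp
  qed
  have "\<bar>ip \<infinity> y (w \<infinity>) - ip \<infinity> y (v \<infinity>)\<bar> \<le> \<epsilon>"
    using bound[of y \<infinity>] mem K w by (simp add: abs_minus_commute)
  moreover have "\<forall>\<^sub>F n in sequentially. \<bar>ip n (x n) (v n) - ip n (x n) (w n)\<bar> \<le> \<epsilon>"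
    using K(2) w(3) by eventually_elim (use bound mem in auto)
  ultimately show "\<exists>z l. z \<longlonglongrightarrow> l \<and> \<bar>l - ip \<infinity> y (v \<infinity>)\<bar> \<le> \<epsilon> \<and>
      (\<forall>\<^sub>F n in sequentially. \<bar>ip n (x n) (v n) - z n\<bar> \<le> \<epsilon>)"
    using w(4) by blast
qed

lemma eventually_nrm_le:
  fixes x :: "nat \<Rightarrow> 'a"
  assumes "(\<lambda>n. nrm n (x n)) \<longlonglongrightarrow> l"
  shows "\<forall>\<^sub>F n in sequentially. nrm n (x n) \<le> \<bar>l\<bar> + 1"
proof -
  have "l < \<bar>l\<bar> + 1" by linarith
  from order_tendstoD(2)[OF assms this] show ?thesis
    by eventually_elim simp
qed

text \<open>Norms change by at most \<epsilon> under the approximation, and pairings with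
  \<open>\<Psi> n \<phi>\<close> by \<epsilon> times a bound for its norm.\<close>

lemma sc_closed:
  assumes mem: "\<And>N. u N \<in> H N"
    and approx: "\<And>\<epsilon>. 0 < \<epsilon> \<Longrightarrow> \<exists>v. sc v \<and> nrm \<infinity> (u \<infinity> - v \<infinity>) \<le> \<epsilon> \<and>
      (\<forall>\<^sub>F n in sequentially. nrm n (u n - v n) \<le> \<epsilon>)"
  shows "sc u"
  unfolding strongly_conv_def
proof (intro conjI allI ballI)
  show "u N \<in> H N" for N by (rule mem)
  show "(\<lambda>n. nrm n (u n)) \<longlonglongrightarrow> nrm \<infinity> (u \<infinity>)"
  proof (rule tendsto_approx)
    fix \<epsilon> :: real assume "0 < \<epsilon>"
    then obtain v where v: "sc v" "nrm \<infinity> (u \<infinity> - v \<infinity>) \<le> \<epsilon>"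
      "\<forall>\<^sub>F n in sequentially. nrm n (u n - v n) \<le> \<epsilon>" using approx by meson
    have "\<bar>nrm \<infinity> (v \<infinity>) - nrm \<infinity> (u \<infinity>)\<bar> \<le> \<epsilon>"
      using Hil.nrm_diff_abs[OF mem[of \<infinity>] scD(1)[OF v(1), of \<infinity>]] v(2) by linarith
    moreover have "\<forall>\<^sub>F n in sequentially. \<bar>nrm n (u n) - nrm n (v n)\<bar> \<le> \<epsilon>"
      using v(3)
    proof eventually_elim
      case (elim n)
      then show ?case
        using Hil.nrm_diff_abs[OF mem[of "enat n"] scD(1)[OF v(1), of "enat n"]] by linarith
    qed
    ultimately show "\<exists>y l. y \<longlonglongrightarrow> l \<and> \<bar>l - nrm \<infinity> (u \<infinity>)\<bar> \<le> \<epsilon> \<and>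
        (\<forall>\<^sub>F n in sequentially. \<bar>nrm n (u n) - y n\<bar> \<le> \<epsilon>)"
      using scD(2)[OF v(1)] by blast
  qed
  fix \<phi> assume \<phi>: "\<phi> \<in> C"
  have "(\<lambda>n. ip n (\<Psi> n \<phi>) (u n)) \<longlonglongrightarrow> ip \<infinity> \<phi> (u \<infinity>)"
  proof (rule tendsto_inner_approx)
    have lim: "(\<lambda>n. nrm n (\<Psi> n \<phi>)) \<longlonglongrightarrow> nrm \<infinity> \<phi>"
      using scD(2)[OF Psi_sc[OF \<phi>]] \<phi> by simp
    show "\<forall>\<^sub>F n in sequentially. nrm n (\<Psi> n \<phi>) \<le> \<bar>nrm \<infinity> \<phi>\<bar> + 1"
      by (rule eventually_nrm_le[OF lim])
    show "0 < \<bar>nrm \<infinity> \<phi>\<bar> + 1" by linarith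
    fix \<epsilon> :: real assume "0 < \<epsilon>"
    then obtain v where v: "sc v" "nrm \<infinity> (u \<infinity> - v \<infinity>) \<le> \<epsilon>"
      "\<forall>\<^sub>F n in sequentially. nrm n (u n - v n) \<le> \<epsilon>" using approx by meson
    have "ip N (\<Psi> N \<phi>) (v N) = ip N (v N) (\<Psi> N \<phi>)" for N
      using scD(1)[OF v(1)] \<phi> by (intro Hil.sym) auto
    then have "(\<lambda>n. ip n (\<Psi> n \<phi>) (v n)) \<longlonglongrightarrow> ip \<infinity> \<phi> (v \<infinity>)"
      using scD(3)[OF v(1) \<phi>] Hil.sym[of \<phi> \<infinity> "v \<infinity>"] C_mem[OF \<phi>] scD(1)[OF v(1)] by simp
    then show "\<exists>w. (\<forall>N. w N \<in> H N) \<and> nrm \<infinity> (u \<infinity> - w \<infinity>) \<le> \<epsilon> \<and>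
      (\<forall>\<^sub>F n in sequentially. nrm n (u n - w n) \<le> \<epsilon>) \<and>
      (\<lambda>n. ip n (\<Psi> n \<phi>) (w n)) \<longlonglongrightarrow> ip \<infinity> \<phi> (w \<infinity>)"
      using v scD(1)[OF v(1)] by blast
  qed (use \<phi> mem C_mem in auto)
  moreover have "ip N (\<Psi> N \<phi>) (u N) = ip N (u N) (\<Psi> N \<phi>)" for N
    using mem \<phi> by (intro Hil.sym) auto
  ultimately show "(\<lambda>n. ip n (u n) (\<Psi> n \<phi>)) \<longlonglongrightarrow> ip \<infinity> (u \<infinity>) \<phi>"
    using Hil.sym[of \<phi> \<infinity> "u \<infinity>"] C_mem[OF \<phi>] mem by simp
qed

text \<open>Strong convergence is tested with \<open>\<Psi> n \<phi>\<close> only; density of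
  \<open>C\<close> and boundedness of \<open>u\<close> extend the test to strongly convergent
  \<open>v\<close>. In particular strong convergence implies weak convergence.\<close>

lemma sc_inner:
  assumes u: "sc u" and v: "sc v"
  shows "(\<lambda>n. ip n (u n) (v n)) \<longlonglongrightarrow> ip \<infinity> (u \<infinity>) (v \<infinity>)"
proof (rule tendsto_inner_approx)
  show "\<forall>\<^sub>F n in sequentially. nrm n (u n) \<le> \<bar>nrm \<infinity> (u \<infinity>)\<bar> + 1"
    by (rule eventually_nrm_le[OF scD(2)[OF u]])
  show "0 < \<bar>nrm \<infinity> (u \<infinity>)\<bar> + 1" by linarith
  fix \<epsilon> :: real assume "0 < \<epsilon>"
  then obtain \<phi> where \<phi>: "\<phi> \<in> C" "nrm \<infinity> (v \<infinity> - \<phi>) < \<epsilon>"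
    using C_dense[OF scD(1)[OF v, of \<infinity>]] by blast
  have "\<forall>\<^sub>F n in sequentially. nrm n (v n - \<Psi> n \<phi>) < \<epsilon>"
    by (rule order_tendstoD(2)[OF sc_diff_Psi[OF v \<phi>(1)] \<phi>(2)])
  then have "\<forall>\<^sub>F n in sequentially. nrm n (v n - \<Psi> n \<phi>) \<le> \<epsilon>"
    by eventually_elim simp
  then show "\<exists>w. (\<forall>N. w N \<in> H N) \<and> nrm \<infinity> (v \<infinity> - w \<infinity>) \<le> \<epsilon> \<and>
      (\<forall>\<^sub>F n in sequentially. nrm n (v n - w n) \<le> \<epsilon>) \<and>
      (\<lambda>n. ip n (u n) (w n)) \<longlonglongrightarrow> ip \<infinity> (u \<infinity>) (w \<infinity>)"
    using \<phi> scD(3)[OF u \<phi>(1)] by (intro exI[of _ "\<lambda>N. \<Psi> N \<phi>"]) auto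
qed (use scD(1)[OF u] scD(1)[OF v] in auto)

lemma wcD:
  assumes "wc u"
  shows "u N \<in> H N"
    and "sc v \<Longrightarrow> (\<lambda>n. ip n (u n) (v n)) \<longlonglongrightarrow> ip \<infinity> (u \<infinity>) (v \<infinity>)"
  using assms by (auto simp: weakly_conv_def)

lemma sc_add:
  assumes u: "sc u" and v: "sc v"
  shows "sc (\<lambda>N. u N + v N)"
  unfolding strongly_conv_def
proof (intro conjI allI ballI)
  note mem = scD(1)[OF u] scD(1)[OF v]
  show "u N + v N \<in> H N" for N using mem by simp
  show "(\<lambda>n. ip n (u n + v n) (\<Psi> n \<phi>)) \<longlonglongrightarrow> ip \<infinity> (u \<infinity> + v \<infinity>) \<phi>"
    if "\<phi> \<in> C" for \<phi>
    using tendsto_add[OF scD(3)[OF u that] scD(3)[OF v that]] mem that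
    by (simp add: Hil.add_left C_mem)
  have "(\<lambda>n. ip n (u n) (u n) + 2 * ip n (u n) (v n)
      + ip n (v n) (v n))
    \<longlonglongrightarrow> ip \<infinity> (u \<infinity>) (u \<infinity>) + 2 * ip \<infinity> (u \<infinity>) (v \<infinity>) + ip \<infinity> (v \<infinity>) (v \<infinity>)"
    by (intro tendsto_intros sc_sq sc_inner u v)
  then have "(\<lambda>n. ip n (u n + v n) (u n + v n))
      \<longlonglongrightarrow> ip \<infinity> (u \<infinity> + v \<infinity>) (u \<infinity> + v \<infinity>)"
    using mem by (simp add: Hil.sq_add)
  then show "(\<lambda>n. nrm n (u n + v n)) \<longlonglongrightarrow> nrm \<infinity> (u \<infinity> + v \<infinity>)"
    unfolding ip_norm_def by (rule tendsto_real_sqrt)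
qed

lemma sc_scale:
  assumes u: "sc u"
  shows "sc (\<lambda>N. c *\<^sub>R u N)"
  unfolding strongly_conv_def
proof (intro conjI allI ballI)
  note mem = scD(1)[OF u]
  show "c *\<^sub>R u N \<in> H N" for N using mem by simp
  show "(\<lambda>n. ip n (c *\<^sub>R u n) (\<Psi> n \<phi>)) \<longlonglongrightarrow> ip \<infinity> (c *\<^sub>R u \<infinity>) \<phi>"
    if "\<phi> \<in> C" for \<phi>
    using tendsto_mult_left[OF scD(3)[OF u that], of c] mem that by (simp add: Hil.scale_left C_mem)
  show "(\<lambda>n. nrm n (c *\<^sub>R u n)) \<longlonglongrightarrow> nrm \<infinity> (c *\<^sub>R u \<infinity>)"
    using tendsto_mult_left[OF scD(2)[OF u], of "\<bar>c\<bar>"] mem by (simp add: Hil.nrm_scale)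
qed

lemma sc_diff: "\<lbrakk>sc u; sc v\<rbrakk> \<Longrightarrow> sc (\<lambda>N. u N - v N)"
  using sc_add[OF _ sc_scale[of v "-1"], of u] by simp

lemma sc_null:
  fixes x :: "nat \<Rightarrow> 'a"
  assumes v: "sc v" and mem: "\<And>n. x n \<in> H n"
    and lim: "(\<lambda>n. nrm n (x n - v n)) \<longlonglongrightarrow> 0"
  shows "sc (section_of x (v \<infinity>))"
proof (rule sc_closed)
  show "section_of x (v \<infinity>) N \<in> H N" for N
    using mem scD(1)[OF v, of \<infinity>] by (cases N) simp_all
  fix \<epsilon> :: real assume "0 < \<epsilon>"
  from order_tendstoD(2)[OF lim this]
  have "\<forall>\<^sub>F n in sequentially. nrm n (section_of x (v \<infinity>) n - v n) \<le> \<epsilon>"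
    by eventually_elim simp
  then show "\<exists>w. sc w \<and> nrm \<infinity> (section_of x (v \<infinity>) \<infinity> - w \<infinity>) \<le> \<epsilon> \<and>
      (\<forall>\<^sub>F n in sequentially. nrm n (section_of x (v \<infinity>) n - w n) \<le> \<epsilon>)"
    using v \<open>0 < \<epsilon>\<close> by (intro exI[of _ v]) simp
qed

text \<open>If \<open>\<phi> k\<close> in \<open>C\<close> tends to \<open>u\<close>, then
  \<open>\<Psi> n (\<phi> (\<kappa> n))\<close> is such a section, provided that
  \<open>\<kappa>\<close> grows slowly.\<close>

lemma section_exists:
  assumes u: "u \<in> H \<infinity>"
  obtains v where "sc v" "v \<infinity> = u"
proof -
  have "\<exists>\<phi>\<in>C. nrm \<infinity> (u - \<phi>) < 1 / real (Suc k)" for k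
    using C_dense[OF u] by simp
  then obtain \<phi> where \<phi>: "\<And>k. \<phi> k \<in> C" "\<And>k. nrm \<infinity> (u - \<phi> k) < 1 / real (Suc k)" by metis
  let ?d = "\<lambda>n i k. nrm n (\<Psi> n (\<phi> i) - \<Psi> n (\<phi> k))"
  \<comment> \<open>All earlier indices are controlled at once, so that for each fixed
    \<open>i\<close> the diagonal section is near \<open>\<Psi> n (\<phi> i)\<close> for large
    \<open>n\<close> with \<open>i \<le> \<kappa> n\<close>.\<close>
  have "\<forall>\<^sub>F n in sequentially. \<forall>i\<in>{..k}. ?d n i k < nrm \<infinity> (\<phi> i - \<phi> k) + 1 / real (Suc k)" for k
  proof (rule eventually_ball_finite)
    show "\<forall>i\<in>{..k}. \<forall>\<^sub>F n in sequentially. ?d n i k < nrm \<infinity> (\<phi> i - \<phi> k) + 1 / real (Suc k)"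
    proof
      fix i
      show "\<forall>\<^sub>F n in sequentially. ?d n i k < nrm \<infinity> (\<phi> i - \<phi> k) + 1 / real (Suc k)"
        using sc_diff_Psi[OF Psi_sc[OF \<phi>(1)[of i]] \<phi>(1)[of k]] \<phi>(1)
        by (intro order_tendstoD(2)) auto
    qed
  qed simp
  then obtain \<kappa> where \<kappa>: "filterlim \<kappa> at_top sequentially"
    "\<forall>\<^sub>F n in sequentially. \<forall>i\<in>{..\<kappa> n}. ?d n i (\<kappa> n) < nrm \<infinity> (\<phi> i - \<phi> (\<kappa> n)) + 1 / real (Suc (\<kappa> n))"
    by (rule diagonal_choice)
  have "sc (section_of (\<lambda>n. \<Psi> n (\<phi> (\<kappa> n))) u)" (is "sc ?v")
  proof (rule sc_closed)
    show "?v N \<in> H N" for N using \<phi> u by (cases N) simp_all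
    fix \<epsilon> :: real assume "0 < \<epsilon>"
    obtain i :: nat where i: "4 / \<epsilon> < real i" using reals_Archimedean2 by blast
    have small: "1 / real (Suc k) < \<epsilon> / 4" if "i \<le> k" for k
    proof -
      have "4 / \<epsilon> < real (Suc k)" using i that by linarith
      then show ?thesis using \<open>0 < \<epsilon>\<close> by (simp add: field_simps)
    qed
    have "\<forall>\<^sub>F n in sequentially. i \<le> \<kappa> n"
      using \<kappa>(1) by (simp add: filterlim_at_top)
    with \<kappa>(2) have "\<forall>\<^sub>F n in sequentially. nrm n (?v n - \<Psi> n (\<phi> i)) \<le> \<epsilon>"
    proof eventually_elim
      case (elim n)
      have "nrm \<infinity> (\<phi> i - \<phi> (\<kappa> n)) \<le> nrm \<infinity> (\<phi> i - u) + nrm \<infinity> (u - \<phi> (\<kappa> n))"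
        using \<phi>(1) u by (intro Hil.nrm_triangle3) (auto intro: C_mem)
      moreover have "nrm \<infinity> (\<phi> i - u) = nrm \<infinity> (u - \<phi> i)"
        using \<phi>(1) u by (intro Hil.nrm_commute) (auto intro: C_mem)
      moreover have "?d n i (\<kappa> n) < nrm \<infinity> (\<phi> i - \<phi> (\<kappa> n)) + 1 / real (Suc (\<kappa> n))"
        using elim by simp
      moreover have "nrm n (?v n - \<Psi> n (\<phi> i)) = ?d n i (\<kappa> n)"
        using \<phi>(1) by (simp add: Hil.nrm_commute)
      ultimately show ?case
        using \<phi>(2)[of i] \<phi>(2)[of "\<kappa> n"] small[OF order_refl] small[OF elim(2)] \<open>0 < \<epsilon>\<close> by argo
    qed
    moreover have "nrm \<infinity> (u - \<phi> i) \<le> \<epsilon>" using \<phi>(2)[of i] small[OF order_refl] \<open>0 < \<epsilon>\<close> by argo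
    ultimately show "\<exists>w. sc w \<and> nrm \<infinity> (?v \<infinity> - w \<infinity>) \<le> \<epsilon> \<and>
        (\<forall>\<^sub>F n in sequentially. nrm n (?v n - w n) \<le> \<epsilon>)"
      using Psi_sc[OF \<phi>(1)[of i]] \<phi>(1)[of i] by (intro exI[of _ "\<lambda>N. \<Psi> N (\<phi> i)"]) simp
  qed
  then show thesis using that by fastforce
qed

lemma subindex_converging:
  assumes "strict_mono r"
  shows "converging (H \<circ> subindex r) (ip \<circ> subindex r) C (\<Psi> \<circ> subindex r)"
proof
  have "(\<lambda>n. ip (r n) (\<Psi> (r n) \<phi>) (\<Psi> (r n) \<phi>)) \<longlonglongrightarrow> ip \<infinity> \<phi> \<phi>" if "\<phi> \<in> C" for \<phi>
    using LIMSEQ_subseq_LIMSEQ[OF Psi_sq[OF that] assms] by (simp add: o_def)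
  then show "converging_hilbert_spaces (H \<circ> subindex r) (ip \<circ> subindex r) C (\<Psi> \<circ> subindex r)"
    using conv by (simp add: converging_hilbert_spaces_def)
qed

lemma subindex_sc:
  assumes "strict_mono r" "sc v"
  shows "strongly_conv (H \<circ> subindex r) (ip \<circ> subindex r) C (\<Psi> \<circ> subindex r) (v \<circ> subindex r)"
  using assms(2) LIMSEQ_subseq_LIMSEQ[OF scD(2)[OF assms(2)] assms(1)]
    LIMSEQ_subseq_LIMSEQ[OF scD(3)[OF assms(2)] assms(1)]
  by (simp add: strongly_conv_def o_def)

text \<open>The gaps of the subsequence are filled by a strongly convergent section with the same
  limit, so that statements about full sections apply to subsections.\<close>

lemma wc_fill:
  assumes w: "subseq_weakly_conv H ip C \<Psi> r x u" and v: "sc v" "v \<infinity> = u"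
    and mem: "\<And>n. x n \<in> H n"
  shows "wc (section_of (\<lambda>n. if n \<in> range r then x n else v n) u)"
  unfolding weakly_conv_def
proof (intro conjI allI impI)
  show "section_of (\<lambda>n. if n \<in> range r then x n else v n) u N \<in> H N" for N
    using mem scD(1)[OF v(1)] v(2) by (cases N) auto
  fix y assume y: "sc y"
  have r: "strict_mono r" using w by (simp add: subseq_weakly_conv_def)
  have 1: "(\<lambda>k. ip (r k) (x (r k)) (y (r k))) \<longlonglongrightarrow> ip \<infinity> u (y \<infinity>)"
    using w subindex_sc[OF r y] unfolding subseq_weakly_conv_def weakly_conv_def
    by (auto simp: o_def dest!: spec[of _ "y \<circ> subindex r"])
  have 2: "(\<lambda>n. ip n (v n) (y n)) \<longlonglongrightarrow> ip \<infinity> u (y \<infinity>)"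
    using sc_inner[OF v(1) y] v(2) by simp
  have "(\<lambda>n. ip n (if n \<in> range r then x n else v n) (y n))
      \<longlonglongrightarrow> ip \<infinity> u (y \<infinity>)"
    by (rule tendsto_fill[OF r _ 2]) (use 1 in \<open>simp_all add: o_def\<close>)
  then show "(\<lambda>n. ip n (section_of (\<lambda>n. if n \<in> range r then x n else v n) u n)
        (y n)) \<longlonglongrightarrow> ip \<infinity> (section_of (\<lambda>n. if n \<in> range r then x n else v n) u \<infinity>) (y \<infinity>)"
    by simp
qed

subsection \<open>Weak compactness\<close>

text \<open>Separability gives a countable dense set in \<open>H \<infinity>\<close>, but the maps
  \<open>\<Psi> n\<close> live on \<open>C\<close>; each of its points is therefore replaced by
  points of \<open>C\<close> tending to it.\<close>

lemma countable_dense: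
  obtains \<phi> :: "nat \<Rightarrow> 'a" where "range \<phi> \<subseteq> C" "\<And>u \<epsilon>. \<lbrakk>u \<in> H \<infinity>; 0 < \<epsilon>\<rbrakk> \<Longrightarrow> \<exists>j. nrm \<infinity> (u - \<phi> j) < \<epsilon>"
proof -
  have "separable_space (ip_topology (H \<infinity>) (ip \<infinity>))"
    using conv by (simp add: converging_hilbert_spaces_def separable_hilbert_space_def)
  then obtain U where U: "countable U" "U \<subseteq> H \<infinity>" "ip_topology (H \<infinity>) (ip \<infinity>) closure_of U = H \<infinity>"
    by (auto simp: separable_space_def)
  have U_dense: "\<exists>d\<in>U. nrm \<infinity> (u - d) < \<epsilon>" if "u \<in> H \<infinity>" "0 < \<epsilon>" for u \<epsilon>
    using U Hil.closure_iff[of U \<infinity>] that by auto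
  have "U \<noteq> {}" using U_dense[of 0 1] by auto
  define pick where "pick d m = (SOME \<phi>. \<phi> \<in> C \<and> nrm \<infinity> (d - \<phi>) < 1 / real (Suc m))" for d m
  have pick: "pick d m \<in> C" "nrm \<infinity> (d - pick d m) < 1 / real (Suc m)" if "d \<in> U" for d m
  proof -
    have "\<exists>\<phi>. \<phi> \<in> C \<and> nrm \<infinity> (d - \<phi>) < 1 / real (Suc m)"
      using C_dense[of d "1 / real (Suc m)"] U(2) that by auto
    from someI_ex[OF this] show "pick d m \<in> C" "nrm \<infinity> (d - pick d m) < 1 / real (Suc m)"
      unfolding pick_def by auto
  qed
  define Q where "Q = (\<lambda>(d, m). pick d m) ` (U \<times> UNIV)"
  have "countable Q" "Q \<noteq> {}" using U \<open>U \<noteq> {}\<close> by (auto simp: Q_def)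
  define \<phi> where "\<phi> = from_nat_into Q"
  have range: "range \<phi> = Q" using \<open>countable Q\<close> \<open>Q \<noteq> {}\<close> by (simp add: \<phi>_def)
  show thesis
  proof (rule that)
    show "range \<phi> \<subseteq> C" using pick by (auto simp: range Q_def)
    fix u and \<epsilon> :: real assume u: "u \<in> H \<infinity>" and "0 < \<epsilon>"
    then obtain d where d: "d \<in> U" "nrm \<infinity> (u - d) < \<epsilon> / 2" using U_dense[of u "\<epsilon> / 2"] by auto
    obtain m :: nat where m: "2 / \<epsilon> < real m" using reals_Archimedean2 by blast
    have "1 / real (Suc m) < \<epsilon> / 2"
    proof -
      have "2 / \<epsilon> < real (Suc m)" using m by linarith
      then show ?thesis using \<open>0 < \<epsilon>\<close> by (simp add: field_simps)
    qed
    moreover have "nrm \<infinity> (u - pick d m) \<le> nrm \<infinity> (u - d) + nrm \<infinity> (d - pick d m)"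
      using u d U pick[OF d(1)] by (intro Hil.nrm_triangle3) (auto intro: C_mem)
    ultimately have "nrm \<infinity> (u - pick d m) < \<epsilon>" using d pick(2)[OF d(1), of m] by argo
    moreover have "pick d m \<in> range \<phi>" using d by (auto simp: range Q_def)
    ultimately show "\<exists>j. nrm \<infinity> (u - \<phi> j) < \<epsilon>" by auto
  qed
qed

text \<open>Boundedness extends convergence of the pairings from the dense family to all strongly
  convergent sections. The limit is a bounded linear functional of the limit vector, and its Riesz
  representative is the weak limit.\<close>

lemma bounded_weakly_conv:
  fixes x :: "nat \<Rightarrow> 'a"
  assumes x: "\<And>n. x n \<in> H n" "\<And>n. nrm n (x n) \<le> K"
    and \<phi>: "range \<phi> \<subseteq> C" "\<And>u \<epsilon>. \<lbrakk>u \<in> H \<infinity>; 0 < \<epsilon>\<rbrakk> \<Longrightarrow> \<exists>j. nrm \<infinity> (u - \<phi> j) < \<epsilon>"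
    and lim: "\<And>j. convergent (\<lambda>n. ip n (x n) (\<Psi> n (\<phi> j)))"
  obtains u where "wc (section_of x u)"
proof -
  have "0 \<le> nrm (enat 0) (x 0)" using x by simp
  then have K: "0 \<le> K" using x(2)[of 0] by linarith
  have \<phi>C: "\<phi> j \<in> C" for j using \<phi> by auto
  have bound: "\<bar>ip n (x n) y\<bar> \<le> K * nrm n y" if "y \<in> H n" for n y
  proof -
    have "\<bar>ip n (x n) y\<bar> \<le> nrm n (x n) * nrm n y"
      using x that by (intro Hil.cauchy_schwarz)
    also have "\<dots> \<le> K * nrm n y" using x that by (intro mult_right_mono) auto
    finally show ?thesis .
  qed
  have conv: "convergent (\<lambda>n. ip n (x n) (v n))" if v: "sc v" for v
  proof (rule Cauchy_convergent, rule CauchyI)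
    fix \<epsilon> :: real assume "0 < \<epsilon>"
    define \<delta> where "\<delta> = \<epsilon> / 4 / (K + 1)"
    have \<delta>: "0 < \<delta>" using \<open>0 < \<epsilon>\<close> K by (simp add: \<delta>_def)
    have K\<delta>: "K * \<delta> \<le> \<epsilon> / 4"
    proof -
      have "K * \<delta> \<le> (K + 1) * \<delta>" using \<delta> by (intro mult_right_mono) auto
      also have "\<dots> = \<epsilon> / 4"
      proof -
        have "K + 1 \<noteq> 0" using K by simp
        then show ?thesis unfolding \<delta>_def by (metis mult.commute nonzero_eq_divide_eq)
      qed
      finally show ?thesis .
    qed
    obtain j where j: "nrm \<infinity> (v \<infinity> - \<phi> j) < \<delta>" using \<phi>(2)[OF scD(1)[OF v, of \<infinity>] \<delta>] by blast
    from order_tendstoD(2)[OF sc_diff_Psi[OF v \<phi>C] j]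
    obtain M :: nat where M: "\<And>n. M \<le> n \<Longrightarrow> nrm n (v n - \<Psi> n (\<phi> j)) < \<delta>"
      by (auto simp: eventually_sequentially)
    have near: "\<bar>ip n (x n) (v n) - ip n (x n) (\<Psi> n (\<phi> j))\<bar> \<le> \<epsilon> / 4"
      if "M \<le> n" for n
    proof -
      have "ip n (x n) (v n) - ip n (x n) (\<Psi> n (\<phi> j)) =
          ip n (x n) (v n - \<Psi> n (\<phi> j))"
        using x scD(1)[OF v] \<phi>C by (simp add: Hil.diff_right)
      also have "\<bar>\<dots>\<bar> \<le> K * nrm n (v n - \<Psi> n (\<phi> j))"
        using scD(1)[OF v] \<phi>C by (intro bound) auto
      also have "\<dots> \<le> K * \<delta>" using M[OF that] K by (intro mult_left_mono) auto
      finally show ?thesis using K\<delta> by linarith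
    qed
    have "0 < \<epsilon> / 4" using \<open>0 < \<epsilon>\<close> by simp
    then obtain N where N: "\<And>m n::nat. \<lbrakk>N \<le> m; N \<le> n\<rbrakk> \<Longrightarrow>
        \<bar>ip m (x m) (\<Psi> m (\<phi> j)) - ip n (x n) (\<Psi> n (\<phi> j))\<bar> < \<epsilon> / 4"
      using CauchyD[OF convergent_Cauchy[OF lim[of j]]] unfolding real_norm_def by blast
    have "norm (ip m (x m) (v m) - ip n (x n) (v n)) < \<epsilon>"
      if "max M N \<le> m" "max M N \<le> n" for m n
      using near[of m] near[of n] N[of m n] that \<open>0 < \<epsilon>\<close> unfolding real_norm_def max.bounded_iff by argo
    then show "\<exists>M. \<forall>m\<ge>M. \<forall>n\<ge>M. norm (ip m (x m) (v m) - ip n (x n) (v n)) < \<epsilon>"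
      by blast
  qed
  have "\<exists>v. sc v \<and> v \<infinity> = u" if "u \<in> H \<infinity>" for u using section_exists[OF that] by metis
  then obtain s where s: "\<And>u. u \<in> H \<infinity> \<Longrightarrow> sc (s u)" "\<And>u. u \<in> H \<infinity> \<Longrightarrow> s u \<infinity> = u" by metis
  define l where "l u = lim (\<lambda>n. ip n (x n) (s u n))" for u
  \<comment> \<open>Two strongly convergent sections with the same limit differ by a section whose
    norms tend to 0, so the functional \<open>l\<close> does not depend on the chosen section
    \<open>s\<close>.\<close>
  have l: "(\<lambda>n. ip n (x n) (v n)) \<longlonglongrightarrow> l (v \<infinity>)" if v: "sc v" for v
  proof -
    have vi: "v \<infinity> \<in> H \<infinity>" using scD(1)[OF v] .
    let ?s = "s (v \<infinity>)"
    have "(\<lambda>n. ip n (x n) (?s n)) \<longlonglongrightarrow> l (v \<infinity>)"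
      using conv[OF s(1)[OF vi]] by (simp add: l_def convergent_LIMSEQ_iff)
    moreover have "(\<lambda>n. ip n (x n) (v n - ?s n)) \<longlonglongrightarrow> 0"
    proof (rule Lim_null_comparison)
      show "\<forall>\<^sub>F n in sequentially. norm (ip n (x n) (v n - ?s n))
          \<le> K * nrm n (v n - ?s n)"
        using bound scD(1)[OF v] scD(1)[OF s(1)[OF vi]] by simp
      show "(\<lambda>n. K * nrm n (v n - ?s n)) \<longlonglongrightarrow> 0"
        using tendsto_mult_left[OF scD(2)[OF sc_diff[OF v s(1)[OF vi]]], of K] s(2)[OF vi] by simp
    qed
    ultimately have "(\<lambda>n. ip n (x n) (?s n) + ip n (x n) (v n - ?s n))
        \<longlonglongrightarrow> l (v \<infinity>) + 0" by (rule tendsto_add)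
    then show ?thesis
      using x scD(1)[OF v] scD(1)[OF s(1)[OF vi]] by (simp add: Hil.diff_right)
  qed
  have l_add: "l (y + z) = l y + l z" if yz: "y \<in> H \<infinity>" "z \<in> H \<infinity>" for y z
  proof -
    have "(\<lambda>n. ip n (x n) (s y n + s z n)) \<longlonglongrightarrow> l (y + z)"
      using l[OF sc_add[OF s(1)[OF yz(1)] s(1)[OF yz(2)]]] s(2) yz by simp
    moreover have "(\<lambda>n. ip n (x n) (s y n + s z n)) \<longlonglongrightarrow> l y + l z"
      using tendsto_add[OF l[OF s(1)[OF yz(1)]] l[OF s(1)[OF yz(2)]]] s(2) yz x
        scD(1)[OF s(1)[OF yz(1)]] scD(1)[OF s(1)[OF yz(2)]] by (simp add: Hil.add_right)
    ultimately show ?thesis by (rule LIMSEQ_unique)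
  qed
  have l_scale: "l (c *\<^sub>R y) = c * l y" if y: "y \<in> H \<infinity>" for c y
  proof -
    have "(\<lambda>n. ip n (x n) (c *\<^sub>R s y n)) \<longlonglongrightarrow> l (c *\<^sub>R y)"
      using l[OF sc_scale[OF s(1)[OF y], of c]] s(2) y by simp
    moreover have "(\<lambda>n. ip n (x n) (c *\<^sub>R s y n)) \<longlonglongrightarrow> c * l y"
      using tendsto_mult_left[OF l[OF s(1)[OF y]], of c] s(2) y x
        scD(1)[OF s(1)[OF y]] by (simp add: Hil.scale_right)
    ultimately show ?thesis by (rule LIMSEQ_unique)
  qed
  have l_bound: "\<bar>l y\<bar> \<le> K * nrm \<infinity> y" if y: "y \<in> H \<infinity>" for y
  proof -
    have "(\<lambda>n. \<bar>ip n (x n) (s y n)\<bar>) \<longlonglongrightarrow> \<bar>l y\<bar>"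
      using tendsto_rabs[OF l[OF s(1)[OF y]]] s(2) y by simp
    moreover have "(\<lambda>n. K * nrm n (s y n)) \<longlonglongrightarrow> K * nrm \<infinity> y"
      using tendsto_mult_left[OF scD(2)[OF s(1)[OF y]], of K] s(2) y by simp
    ultimately show "\<bar>l y\<bar> \<le> K * nrm \<infinity> y"
      using bound scD(1)[OF s(1)[OF y]] by (intro LIMSEQ_le) auto
  qed
  obtain u where u: "u \<in> H \<infinity>" "\<And>y. y \<in> H \<infinity> \<Longrightarrow> l y = ip \<infinity> u y"
  proof (rule Hil.riesz[where N = \<infinity> and l = l and K = K])
    fix u assume "u \<in> H \<infinity>" "\<And>x. x \<in> H \<infinity> \<Longrightarrow> l x = ip \<infinity> u x"
    then show thesis by (rule that)
  qed (simp_all add: l_add l_scale l_bound)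
  have "wc (section_of x u)"
    unfolding weakly_conv_def
  proof (intro conjI allI impI)
    show "section_of x u N \<in> H N" for N using x u by (cases N) auto
    fix v assume v: "sc v"
    then show "(\<lambda>n. ip n (section_of x u n) (v n))
        \<longlonglongrightarrow> ip \<infinity> (section_of x u \<infinity>) (v \<infinity>)"
      using l[OF v] u(2)[OF scD(1)[OF v]] by simp
  qed
  then show thesis by (rule that)
qed

lemma weakly_conv_subsequence:
  fixes x :: "nat \<Rightarrow> 'a"
  assumes x: "\<And>n. x n \<in> H n" "\<And>n. nrm n (x n) \<le> K"
  obtains r u where "subseq_weakly_conv H ip C \<Psi> r x u"
proof -
  obtain \<phi> :: "nat \<Rightarrow> 'a" where \<phi>: "range \<phi> \<subseteq> C"
    "\<And>u \<epsilon>. \<lbrakk>u \<in> H \<infinity>; 0 < \<epsilon>\<rbrakk> \<Longrightarrow> \<exists>j. nrm \<infinity> (u - \<phi> j) < \<epsilon>" using countable_dense by metis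
  have \<phi>C: "\<phi> j \<in> C" for j using \<phi> by auto
  define a where "a j n = ip n (x n) (\<Psi> n (\<phi> j))" for j n :: nat
  have bdd: "\<exists>B. \<forall>n. \<bar>a j n\<bar> \<le> B" for j
  proof -
    have "Bseq (\<lambda>n. nrm n (\<Psi> n (\<phi> j)))"
      using scD(2)[OF Psi_sc[OF \<phi>C]] by (intro convergent_imp_Bseq convergentI)
    then obtain B where B: "\<And>n::nat. norm (nrm n (\<Psi> n (\<phi> j))) \<le> B"
      by (auto simp: Bseq_def)
    have "\<bar>a j n\<bar> \<le> K * B" for n
    proof -
      have "\<bar>a j n\<bar> \<le> nrm n (x n) * nrm n (\<Psi> n (\<phi> j))"
        unfolding a_def using x \<phi>C by (intro Hil.cauchy_schwarz) auto
      also have "\<dots> \<le> K * B"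
        using x B[of n] \<phi>C Hil.nrm_nonneg[OF x(1)[of n]] order_trans[OF Hil.nrm_nonneg[OF x(1)[of n]] x(2)[of n]]
        by (intro mult_mono) auto
      finally show ?thesis .
    qed
    then show ?thesis by blast
  qed
  interpret d: subseqs "\<lambda>j s. convergent (a j \<circ> s)"
  proof
    fix j and s :: "nat \<Rightarrow> nat" assume "strict_mono s"
    obtain B where B: "\<And>n. \<bar>a j n\<bar> \<le> B" using bdd by blast
    have "\<And>n. (a j \<circ> s) n \<in> {- B..B}" using B by (auto simp: abs_le_iff minus_le_iff)
    then obtain l r' where "strict_mono (r' :: nat \<Rightarrow> nat)" "((a j \<circ> s) \<circ> r') \<longlonglongrightarrow> l"
      using compact_Icc[of "- B" B, THEN compact_imp_seq_compact] by (metis seq_compactE)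
    then show "\<exists>r'. strict_mono r' \<and> convergent (a j \<circ> (s \<circ> r'))"
      by (auto simp: convergent_def o_assoc)
  qed
  define r where "r = d.diagseq"
  have r: "strict_mono r" unfolding r_def by (rule d.subseq_diagseq)
  have conv: "convergent (a j \<circ> r)" for j
  proof -
    \<comment> \<open>The diagonal sequence is controlled by the \<open>j\<close>-th stage only
      after its first \<open>j + 1\<close> terms; the shift is undone below.\<close>
    have "convergent (a j \<circ> (r \<circ> (+) (Suc j)))"
      unfolding r_def
      by (rule d.diagseq_holds) (auto simp: o_assoc intro: convergent_subseq_convergent)
    then obtain l where "(\<lambda>n. (a j \<circ> r) (n + Suc j)) \<longlonglongrightarrow> l"
      by (auto simp: convergent_def o_def add.commute)
    then have "(a j \<circ> r) \<longlonglongrightarrow> l" by (rule LIMSEQ_offset)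
    then show ?thesis by (rule convergentI)
  qed
  \<comment> \<open>Pairings converge along \<open>r\<close> only, so the weak limit is constructed
    inside the subfamily.\<close>
  interpret sub: converging "H \<circ> subindex r" "ip \<circ> subindex r" C "\<Psi> \<circ> subindex r"
    by (rule subindex_converging[OF r])
  obtain u where "sub.wc (section_of (x \<circ> r) u)"
    by (rule sub.bounded_weakly_conv[of "x \<circ> r" K \<phi>])
      (use x \<phi> conv in \<open>auto simp: a_def o_def\<close>)
  then show thesis using r by (intro that[of r u]) (simp add: subseq_weakly_conv_def)
qed

end

section \<open>Energies and resolvents\<close>

context resolvent_on
begin

lemma form_semi_inner: "semi_inner_on (form_dom S b G) (Defs.form S b G)"
  unfolding form_dom_eq form_eq by (rule form.E.semi_inner_on_axioms)

lemma form_dom_mem: "u \<in> form_dom S b G \<Longrightarrow> u \<in> S"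
  by (simp add: form_dom_eq)

lemma G_form_dom: "\<lbrakk>0 < \<alpha>; u \<in> S\<rbrakk> \<Longrightarrow> G \<alpha> u \<in> form_dom S b G"
  by (simp add: form_dom_eq)

lemma form_GG:
  assumes "0 < \<alpha>" "u \<in> S"
  shows "Defs.form S b G (G \<alpha> u) (G \<alpha> u) = b u (G \<alpha> u) - \<alpha> * b (G \<alpha> u) (G \<alpha> u)"
  using form_G[OF assms G_dom[OF assms]] by (simp add: form_eq)

lemma form_shift_GG: "\<lbrakk>0 < \<alpha>; u \<in> S\<rbrakk> \<Longrightarrow> form_shift S b G \<alpha> (G \<alpha> u) (G \<alpha> u) = b u (G \<alpha> u)"
  by (simp add: form_shift_def form_GG)

text \<open>The energy of \<open>G \<alpha> u - x\<close> is dropped from the quadratic identity.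
  The right side is 0 at \<open>x = G \<alpha> u\<close>, so it tends to 0 along a recovery sequence
  as soon as \<open>b u (G \<alpha> u)\<close> has the right limit.\<close>

lemma resolvent_gap:
  assumes "0 < \<alpha>" "u \<in> S" "x \<in> form_dom S b G"
  shows "\<alpha> * (nrm (G \<alpha> u - x))\<^sup>2 \<le> b u (G \<alpha> u) - 2 * b u x + (Defs.form S b G x x + \<alpha> * b x x)"
proof -
  let ?g = "G \<alpha> u"
  have g: "?g \<in> form.dom" "?g \<in> S" and x: "x \<in> form.dom" "x \<in> S"
    using assms by (simp_all add: form_dom_eq)
  have "0 \<le> form.E (?g - x) (?g - x)" using g x by (intro form.E.nonneg) auto
  also have "\<dots> = form.E ?g ?g - 2 * form.E ?g x + form.E x x"
    using g x by (simp add: form.E.sq_diff)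
  also have "\<dots> = (b u ?g - \<alpha> * b ?g ?g) - 2 * (b u x - \<alpha> * b ?g x) + form.E x x"
    using g x assms by (simp add: form_G)
  finally have "\<alpha> * b ?g ?g - 2 * (\<alpha> * b ?g x) \<le> b u ?g - 2 * b u x + form.E x x" by argo
  moreover have "\<alpha> * (nrm (?g - x))\<^sup>2 = (\<alpha> * b ?g ?g - 2 * (\<alpha> * b ?g x)) + \<alpha> * b x x"
    using g x by (simp add: nrm_sq sq_diff algebra_simps)
  ultimately show ?thesis by (simp add: form_eq)
qed

lemma yosida_le_energy:
  assumes "0 < \<beta>" "u \<in> S" "v \<in> S"
  shows "ereal (2 * yosida \<beta> v u - yosida \<beta> v v) \<le> energy S b G u"
proof (cases "u \<in> form_dom S b G")
  case True
  then have "yosida \<beta> u u \<le> Defs.form S b G u u"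
    using yosida_le_form[OF assms(1), of u] by (simp add: form_dom_eq form_eq)
  then show ?thesis using True yosida_sq_diff[OF assms] by (simp add: energy_def)
qed (simp add: energy_def)

text \<open>The energy is governed by the Yosida forms also outside the form domain: a finite bound
  on them puts \<open>u\<close> into the domain.\<close>

lemma energy_le_yosida:
  assumes "u \<in> S" "\<And>\<beta>. 0 < \<beta> \<Longrightarrow> ereal (yosida \<beta> u u) \<le> L"
  shows "energy S b G u \<le> L"
proof (cases L)
  case (real c)
  then have c: "yosida \<beta> u u \<le> c" if "0 < \<beta>" for \<beta> using assms(2)[OF that] by simp
  have "u \<in> form.dom" "form.E u u \<le> c"
    using yosida_bounded[OF assms(1) c] by blast+
  then show ?thesis using real by (simp add: energy_def form_dom_eq form_eq)
next
  case MInf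
  then show ?thesis using assms(2)[of 1] by simp
qed simp

text \<open>The domain of the generator is a form core; this reduces the construction of recovery
  sequences to vectors \<open>G 1 z\<close>.\<close>

lemma form_approx_gen_dom:
  assumes "u \<in> form_dom S b G"
  shows "\<exists>w. (\<forall>n. w n \<in> gen_dom S G) \<and> (\<lambda>n. nrm (w n - u)) \<longlonglongrightarrow> 0 \<and>
    (\<lambda>n. Defs.form S b G (w n) (w n)) \<longlonglongrightarrow> Defs.form S b G u u"
proof -
  obtain w where w: "form.approx w u" using assms by (auto simp: form_dom_eq elim: form.domE)
  note wD = form.approxD(1-4)[OF w]
  have "(\<lambda>n. form.E (w n) (w n)) \<longlonglongrightarrow> form.E u u"
    using form.form_lim[OF w w] wD by (simp add: form.form_D)
  then show ?thesis using wD by (intro exI[of _ w]) (simp add: form_eq)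
qed

lemma G_bounded_operator: "0 < \<alpha> \<Longrightarrow> bounded_operator S b (G \<alpha>)"
proof -
  assume \<alpha>: "0 < \<alpha>"
  have "nrm (G \<alpha> u) \<le> 1 / \<alpha> * nrm u" if "u \<in> S" for u
    using G_contraction[OF \<alpha> that] \<alpha> by (simp add: field_simps)
  then show ?thesis
    using \<alpha> unfolding bounded_operator_def linear_between_def
    by (auto simp: G_add G_scale intro!: exI[of _ "1 / \<alpha>"])
qed

lemma Phi_bounded_operator: "f \<in> C0_halfline \<Longrightarrow> bounded_operator S b (Phi f)"
  using Phi_linear Phi_bound unfolding bounded_operator_def by blast

lemma Phi_zero: "u \<in> S \<Longrightarrow> Phi (\<lambda>x. 0) u = 0"
  using Phi_cmult[of "\<lambda>x. 1 / (1 + x)" u 0] C0_halfline_resolvent[of 1] by simp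

lemma Phi_poly_pCons:
  assumes "\<theta> \<in> C0_halfline" "(\<lambda>x. \<theta> x * poly q (\<theta> x)) \<in> C0_halfline" "u \<in> S"
  shows "(\<lambda>x. \<theta> x * poly (pCons a q) (\<theta> x)) \<in> C0_halfline"
    and "Phi (\<lambda>x. \<theta> x * poly (pCons a q) (\<theta> x)) u =
      a *\<^sub>R Phi \<theta> u + Phi \<theta> (Phi (\<lambda>x. \<theta> x * poly q (\<theta> x)) u)"
proof -
  have eq: "(\<lambda>x. \<theta> x * poly (pCons a q) (\<theta> x)) = (\<lambda>x. a * \<theta> x + \<theta> x * (\<theta> x * poly q (\<theta> x)))"
    by (auto simp: algebra_simps)
  note 1 = C0_halfline_cmult[OF assms(1), of a] and 2 = C0_halfline_mult[OF assms(1,2)]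
  show "(\<lambda>x. \<theta> x * poly (pCons a q) (\<theta> x)) \<in> C0_halfline"
    unfolding eq by (rule C0_halfline_add[OF 1 2])
  show "Phi (\<lambda>x. \<theta> x * poly (pCons a q) (\<theta> x)) u =
      a *\<^sub>R Phi \<theta> u + Phi \<theta> (Phi (\<lambda>x. \<theta> x * poly q (\<theta> x)) u)"
    unfolding eq using assms by (simp only: Phi_add[OF 1 2] Phi_cmult Phi_mult)
qed

end

section \<open>Convergence of resolvents\<close>

lemma section_of_eta: "section_of (\<lambda>n. f n) (f \<infinity>) = f"
  by (rule ext) (simp add: section_of_def split: enat.split)

lemma subseq_weakly_conv_mem:
  assumes "subseq_weakly_conv H ip C \<Psi> r x u"
  shows "u \<in> H \<infinity>"
proof -
  have "section_of (x \<circ> r) u \<infinity> \<in> (H \<circ> subindex r) \<infinity>"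
    using assms unfolding subseq_weakly_conv_def weakly_conv_def by blast
  then show ?thesis by simp
qed

lemma subindex_compose: "subindex r \<circ> subindex s = subindex (r \<circ> s)"
  by (rule ext) (simp add: subindex_def section_of_def split: enat.split)

locale converging_resolvents = converging H ip C \<Psi>
  for H :: "enat \<Rightarrow> 'a::real_vector set" and ip C \<Psi> +
  fixes G :: "enat \<Rightarrow> real \<Rightarrow> 'a \<Rightarrow> 'a"
  assumes resolvents: "symmetric_resolvent (H N) (ip N) (G N)"
begin

sublocale R: resolvent_on "H N" "ip N" "G N" for N
  by unfold_locales (rule resolvents)

abbreviation fd :: "enat \<Rightarrow> 'a set" where "fd N \<equiv> form_dom (H N) (ip N) (G N)"
abbreviation E :: "enat \<Rightarrow> 'a \<Rightarrow> 'a \<Rightarrow> real" where "E N \<equiv> Defs.form (H N) (ip N) (G N)"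
abbreviation Ph :: "enat \<Rightarrow> (real \<Rightarrow> real) \<Rightarrow> 'a \<Rightarrow> 'a" where
  "Ph N \<equiv> resolvent_on.Phi (H N) (ip N) (G N)"

sublocale F: semi_inner_on "fd N" "E N" for N
  by (rule R.form_semi_inner)

definition conv_at :: "real \<Rightarrow> bool" where
  "conv_at \<alpha> \<longleftrightarrow> (\<forall>u. sc u \<longrightarrow> sc (\<lambda>N. G N \<alpha> (u N)))"

lemma resolvents_conv_iff: "resolvents_conv H ip C \<Psi> G \<longleftrightarrow> (\<forall>\<alpha>>0. conv_at \<alpha>)"
  using R.G_bounded_operator
  by (auto simp: resolvents_conv_def operators_strongly_conv_def conv_at_def)

subsection \<open>Functional calculus along sections\<close>

text \<open>Strong convergence is preserved by sums, multiples and composition of operators. The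
  leading factor \<open>\<theta> x\<close> excludes constants, which do not vanish at
  infinity.\<close>

lemma Phi_conv_poly:
  assumes \<theta>: "\<theta> \<in> C0_halfline" "\<And>u. sc u \<Longrightarrow> sc (\<lambda>N. Ph N \<theta> (u N))"
  shows "(\<lambda>x. \<theta> x * poly q (\<theta> x)) \<in> C0_halfline \<and>
    (\<forall>u. sc u \<longrightarrow> sc (\<lambda>N. Ph N (\<lambda>x. \<theta> x * poly q (\<theta> x)) (u N)))"
proof (induction q)
  case 0
  have "(\<lambda>x. 0) \<in> C0_halfline" by (simp add: C0_halfline_def)
  moreover have "sc (\<lambda>N. Ph N (\<lambda>x. 0) (u N))" if "sc u" for u
    using sc_scale[OF that, of 0] scD(1)[OF that] by (simp add: R.Phi_zero)
  ultimately show ?case by simp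
next
  case (pCons a q)
  let ?f = "\<lambda>x. \<theta> x * poly (pCons a q) (\<theta> x)" and ?g = "\<lambda>x. \<theta> x * poly q (\<theta> x)"
  have g: "?g \<in> C0_halfline" "\<And>u. sc u \<Longrightarrow> sc (\<lambda>N. Ph N ?g (u N))" using pCons by auto
  have "sc (\<lambda>N. Ph N ?f (u N))" if u: "sc u" for u
  proof -
    have "Ph N ?f (u N) = a *\<^sub>R Ph N \<theta> (u N) + Ph N \<theta> (Ph N ?g (u N))" for N
      by (rule R.Phi_poly_pCons(2)[OF \<theta>(1) g(1) scD(1)[OF u]])
    then show ?thesis
      using sc_add[OF sc_scale[OF \<theta>(2)[OF u], of a] \<theta>(2)[OF g(2)[OF u]]] by simp
  qed
  moreover have "?f \<in> C0_halfline" by (rule R.Phi_poly_pCons(1)[OF \<theta>(1) g(1) Hil.mem(1)])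
  ultimately show ?case by blast
qed

text \<open>The approximation error is a sup norm on the half-line, so the operators differ by at
  most \<open>\<epsilon> / K\<close> in every \<open>H N\<close> simultaneously, which is the
  uniformity that \<open>sc_closed\<close> asks for.\<close>

lemma Phi_conv:
  assumes \<theta>: "\<theta> \<in> C0_halfline" "\<And>u. sc u \<Longrightarrow> sc (\<lambda>N. Ph N \<theta> (u N))"
    and \<theta>\<eta>: "\<And>x. 0 \<le> x \<Longrightarrow> 0 < \<theta> x \<and> \<theta> x \<le> 1 \<and> \<eta> (\<theta> x) = x"
    and \<eta>: "continuous_on {0<..1} \<eta>" "\<And>s. \<lbrakk>0 < s; s \<le> 1\<rbrakk> \<Longrightarrow> 0 \<le> \<eta> s" "filterlim \<eta> at_top (at_right 0)"
    and f: "f \<in> C0_halfline" and u: "sc u"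
  shows "sc (\<lambda>N. Ph N f (u N))"
proof (rule sc_closed)
  show "Ph N f (u N) \<in> H N" for N using f scD(1)[OF u] by (rule R.Phi_mem)
  fix \<epsilon> :: real assume "0 < \<epsilon>"
  define K where "K = \<bar>nrm \<infinity> (u \<infinity>)\<bar> + 1"
  have K: "0 < K" by (simp add: K_def)
  have "0 < \<epsilon> / K" using \<open>0 < \<epsilon>\<close> K by simp
  then obtain q where q: "\<And>x. 0 \<le> x \<Longrightarrow> \<bar>f x - \<theta> x * poly q (\<theta> x)\<bar> \<le> \<epsilon> / K"
    using C0_halfline_approx[OF f _ \<eta> \<theta>\<eta>] by blast
  let ?g = "\<lambda>x. \<theta> x * poly q (\<theta> x)"
  have g: "?g \<in> C0_halfline" "sc (\<lambda>N. Ph N ?g (u N))" using Phi_conv_poly[OF \<theta>, of q] u by auto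
  have dist: "nrm N (Ph N f (u N) - Ph N ?g (u N)) \<le> \<epsilon>" if "nrm N (u N) \<le> K" for N
  proof -
    have "nrm N (Ph N f (u N) - Ph N ?g (u N)) \<le> \<epsilon> / K * nrm N (u N)"
      by (rule R.Phi_dist[OF f g(1) q scD(1)[OF u]])
    also have "\<dots> \<le> \<epsilon> / K * K" using that \<open>0 < \<epsilon> / K\<close> by (intro mult_left_mono) auto
    finally show ?thesis using K by simp
  qed
  have "\<forall>\<^sub>F n in sequentially. nrm n (u n) \<le> K"
    unfolding K_def by (rule eventually_nrm_le[OF scD(2)[OF u]])
  then have "\<forall>\<^sub>F n in sequentially.
      nrm n (Ph n f (u n) - Ph n ?g (u n)) \<le> \<epsilon>"
    by eventually_elim (rule dist)
  moreover have "nrm \<infinity> (Ph \<infinity> f (u \<infinity>) - Ph \<infinity> ?g (u \<infinity>)) \<le> \<epsilon>"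
    by (rule dist) (simp add: K_def)
  ultimately show "\<exists>v. sc v \<and> nrm \<infinity> (Ph \<infinity> f (u \<infinity>) - v \<infinity>) \<le> \<epsilon> \<and>
      (\<forall>\<^sub>F n in sequentially. nrm n (Ph n f (u n) - v n) \<le> \<epsilon>)"
    using g(2) by (intro exI[of _ "\<lambda>N. Ph N ?g (u N)"]) simp
qed

lemma Phi_conv_resolvent:
  assumes \<alpha>: "0 < \<alpha>" "conv_at \<alpha>" and f: "f \<in> C0_halfline" and u: "sc u"
  shows "sc (\<lambda>N. Ph N f (u N))"
\<comment> \<open>The factor \<alpha> normalizes the resolvent function to values in
  \<open>(0, 1]\<close>.\<close>
proof (rule Phi_conv[where \<theta> = "\<lambda>x. \<alpha> * (1 / (\<alpha> + x))" and \<eta> = "\<lambda>s. \<alpha> / s - \<alpha>"])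
  note r = C0_halfline_resolvent[OF \<alpha>(1)]
  show "(\<lambda>x. \<alpha> * (1 / (\<alpha> + x))) \<in> C0_halfline" by (rule C0_halfline_cmult[OF r])
  fix v assume v: "sc v"
  have "Ph N (\<lambda>x. \<alpha> * (1 / (\<alpha> + x))) (v N) = \<alpha> *\<^sub>R G N \<alpha> (v N)" for N
    using R.Phi_cmult[OF r scD(1)[OF v], where c = \<alpha>] R.Phi_resolvent[OF \<alpha>(1) scD(1)[OF v]] by simp
  then show "sc (\<lambda>N. Ph N (\<lambda>x. \<alpha> * (1 / (\<alpha> + x))) (v N))"
    using sc_scale[of "\<lambda>N. G N \<alpha> (v N)" \<alpha>] \<alpha>(2) v by (simp add: conv_at_def)
next
  show "0 < \<alpha> * (1 / (\<alpha> + x)) \<and> \<alpha> * (1 / (\<alpha> + x)) \<le> 1 \<and> \<alpha> / (\<alpha> * (1 / (\<alpha> + x))) - \<alpha> = x"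
    if "0 \<le> x" for x using that \<alpha> by (simp add: field_simps)
  show "continuous_on {0<..1} (\<lambda>s. \<alpha> / s - \<alpha>)" by (auto intro!: continuous_intros)
  show "0 \<le> \<alpha> / s - \<alpha>" if "0 < s" "s \<le> 1" for s using that \<alpha> by (simp add: field_simps)
  have "filterlim (\<lambda>s. \<alpha> * inverse s) at_top (at_right 0)"
    by (rule filterlim_tendsto_pos_mult_at_top[OF tendsto_const \<alpha>(1) filterlim_inverse_at_top_right])
  from filterlim_tendsto_add_at_top[OF tendsto_const this, of "- \<alpha>"]
  show "filterlim (\<lambda>s. \<alpha> / s - \<alpha>) at_top (at_right 0)"
    by (simp add: divide_inverse add.commute)
qed (fact f u)+

lemma resolvents_conv_if_conv_at:
  assumes "0 < \<alpha>" "conv_at \<alpha>"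
  shows "resolvents_conv H ip C \<Psi> G"
  unfolding resolvents_conv_iff
proof (intro allI impI)
  fix \<beta> :: real assume \<beta>: "0 < \<beta>"
  have "sc (\<lambda>N. G N \<beta> (u N))" if u: "sc u" for u
  proof -
    have "sc (\<lambda>N. Ph N (\<lambda>x. 1 / (\<beta> + x)) (u N))"
      by (rule Phi_conv_resolvent[OF assms C0_halfline_resolvent[OF \<beta>] u])
    then show ?thesis using R.Phi_resolvent[OF \<beta> scD(1)[OF u]] by simp
  qed
  then show "conv_at \<beta>" by (simp add: conv_at_def)
qed

lemma power_semigroup_conv_iff:
  assumes "0 < t" "0 \<le> p"
  shows "operators_strongly_conv H ip C \<Psi>
      (\<lambda>N. gen_power (H N) (ip N) (G N) p \<circ> gen_semigroup (H N) (ip N) (G N) t) \<longleftrightarrow>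
    (\<forall>u. sc u \<longrightarrow> sc (\<lambda>N. Ph N (\<lambda>x. xpow p x * exp (- t * x)) (u N)))"
proof -
  let ?L = "\<lambda>N. gen_power (H N) (ip N) (G N) p \<circ> gen_semigroup (H N) (ip N) (G N) t"
  note h = C0_halfline_xpow_exp[OF assms]
  have L: "?L N v = Ph N (\<lambda>x. xpow p x * exp (- t * x)) v" if "v \<in> H N" for N v
    using R.gen_power_semigroup_eq[OF assms that] by simp
  have "bounded_operator (H N) (ip N) (?L N)" for N
    using R.Phi_bounded_operator[OF h, of N] L[of _ N]
    unfolding bounded_operator_def linear_between_def image_subset_iff by simp
  moreover have "(\<lambda>N. ?L N (u N)) = (\<lambda>N. Ph N (\<lambda>x. xpow p x * exp (- t * x)) (u N))" if "sc u" for u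
    using L scD(1)[OF that] by blast
  ultimately show ?thesis unfolding operators_strongly_conv_def by simp
qed

theorem resolvents_conv_iff_powers:
  "resolvents_conv H ip C \<Psi> G \<longleftrightarrow> powers_of_semigroups_conv H ip C \<Psi> G"
proof
  assume "resolvents_conv H ip C \<Psi> G"
  then have "conv_at 1" by (simp add: resolvents_conv_iff)
  then show "powers_of_semigroups_conv H ip C \<Psi> G"
    using Phi_conv_resolvent[of 1] C0_halfline_xpow_exp
    by (auto simp: powers_of_semigroups_conv_def power_semigroup_conv_iff)
next
  assume "powers_of_semigroups_conv H ip C \<Psi> G"
  \<comment> \<open>The instance \<open>t = 1\<close>, \<open>p = 0\<close> is the operator of
    \<open>exp (- x)\<close>, which generates the calculus by way of the inverse
    \<open>- ln s\<close>.\<close>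
  then have "operators_strongly_conv H ip C \<Psi>
      (\<lambda>N. gen_power (H N) (ip N) (G N) 0 \<circ> gen_semigroup (H N) (ip N) (G N) 1)"
    unfolding powers_of_semigroups_conv_def by simp
  then have exp: "sc (\<lambda>N. Ph N (\<lambda>x. exp (- 1 * x)) (u N))" if "sc u" for u
    using that power_semigroup_conv_iff[of 1 0] by (simp add: xpow_def)
  have "sc (\<lambda>N. Ph N (\<lambda>x. 1 / (1 + x)) (u N))" if u: "sc u" for u
  proof (rule Phi_conv[where \<theta> = "\<lambda>x. exp (- 1 * x)" and \<eta> = "\<lambda>s. - ln s"])
    show "(\<lambda>x::real. exp (- 1 * x)) \<in> C0_halfline" by (rule C0_halfline_exp) simp
    show "continuous_on {0<..1} (\<lambda>s::real. - ln s)" by (auto intro!: continuous_intros)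
    show "filterlim (\<lambda>s::real. - ln s) at_top (at_right 0)"
      using ln_at_0 by (simp add: filterlim_uminus_at_bot)
    show "(\<lambda>x. 1 / (1 + x)) \<in> C0_halfline" by (rule C0_halfline_resolvent) simp
  qed (use u exp in auto)
  then have "conv_at 1"
    using R.Phi_resolvent[of 1] scD(1) by (simp add: conv_at_def)
  then show "resolvents_conv H ip C \<Psi> G" by (rule resolvents_conv_if_conv_at[rotated]) simp
qed

subsection \<open>Recovery sequences\<close>

abbreviation has_rec :: "'a \<Rightarrow> bool" where "has_rec \<equiv> has_recovery_sequence H ip C \<Psi> G"

lemma has_rec_iff:
  "has_rec u \<longleftrightarrow> (\<exists>x :: nat \<Rightarrow> 'a. (\<forall>n. x n \<in> fd n) \<and> sc (section_of x u) \<and>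
      (\<lambda>n. E n (x n) (x n)) \<longlonglongrightarrow> E \<infinity> u u)"
  by (simp add: has_recovery_sequence_def)

text \<open>A diagonal choice among the recovery sequences of the \<open>y k\<close>, with a
  strongly convergent section \<open>v\<close> of limit \<open>u\<close> as reference for distances
  in \<open>H n\<close>.\<close>

lemma recovery_closed:
  assumes u: "u \<in> H \<infinity>" and y: "\<And>k. has_rec (y k)"
    and lim: "(\<lambda>k. nrm \<infinity> (y k - u)) \<longlonglongrightarrow> 0" "(\<lambda>k. E \<infinity> (y k) (y k)) \<longlonglongrightarrow> E \<infinity> u u"
  shows "has_rec u"
proof -
  have "\<forall>k. \<exists>x :: nat \<Rightarrow> 'a. (\<forall>n. x n \<in> fd n) \<and> sc (section_of x (y k)) \<and>
      (\<lambda>n. E n (x n) (x n)) \<longlonglongrightarrow> E \<infinity> (y k) (y k)"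
    using y unfolding has_rec_iff by blast
  from choice[OF this] obtain x :: "nat \<Rightarrow> nat \<Rightarrow> 'a" where x': "\<forall>k. (\<forall>n. x k n \<in> fd n) \<and>
      sc (section_of (x k) (y k)) \<and> (\<lambda>n. E n (x k n) (x k n)) \<longlonglongrightarrow> E \<infinity> (y k) (y k)" by blast
  then have x: "\<And>k n. x k n \<in> fd n" "\<And>k. sc (section_of (x k) (y k))"
    "\<And>k. (\<lambda>n. E n (x k n) (x k n)) \<longlonglongrightarrow> E \<infinity> (y k) (y k)" by blast+
  obtain v where v: "sc v" "v \<infinity> = u" using section_exists[OF u] .
  have "\<forall>\<^sub>F n in sequentially. nrm n (x k n - v n) < nrm \<infinity> (y k - u) + 1 / real (Suc k) \<and>
      dist (E n (x k n) (x k n)) (E \<infinity> (y k) (y k)) < 1 / real (Suc k)" for k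
  proof (rule eventually_conj)
    show "\<forall>\<^sub>F n in sequentially. nrm n (x k n - v n) < nrm \<infinity> (y k - u) + 1 / real (Suc k)"
      using scD(2)[OF sc_diff[OF x(2) v(1)], of k] v(2) by (intro order_tendstoD(2)) auto
    show "\<forall>\<^sub>F n in sequentially. dist (E n (x k n) (x k n)) (E \<infinity> (y k) (y k)) < 1 / real (Suc k)"
      by (rule tendstoD[OF x(3)]) simp
  qed
  then obtain \<kappa> where \<kappa>: "filterlim \<kappa> at_top sequentially" "\<forall>\<^sub>F n in sequentially.
      nrm n (x (\<kappa> n) n - v n) < nrm \<infinity> (y (\<kappa> n) - u) + 1 / real (Suc (\<kappa> n)) \<and>
      dist (E n (x (\<kappa> n) n) (x (\<kappa> n) n)) (E \<infinity> (y (\<kappa> n)) (y (\<kappa> n))) < 1 / real (Suc (\<kappa> n))"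
    by (rule diagonal_choice)
  define z where "z n = x (\<kappa> n) n" for n
  have z: "z n \<in> fd n" "z n \<in> H n" for n
    using x(1) R.form_dom_mem by (simp_all add: z_def)
  have one: "(\<lambda>n. 1 / real (Suc (\<kappa> n))) \<longlonglongrightarrow> 0"
    by (rule filterlim_compose[OF LIMSEQ_Suc[OF lim_1_over_n] \<kappa>(1)])
  have "(\<lambda>n. nrm \<infinity> (y (\<kappa> n) - u) + 1 / real (Suc (\<kappa> n))) \<longlonglongrightarrow> 0 + 0"
    by (intro tendsto_add one filterlim_compose[OF lim(1) \<kappa>(1)])
  then have b: "(\<lambda>n. nrm \<infinity> (y (\<kappa> n) - u) + 1 / real (Suc (\<kappa> n))) \<longlonglongrightarrow> 0" by simp
  have "(\<lambda>n. nrm n (z n - v n)) \<longlonglongrightarrow> 0"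
  proof (rule Lim_null_comparison[OF _ b])
    show "\<forall>\<^sub>F n in sequentially. norm (nrm n (z n - v n))
        \<le> nrm \<infinity> (y (\<kappa> n) - u) + 1 / real (Suc (\<kappa> n))"
      using \<kappa>(2) by eventually_elim (use z scD(1)[OF v(1)] in \<open>simp add: z_def\<close>)
  qed
  then have "sc (section_of z u)"
    using sc_null[OF v(1) z(2)] v(2) by simp
  moreover have "(\<lambda>n. E n (z n) (z n)) \<longlonglongrightarrow> E \<infinity> u u"
  proof -
    have "(\<lambda>n. E n (z n) (z n) - E \<infinity> (y (\<kappa> n)) (y (\<kappa> n))) \<longlonglongrightarrow> 0"
    proof (rule Lim_null_comparison[OF _ one])
      show "\<forall>\<^sub>F n in sequentially. norm (E n (z n) (z n) - E \<infinity> (y (\<kappa> n)) (y (\<kappa> n)))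
          \<le> 1 / real (Suc (\<kappa> n))"
        using \<kappa>(2) by eventually_elim (simp add: z_def dist_norm)
    qed
    from tendsto_add[OF this filterlim_compose[OF lim(2) \<kappa>(1)]] show ?thesis by simp
  qed
  ultimately show ?thesis unfolding has_rec_iff using z(1) by blast
qed

text \<open>The norm of E_1 dominates both the Hilbert norm and the energy seminorm, so
  approximation by elements of \<open>V\<close> meets the hypotheses of
  \<open>recovery_closed\<close>.\<close>

lemma recovery_on_domain_iff:
  "recovery_on_domain H ip C \<Psi> G \<longleftrightarrow> recovery_on_dense_subspace H ip C \<Psi> G"
proof
  interpret E1: inner_on "fd \<infinity>" "form_shift (H \<infinity>) (ip \<infinity>) (G \<infinity>) 1"
    using R.form_shift_inner_on[of 1 \<infinity>] by (simp add: R.form_dom_eq)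
  {
    assume "recovery_on_domain H ip C \<Psi> G"
    moreover have "dense_subspace (fd \<infinity>) (form_shift (H \<infinity>) (ip \<infinity>) (G \<infinity>) 1) (fd \<infinity>)"
      unfolding dense_subspace_def
    proof (intro conjI)
      show "subspace (fd \<infinity>)" by (rule F.subspace)
      have "\<exists>v\<in>fd \<infinity>. E1.nrm (u - v) < \<epsilon>" if "u \<in> fd \<infinity>" "0 < \<epsilon>" for u \<epsilon>
        using that by (intro bexI[of _ u]) auto
      then show "ip_topology (fd \<infinity>) (form_shift (H \<infinity>) (ip \<infinity>) (G \<infinity>) 1) closure_of fd \<infinity> = fd \<infinity>"
        by (simp add: E1.closure_iff)
    qed simp
    ultimately show "recovery_on_dense_subspace H ip C \<Psi> G"
      unfolding recovery_on_domain_def recovery_on_dense_subspace_def by blast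
  }
  assume "recovery_on_dense_subspace H ip C \<Psi> G"
  then obtain V where dense: "dense_subspace (fd \<infinity>) (form_shift (H \<infinity>) (ip \<infinity>) (G \<infinity>) 1) V"
    and rec: "\<forall>u\<in>V. has_rec u"
    unfolding recovery_on_dense_subspace_def by blast
  have V: "V \<subseteq> fd \<infinity>" using dense by (simp add: dense_subspace_def)
  have V_dense: "\<forall>u\<in>fd \<infinity>. \<forall>\<epsilon>>0. \<exists>v\<in>V. E1.nrm (u - v) < \<epsilon>"
    using dense E1.closure_iff[OF V] by (simp add: dense_subspace_def)
  show "recovery_on_domain H ip C \<Psi> G"
    unfolding recovery_on_domain_def
  proof
    fix u assume u: "u \<in> fd \<infinity>"
    have "\<exists>v\<in>V. E1.nrm (u - v) < 1 / real (Suc k)" for k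
      using V_dense u by simp
    then obtain y where y: "\<And>k. y k \<in> V" "\<And>k. E1.nrm (u - y k) < 1 / real (Suc k)" by metis
    have yd: "y k \<in> fd \<infinity>" "y k \<in> H \<infinity>" and uH: "u \<in> H \<infinity>" for k
      using y(1) V R.form_dom_mem u by blast+
    have sq: "form_shift (H \<infinity>) (ip \<infinity>) (G \<infinity>) 1 x x = E \<infinity> x x + ip \<infinity> x x" for x
      by (simp add: form_shift_def)
    have le: "nrm \<infinity> (y k - u) \<le> 1 / real (Suc k)" "F.nrm \<infinity> (y k - u) \<le> 1 / real (Suc k)" for k
    proof -
      have "y k - u \<in> fd \<infinity>" "y k - u \<in> H \<infinity>" using yd u uH by simp_all
      then have "nrm \<infinity> (y k - u) \<le> E1.nrm (y k - u)" "F.nrm \<infinity> (y k - u) \<le> E1.nrm (y k - u)"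
        using F.nonneg[of "y k - u" \<infinity>] Hil.nonneg[of "y k - u" \<infinity>]
        by (simp_all add: ip_norm_def sq)
      moreover have "E1.nrm (y k - u) = E1.nrm (u - y k)"
        using yd u by (intro E1.nrm_commute)
      ultimately show "nrm \<infinity> (y k - u) \<le> 1 / real (Suc k)" "F.nrm \<infinity> (y k - u) \<le> 1 / real (Suc k)"
        using y(2)[of k] by linarith+
    qed
    have one: "(\<lambda>k. 1 / real (Suc k)) \<longlonglongrightarrow> 0" by (rule LIMSEQ_Suc[OF lim_1_over_n])
    show "has_rec u"
    proof (rule recovery_closed[OF uH])
      show "has_rec (y k)" for k using rec y(1) by blast
      show "(\<lambda>k. nrm \<infinity> (y k - u)) \<longlonglongrightarrow> 0"
        by (rule Hil.nrm_null[OF one]) (use yd uH le in auto)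
      have Elim: "(\<lambda>k. F.nrm \<infinity> (y k - u)) \<longlonglongrightarrow> 0"
        by (rule F.nrm_null[OF one]) (use yd u le in auto)
      have "(\<lambda>k. F.nrm \<infinity> (y k)) \<longlonglongrightarrow> F.nrm \<infinity> u"
        by (rule F.nrm_tendsto[OF yd(1) u Elim tendsto_const])
      then have "(\<lambda>k. (F.nrm \<infinity> (y k))\<^sup>2) \<longlonglongrightarrow> (F.nrm \<infinity> u)\<^sup>2" by (rule tendsto_power)
      then show "(\<lambda>k. E \<infinity> (y k) (y k)) \<longlonglongrightarrow> E \<infinity> u u" using yd u by (simp add: F.nrm_sq)
    qed
  qed
qed

subsection \<open>The equivalences\<close>

lemma resolvent_energies_conv_iff:
  "resolvent_energies_conv H ip C \<Psi> G \<longleftrightarrow> (\<forall>u. \<forall>\<alpha>>0. sc u \<longrightarrow>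
     (\<lambda>n. ip n (u n) (G n \<alpha> (u n))) \<longlonglongrightarrow> ip \<infinity> (u \<infinity>) (G \<infinity> \<alpha> (u \<infinity>)))"
  unfolding resolvent_energies_conv_def using scD(1) by (simp add: R.form_shift_GG)

lemma conv_imp_energies:
  "resolvents_conv H ip C \<Psi> G \<Longrightarrow> resolvent_energies_conv H ip C \<Psi> G"
  unfolding resolvent_energies_conv_iff resolvents_conv_iff conv_at_def
  using sc_inner by blast

text \<open>For \<open>G \<infinity> 1 z\<close> the vectors \<open>G n 1 (v n)\<close>, with
  \<open>v\<close> tending strongly to \<open>z\<close>, form a recovery sequence, as their energies
  are inner products of strongly convergent sections. The form core property gives the rest.\<close>

lemma conv_imp_recovery:
  assumes "resolvents_conv H ip C \<Psi> G"
  shows "recovery_on_domain H ip C \<Psi> G"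
  unfolding recovery_on_domain_def
proof
  have conv: "sc (\<lambda>N. G N 1 (v N))" if "sc v" for v
    using assms that by (simp add: resolvents_conv_iff conv_at_def)
  fix u assume u: "u \<in> fd \<infinity>"
  obtain w where w: "\<forall>n. w n \<in> gen_dom (H \<infinity>) (G \<infinity>)"
    "(\<lambda>n. nrm \<infinity> (w n - u)) \<longlonglongrightarrow> 0" "(\<lambda>n. E \<infinity> (w n) (w n)) \<longlonglongrightarrow> E \<infinity> u u"
    using R.form_approx_gen_dom[OF u] by blast
  have rec: "has_rec (w k)" for k
  proof -
    have "w k \<in> G \<infinity> 1 ` H \<infinity>" using w(1) unfolding gen_dom_def by blast
    then obtain z where z: "z \<in> H \<infinity>" "w k = G \<infinity> 1 z" by blast
    obtain v where v: "sc v" "v \<infinity> = z" using section_exists[OF z(1)] .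
    note mem = scD(1)[OF v(1)]
    have "(\<lambda>n. ip n (v n) (G n 1 (v n))
        - 1 * ip n (G n 1 (v n)) (G n 1 (v n)))
      \<longlonglongrightarrow> ip \<infinity> (v \<infinity>) (G \<infinity> 1 (v \<infinity>)) - 1 * ip \<infinity> (G \<infinity> 1 (v \<infinity>)) (G \<infinity> 1 (v \<infinity>))"
      by (intro tendsto_intros sc_inner[OF v(1) conv[OF v(1)]] sc_sq[OF conv[OF v(1)]])
    then have "(\<lambda>n. E n (G n 1 (v n)) (G n 1 (v n)))
        \<longlonglongrightarrow> E \<infinity> (w k) (w k)"
      using mem v(2) z by (simp add: R.form_GG)
    moreover have "sc (section_of (\<lambda>n. G n 1 (v n)) (w k))"
      using conv[OF v(1)] section_of_eta[of "\<lambda>N. G N 1 (v N)"] v(2) z(2) by simp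
    ultimately show ?thesis
      unfolding has_rec_iff using mem R.G_form_dom[of 1]
      by (intro exI[of _ "\<lambda>n :: nat. G n 1 (v n)"]) simp
  qed
  show "has_rec u" by (rule recovery_closed[OF R.form_dom_mem[OF u] rec w(2,3)])
qed

lemma conv_imp_liminf:
  assumes "resolvents_conv H ip C \<Psi> G"
  shows "energy_liminf H ip C \<Psi> G"
  unfolding energy_liminf_def
proof (intro allI impI)
  fix u assume u: "wc u"
  show "energy (H \<infinity>) (ip \<infinity>) (G \<infinity>) (u \<infinity>)
      \<le> liminf (\<lambda>n. energy (H n) (ip n) (G n) (u n))"
  proof (rule R.energy_le_yosida)
    show "u \<infinity> \<in> H \<infinity>" by (rule wcD(1)[OF u])
    fix \<beta> :: real assume \<beta>: "0 < \<beta>"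
    \<comment> \<open>Point of linearization: the affine lower bound of the energy at
      \<open>v\<close> converges, although the Yosida form at the weakly convergent \<open>u\<close>
      need not.\<close>
    obtain v where v: "sc v" "v \<infinity> = u \<infinity>" using section_exists[OF wcD(1)[OF u]] .
    define Y where "Y N a c = \<beta> * ip N (a - \<beta> *\<^sub>R G N \<beta> a) c" for N a c
    have Y: "R.yosida N \<beta> a c = Y N a c" for N a c by (simp add: Y_def R.yosida_def)
    have d: "sc (\<lambda>N. v N - \<beta> *\<^sub>R G N \<beta> (v N))"
      using assms v \<beta> by (intro sc_diff sc_scale) (auto simp: resolvents_conv_iff conv_at_def)
    have "ip N (u N) (v N - \<beta> *\<^sub>R G N \<beta> (v N)) = ip N (v N - \<beta> *\<^sub>R G N \<beta> (v N)) (u N)" for N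
      using wcD(1)[OF u] scD(1)[OF d] by (intro Hil.sym)
    then have "(\<lambda>n. Y n (v n) (u n)) \<longlonglongrightarrow> Y \<infinity> (v \<infinity>) (u \<infinity>)"
      using tendsto_mult_left[OF wcD(2)[OF u d], of \<beta>] by (simp add: Y_def)
    moreover have "(\<lambda>n. Y n (v n) (v n)) \<longlonglongrightarrow> Y \<infinity> (v \<infinity>) (v \<infinity>)"
      using tendsto_mult_left[OF sc_inner[OF d v(1)], of \<beta>] by (simp add: Y_def)
    ultimately have "(\<lambda>n. 2 * Y n (v n) (u n) - Y n (v n) (v n))
        \<longlonglongrightarrow> 2 * Y \<infinity> (v \<infinity>) (u \<infinity>) - Y \<infinity> (v \<infinity>) (v \<infinity>)" by (intro tendsto_intros)
    then have lim: "(\<lambda>n. 2 * Y n (v n) (u n) - Y n (v n) (v n))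
        \<longlonglongrightarrow> Y \<infinity> (u \<infinity>) (u \<infinity>)" using v(2) by simp
    have "ereal (Y \<infinity> (u \<infinity>) (u \<infinity>)) = liminf (\<lambda>n. ereal
        (2 * Y n (v n) (u n) - Y n (v n) (v n)))"
      using lim by (intro lim_imp_Liminf[symmetric]) auto
    also have "\<dots> \<le> liminf (\<lambda>n. energy (H n) (ip n) (G n) (u n))"
      using R.yosida_le_energy[OF \<beta> wcD(1)[OF u] scD(1)[OF v(1)]]
      by (intro Liminf_mono always_eventually) (simp add: Y)
    finally show "ereal (R.yosida \<infinity> \<beta> (u \<infinity>) (u \<infinity>))
        \<le> liminf (\<lambda>n. energy (H n) (ip n) (G n) (u n))"
      by (simp add: Y)
  qed
qed

lemma energies_recovery_imp_conv:
  assumes "resolvent_energies_conv H ip C \<Psi> G" "recovery_on_domain H ip C \<Psi> G"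
  shows "resolvents_conv H ip C \<Psi> G"
proof (rule resolvents_conv_if_conv_at)
  show "(0::real) < 1" by simp
  show "conv_at 1"
    unfolding conv_at_def
  proof (intro allI impI)
    fix u assume u: "sc u"
    note mem = scD(1)[OF u]
    let ?w = "G \<infinity> 1 (u \<infinity>)"
    have w: "?w \<in> fd \<infinity>" using mem by (intro R.G_form_dom) auto
    then obtain x :: "nat \<Rightarrow> 'a" where x: "\<And>n. x n \<in> fd n" "sc (section_of x ?w)"
      "(\<lambda>n. E n (x n) (x n)) \<longlonglongrightarrow> E \<infinity> ?w ?w"
      using assms(2) unfolding recovery_on_domain_def has_rec_iff by blast
    have xH: "x n \<in> H n" for n using x(1) by (rule R.form_dom_mem)
    have "(\<lambda>n. ip n (u n) (G n 1 (u n))) \<longlonglongrightarrow> ip \<infinity> (u \<infinity>) ?w"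
      using assms(1) u unfolding resolvent_energies_conv_iff by simp
    moreover have "(\<lambda>n. ip n (u n) (x n)) \<longlonglongrightarrow> ip \<infinity> (u \<infinity>) ?w"
      using sc_inner[OF u x(2)] by simp
    moreover have "(\<lambda>n. ip n (x n) (x n)) \<longlonglongrightarrow> ip \<infinity> ?w ?w"
      using sc_sq[OF x(2)] by simp
    ultimately have "(\<lambda>n. ip n (u n) (G n 1 (u n))
        - 2 * ip n (u n) (x n) + (E n (x n) (x n) + 1 * ip n (x n) (x n)))
      \<longlonglongrightarrow> ip \<infinity> (u \<infinity>) ?w - 2 * ip \<infinity> (u \<infinity>) ?w + (E \<infinity> ?w ?w + 1 * ip \<infinity> ?w ?w)"
      using x(3) by (intro tendsto_intros)
    \<comment> \<open>By \<open>form_GG\<close> the bracket equals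
      \<open>ip \<infinity> (u \<infinity>) ?w\<close>, so the bound for the squared distance
      vanishes in the limit.\<close>
    moreover have "ip \<infinity> (u \<infinity>) ?w - 2 * ip \<infinity> (u \<infinity>) ?w + (E \<infinity> ?w ?w + 1 * ip \<infinity> ?w ?w) = 0"
      using mem by (simp add: R.form_GG)
    ultimately have "(\<lambda>n. ip n (u n) (G n 1 (u n))
        - 2 * ip n (u n) (x n) + (E n (x n) (x n) + 1 * ip n (x n) (x n)))
      \<longlonglongrightarrow> 0" (is "?c \<longlonglongrightarrow> 0") by simp
    then have c: "(\<lambda>n. sqrt (?c n)) \<longlonglongrightarrow> 0" using tendsto_real_sqrt by fastforce
    have "(\<lambda>n. nrm n (G n 1 (u n) - x n)) \<longlonglongrightarrow> 0"
    proof (rule Lim_null_comparison[OF _ c], intro always_eventually allI)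
      fix n
      have "1 * (nrm n (G n 1 (u n) - x n))\<^sup>2 \<le> ?c n"
        using mem x(1) by (intro R.resolvent_gap) auto
      then show "norm (nrm n (G n 1 (u n) - x n)) \<le> sqrt (?c n)"
        using mem xH by (simp add: real_le_rsqrt)
    qed
    then have "sc (section_of (\<lambda>n. G n 1 (u n)) ?w)"
      using sc_null[OF x(2), of "\<lambda>n. G n 1 (u n)"] mem by simp
    then show "sc (\<lambda>N. G N 1 (u N))" using section_of_eta[of "\<lambda>N. G N 1 (u N)"] by simp
  qed
qed

lemma liminf_imp_resolvent_liminf:
  assumes "energy_liminf H ip C \<Psi> G"
  shows "resolvent_energy_liminf H ip C \<Psi> G"
  unfolding resolvent_energy_liminf_def
proof (intro exI[of _ 1] conjI ballI allI impI)
  fix \<phi> r u assume \<phi>: "\<phi> \<in> C"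
  let ?x = "\<lambda>n. G n 1 (\<Psi> n \<phi>)"
  let ?e = "\<lambda>n :: nat. energy (H n) (ip n) (G n)"
  assume w: "subseq_weakly_conv H ip C \<Psi> r ?x u"
  then have r: "strict_mono r" by (simp add: subseq_weakly_conv_def)
  have "u \<in> H \<infinity>" using w by (rule subseq_weakly_conv_mem)
  then obtain v where v: "sc v" "v \<infinity> = u" by (rule section_exists)
  let ?U = "section_of (\<lambda>n. if n \<in> range r then ?x n else v n) u"
  have "wc ?U" using \<phi> by (intro wc_fill[OF w v]) auto
  then have "energy (H \<infinity>) (ip \<infinity>) (G \<infinity>) (?U \<infinity>) \<le> liminf (\<lambda>n. ?e n (?U n))"
    using assms unfolding energy_liminf_def by blast
  also have "\<dots> \<le> liminf ((\<lambda>n. ?e n (?U n)) \<circ> r)"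
    by (rule liminf_subseq_mono[OF r])
  finally show "energy (H \<infinity>) (ip \<infinity>) (G \<infinity>) u \<le> liminf (\<lambda>k. ?e (r k) (?x (r k)))"
    by (simp add: o_def)
qed simp

text \<open>If the distance from the resolvents to a recovery sequence of
  \<open>G \<infinity> \<alpha> \<phi>\<close> did not tend to 0, a weakly convergent subsequence
  would keep it above some \<epsilon>. The gap estimate then makes <\<phi>, u> exceed <\<phi>, w>
  strictly, while the lower bound of energies at the weak limit \<open>u\<close> gives the opposite
  inequality. Density of \<open>C\<close> and contractivity extend the result from
  \<open>\<Psi> N \<phi>\<close> to all strongly convergent sections.\<close>

lemma resolvent_liminf_recovery_imp_conv:
  assumes "resolvent_energy_liminf H ip C \<Psi> G" "recovery_on_domain H ip C \<Psi> G"
  shows "resolvents_conv H ip C \<Psi> G"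
proof -
  let ?e = "\<lambda>n :: nat. energy (H n) (ip n) (G n)"
  obtain \<alpha> where \<alpha>: "0 < \<alpha>" and liminf: "\<And>\<phi> r u. \<lbrakk>\<phi> \<in> C;
      subseq_weakly_conv H ip C \<Psi> r (\<lambda>n. G n \<alpha> (\<Psi> n \<phi>)) u\<rbrakk> \<Longrightarrow>
      energy (H \<infinity>) (ip \<infinity>) (G \<infinity>) u \<le> liminf (\<lambda>k. ?e (r k) (G (r k) \<alpha> (\<Psi> (r k) \<phi>)))"
    using assms(1) unfolding resolvent_energy_liminf_def by blast
  have core: "sc (\<lambda>N. G N \<alpha> (\<Psi> N \<phi>))" if \<phi>: "\<phi> \<in> C" for \<phi>
  proof -
    define x where "x n = G n \<alpha> (\<Psi> n \<phi>)" for n :: nat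
    define w where "w = G \<infinity> \<alpha> \<phi>"
    note \<phi>H = C_mem[OF \<phi>]
    have x: "x n \<in> H n" "x n \<in> fd n" for n
      using \<phi> \<alpha> R.G_form_dom by (simp_all add: x_def)
    have w: "w \<in> H \<infinity>" "w \<in> fd \<infinity>" using \<phi>H \<alpha> R.G_form_dom by (simp_all add: w_def)
    obtain y :: "nat \<Rightarrow> 'a" where y: "\<And>n. y n \<in> fd n" "sc (section_of y w)"
      "(\<lambda>n. E n (y n) (y n)) \<longlonglongrightarrow> E \<infinity> w w"
      using assms(2) w(2) unfolding recovery_on_domain_def has_rec_iff by blast
    have yH: "y n \<in> H n" for n using y(1) by (rule R.form_dom_mem)
    define q where "q n = ip n (\<Psi> n \<phi>) (x n)" for n :: nat
    \<comment> \<open>The part of the gap bound that converges along the whole sequence;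
      \<open>q\<close> is controlled along weakly convergent subsequences.\<close>
    define c where "c n = - 2 * ip n (\<Psi> n \<phi>) (y n)
      + (E n (y n) (y n) + \<alpha> * ip n (y n) (y n))" for n :: nat
    have gap: "\<alpha> * (nrm n (x n - y n))\<^sup>2 \<le> q n + c n" for n
      using R.resolvent_gap[OF \<alpha> Psi_mem[OF \<phi>] y(1)[of n]] unfolding x_def q_def c_def by linarith
    have "c \<longlonglongrightarrow> - 2 * ip \<infinity> \<phi> w + (E \<infinity> w w + \<alpha> * ip \<infinity> w w)"
      unfolding c_def using sc_inner[OF Psi_sc[OF \<phi>] y(2)] sc_sq[OF y(2)] y(3) \<phi>
      by (intro tendsto_intros) auto
    then have c: "c \<longlonglongrightarrow> - ip \<infinity> \<phi> w"
      using \<phi>H \<alpha> by (simp add: w_def R.form_GG)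
    have "(\<lambda>n. nrm n (x n - y n)) \<longlonglongrightarrow> 0"
    proof (rule ccontr)
      assume "\<not> (\<lambda>n. nrm n (x n - y n)) \<longlonglongrightarrow> 0"
      then obtain \<epsilon> where \<epsilon>: "0 < \<epsilon>" "\<not> (\<forall>\<^sub>F n in sequentially. nrm n (x n - y n) < \<epsilon>)"
        using x yH unfolding tendsto_iff by (auto simp: dist_norm)
      have "\<exists>n>m. \<epsilon> \<le> nrm n (x n - y n)" for m :: nat
      proof (rule ccontr)
        assume "\<not> (\<exists>n>m. \<epsilon> \<le> nrm n (x n - y n))"
        then have "\<forall>n\<ge>Suc m. nrm n (x n - y n) < \<epsilon>" by (simp add: Suc_le_eq not_le)
        then show False using \<epsilon>(2) unfolding eventually_sequentially by blast
      qed
      then have "infinite {n. \<epsilon> \<le> nrm n (x n - y n)}"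
        unfolding infinite_nat_iff_unbounded by blast
      from infinite_enumerate[OF this] obtain r0 :: "nat \<Rightarrow> nat" where
        r0: "strict_mono r0" "\<forall>k. r0 k \<in> {n. \<epsilon> \<le> nrm n (x n - y n)}" by blast
      interpret sub: converging "H \<circ> subindex r0" "ip \<circ> subindex r0" C "\<Psi> \<circ> subindex r0"
        by (rule subindex_converging[OF r0(1)])
      have "Bseq (\<lambda>n. nrm n (\<Psi> n \<phi>))"
        using scD(2)[OF Psi_sc[OF \<phi>]] by (intro convergent_imp_Bseq convergentI)
      then obtain B where B: "\<And>n::nat. norm (nrm n (\<Psi> n \<phi>)) \<le> B" by (auto simp: Bseq_def)
      have bound: "nrm n (x n) \<le> B / \<alpha>" for n
      proof -
        have "\<alpha> * nrm n (x n) \<le> nrm n (\<Psi> n \<phi>)"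
          unfolding x_def using \<alpha> \<phi> by (intro R.G_contraction) auto
        also have "\<dots> \<le> B" using B[of n] by simp
        finally show ?thesis using \<alpha> by (simp add: field_simps)
      qed
      obtain r1 u where r1: "subseq_weakly_conv (H \<circ> subindex r0) (ip \<circ> subindex r0) C
          (\<Psi> \<circ> subindex r0) r1 (x \<circ> r0) u"
        by (rule sub.weakly_conv_subsequence[of "x \<circ> r0" "B / \<alpha>"]) (use x bound in auto)
      define r where "r = r0 \<circ> r1"
      have weak: "subseq_weakly_conv H ip C \<Psi> r x u"
        using r1 r0(1) unfolding subseq_weakly_conv_def r_def
        by (simp add: o_assoc[symmetric] subindex_compose strict_mono_o)
      then have r: "strict_mono r" by (simp add: subseq_weakly_conv_def)
      have test: "(\<lambda>k. ip (r k) (x (r k)) (v (r k))) \<longlonglongrightarrow> ip \<infinity> u (v \<infinity>)" if "sc v" for v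
        using weak subindex_sc[OF r that] unfolding subseq_weakly_conv_def weakly_conv_def
        by (auto simp: o_def dest!: spec[of _ "v \<circ> subindex r"])
      have u: "u \<in> H \<infinity>" using weak by (rule subseq_weakly_conv_mem)
      then obtain v where v: "sc v" "v \<infinity> = u" by (rule section_exists)
      have "q (r k) = ip (r k) (x (r k)) (\<Psi> (r k) \<phi>)" for k
        unfolding q_def using x \<phi> by (intro Hil.sym) auto
      then have q: "(\<lambda>k. q (r k)) \<longlonglongrightarrow> ip \<infinity> \<phi> u"
        using test[OF Psi_sc[OF \<phi>]] \<phi> Hil.sym[OF u \<phi>H] by simp
      \<comment> \<open>The weakly convergent \<open>x\<close> enters linearly here:
        \<open>2 <x, v> - <v, v>\<close> is a lower bound for \<open><x, x>\<close> that converges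
        when \<open>v\<close> tends strongly to \<open>u\<close>.\<close>
      define d where "d k = q (r k) - \<alpha> * (2 * ip (r k) (x (r k)) (v (r k))
        - ip (r k) (v (r k)) (v (r k)))" for k
      have "(\<lambda>k. ip (r k) (v (r k)) (v (r k))) \<longlonglongrightarrow> ip \<infinity> u u"
        using LIMSEQ_subseq_LIMSEQ[OF sc_sq[OF v(1)] r] v(2) by (simp add: o_def)
      moreover have "(\<lambda>k. ip (r k) (x (r k)) (v (r k))) \<longlonglongrightarrow> ip \<infinity> u u"
        using test[OF v(1)] v(2) by simp
      ultimately have "d \<longlonglongrightarrow> ip \<infinity> \<phi> u - \<alpha> * (2 * ip \<infinity> u u - ip \<infinity> u u)"
        unfolding d_def using q by (intro tendsto_intros)
      then have d: "d \<longlonglongrightarrow> ip \<infinity> \<phi> u - \<alpha> * ip \<infinity> u u" by simp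
      have ed: "?e (r k) (x (r k)) \<le> ereal (d k)" for k
      proof -
        have "E (r k) (x (r k)) (x (r k)) = q (r k) - \<alpha> * ip (r k) (x (r k)) (x (r k))"
          unfolding x_def q_def using \<alpha> \<phi> by (intro R.form_GG) auto
        moreover have "\<alpha> * (2 * ip (r k) (x (r k)) (v (r k))
            - ip (r k) (v (r k)) (v (r k))) \<le> \<alpha> * ip (r k) (x (r k)) (x (r k))"
          using Hil.young[OF x(1) scD(1)[OF v(1)], of "r k"] \<alpha> by (intro mult_left_mono) auto
        ultimately show ?thesis using x(2) by (simp add: energy_def d_def)
      qed
      have "energy (H \<infinity>) (ip \<infinity>) (G \<infinity>) u \<le> liminf (\<lambda>k. ?e (r k) (x (r k)))"
        unfolding x_def using liminf[OF \<phi>] weak unfolding x_def by blast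
      also have "\<dots> \<le> liminf (\<lambda>k. ereal (d k))"
        using ed by (intro Liminf_mono always_eventually) auto
      also have "\<dots> = ereal (ip \<infinity> \<phi> u - \<alpha> * ip \<infinity> u u)"
        using d by (intro lim_imp_Liminf) auto
      finally have uE: "u \<in> fd \<infinity>" "E \<infinity> u u \<le> ip \<infinity> \<phi> u - \<alpha> * ip \<infinity> u u"
        by (auto simp: energy_def split: if_splits)
      \<comment> \<open>Minimality of \<open>w\<close> in the limit space, tested at the weak limit
        \<open>u\<close>.\<close>
      have "0 \<le> \<alpha> * (nrm \<infinity> (w - u))\<^sup>2" using \<alpha> by simp
      also have "\<dots> \<le> ip \<infinity> \<phi> w - 2 * ip \<infinity> \<phi> u + (E \<infinity> u u + \<alpha> * ip \<infinity> u u)"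
        unfolding w_def by (rule R.resolvent_gap[OF \<alpha> \<phi>H uE(1)])
      also have "\<dots> \<le> ip \<infinity> \<phi> w - ip \<infinity> \<phi> u" using uE(2) by linarith
      finally have le: "ip \<infinity> \<phi> u \<le> ip \<infinity> \<phi> w" by simp
      have lim: "(\<lambda>k. q (r k) + c (r k)) \<longlonglongrightarrow> ip \<infinity> \<phi> u + - ip \<infinity> \<phi> w"
        using tendsto_add[OF q LIMSEQ_subseq_LIMSEQ[OF c r]] by (simp add: o_def)
      have "\<alpha> * \<epsilon>\<^sup>2 \<le> q (r k) + c (r k)" for k
      proof -
        have "\<epsilon>\<^sup>2 \<le> (nrm (r k) (x (r k) - y (r k)))\<^sup>2"
          using r0(2) \<epsilon>(1) by (intro power_mono) (simp_all add: r_def)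
        then have "\<alpha> * \<epsilon>\<^sup>2 \<le> \<alpha> * (nrm (r k) (x (r k) - y (r k)))\<^sup>2"
          using \<alpha> by (intro mult_left_mono) auto
        also have "\<dots> \<le> q (r k) + c (r k)" by (rule gap)
        finally show ?thesis .
      qed
      then have "\<alpha> * \<epsilon>\<^sup>2 \<le> ip \<infinity> \<phi> u + - ip \<infinity> \<phi> w" by (intro LIMSEQ_le_const[OF lim]) auto
      moreover have "0 < \<alpha> * \<epsilon>\<^sup>2" using \<alpha> \<epsilon>(1) by simp
      ultimately show False using le by linarith
    qed
    then have "sc (section_of x w)" using sc_null[OF y(2) x(1)] by simp
    then show ?thesis
      using section_of_eta[of "\<lambda>N. G N \<alpha> (\<Psi> N \<phi>)"] \<phi> by (simp add: x_def[abs_def] w_def)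
  qed
  have "conv_at \<alpha>"
    unfolding conv_at_def
  proof (intro allI impI)
    fix u assume u: "sc u"
    note mem = scD(1)[OF u]
    show "sc (\<lambda>N. G N \<alpha> (u N))"
    proof (rule sc_closed)
      show "G N \<alpha> (u N) \<in> H N" for N using \<alpha> mem by simp
      fix \<epsilon> :: real assume "0 < \<epsilon>"
      then have "0 < \<alpha> * \<epsilon>" using \<alpha> by simp
      then obtain \<phi> where \<phi>: "\<phi> \<in> C" "nrm \<infinity> (u \<infinity> - \<phi>) < \<alpha> * \<epsilon>" using C_dense[OF mem] by blast
      have dist: "nrm N (G N \<alpha> (u N) - G N \<alpha> (\<Psi> N \<phi>)) \<le> \<epsilon>" if "nrm N (u N - \<Psi> N \<phi>) < \<alpha> * \<epsilon>" for N
      proof -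
        have "\<alpha> * nrm N (G N \<alpha> (u N - \<Psi> N \<phi>)) \<le> nrm N (u N - \<Psi> N \<phi>)"
          using \<alpha> mem \<phi> by (intro R.G_contraction) auto
        then have "\<alpha> * nrm N (G N \<alpha> (u N) - G N \<alpha> (\<Psi> N \<phi>)) \<le> \<alpha> * \<epsilon>"
          using that unfolding R.G_diff[OF \<alpha> mem Psi_mem[OF \<phi>(1)]] by linarith
        then show ?thesis using \<alpha> by simp
      qed
      have "\<forall>\<^sub>F n in sequentially. nrm n (u n - \<Psi> n \<phi>) < \<alpha> * \<epsilon>"
        by (rule order_tendstoD(2)[OF sc_diff_Psi[OF u \<phi>(1)] \<phi>(2)])
      then have "\<forall>\<^sub>F n in sequentially.
          nrm n (G n \<alpha> (u n) - G n \<alpha> (\<Psi> n \<phi>)) \<le> \<epsilon>"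
        by eventually_elim (rule dist)
      moreover have "nrm \<infinity> (G \<infinity> \<alpha> (u \<infinity>) - G \<infinity> \<alpha> (\<Psi> \<infinity> \<phi>)) \<le> \<epsilon>"
        using \<phi> by (intro dist) simp
      ultimately show "\<exists>v. sc v \<and> nrm \<infinity> (G \<infinity> \<alpha> (u \<infinity>) - v \<infinity>) \<le> \<epsilon> \<and>
          (\<forall>\<^sub>F n in sequentially. nrm n (G n \<alpha> (u n) - v n) \<le> \<epsilon>)"
        using core[OF \<phi>(1)] by blast
    qed
  qed
  then show ?thesis by (rule resolvents_conv_if_conv_at[OF \<alpha>])
qed

end

theorem theorem3p4:
  fixes H :: "enat \<Rightarrow> 'a::real_vector set"
    and ip :: "enat \<Rightarrow> 'a \<Rightarrow> 'a \<Rightarrow> real"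
    and C :: "'a set"
    and \<Psi> :: "enat \<Rightarrow> 'a \<Rightarrow> 'a"
    and G :: "enat \<Rightarrow> real \<Rightarrow> 'a \<Rightarrow> 'a"
  assumes "converging_hilbert_spaces H ip C \<Psi>"
    and "\<And>N. symmetric_resolvent (H N) (ip N) (G N)"
  shows "(resolvents_conv H ip C \<Psi> G \<longleftrightarrow>
            resolvent_energies_conv H ip C \<Psi> G \<and> recovery_on_domain H ip C \<Psi> G) \<and>
         (resolvents_conv H ip C \<Psi> G \<longleftrightarrow>
            energy_liminf H ip C \<Psi> G \<and> recovery_on_dense_subspace H ip C \<Psi> G) \<and>
         (resolvents_conv H ip C \<Psi> G \<longleftrightarrow>
            resolvent_energy_liminf H ip C \<Psi> G \<and> recovery_on_dense_subspace H ip C \<Psi> G) \<and>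
         (resolvents_conv H ip C \<Psi> G \<longleftrightarrow> powers_of_semigroups_conv H ip C \<Psi> G)"
proof -
  interpret converging_resolvents H ip C \<Psi> G
    using assms by unfold_locales
  \<comment> \<open>Both versions of recovery being equivalent, the cycle runs from (i) to the lower
    bound in (iii), from there to the one in (iv), and back to (i) by recovery; (ii) and (v) are
    each linked to (i) directly.\<close>
  show ?thesis
    using conv_imp_energies conv_imp_recovery conv_imp_liminf energies_recovery_imp_conv
      liminf_imp_resolvent_liminf resolvent_liminf_recovery_imp_conv
      recovery_on_domain_iff resolvents_conv_iff_powers
    by blast
qed

end
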